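(* Let $R = R_0[x_1,\ldots,x_d]$ be a commutative Noetherian $\mathbb{N}$-graded algebra, where $R_0$ is the degree-$0$ component of $R$ and the $x_i$ are homogeneous with $\deg(x_i)\ge 1$ for $1\le i\le d$. Let $M$ be a finitely generated $\mathbb{Z}$-graded $R$-module, $N$ a graded submodule of $M$, and $I$ a homogeneous ideal of $R$. Let $J$ be a reduction ideal of $I$ (possibly $J=I$), generated by homogeneous elements $y_1,\ldots,y_c$ of degrees $d_1\le\cdots\le d_c$ respectively. Assume that $(0:_M I)=0$. (1) Let $\mathfrak{p}\in\mathcal{A}_N^M(I)$ be such that $I\subseteq\mathfrak{p}$. Then there exist $a\in\{d_1,\ldots,d_c\}$ and $b\in\mathbb{Z}$ such that $v_{\mathfrak{p}}(M/I^nN) = an+b$ for all $n\gg 0$. Moreover, if $\mathcal{B}_{IN}^M(I) = \mathcal{A}_N^M(I)$, then $v_{\mathfrak{p}}(I^nM/I^{n+1}N) = v_{\mathfrak{p}}(M/I^{n+1}N)$ for all $n \gg 0$. (2) Let $\mathcal{A}_N^M(I)\neq \emptyset$, and suppose $I^{n_0}M\subseteq N$ for some $n_0$ (e.g., $N=M$, or $N=\mathfrak{a}M$ for some homogeneous ideal $\mathfrak{a}$ satisfying $I \subseteq \sqrt{\mathfrak{a}}$). Then the functions $$\mathrm{indeg}\big( I^nM/I^{n+1}N \big),\quad v\big( I^nM/I^{n+1}N \big)\quad\text{and}\quad v\big( M/I^{n+1}N \big)$$ are all eventually linear in $n$ with the same leading coefficient $d_{\gamma} \in \{d_1,\ldots,d_c\}$,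 where $$\gamma = \inf\left\{j : y_j\notin\sqrt{\mathrm{ann}_{\mathscr{R}(J)} (\mathscr{G})},\ 1 \le j \le c \right\}\quad\text{and}\quad \mathscr{G} := \mathscr{R}(I,M)/\mathscr{R}(I,IN).$$ In addition, if $\mathcal{B}_{IN}^M(I) = \mathcal{A}_N^M(I)$, then $v\big( I^nM/I^{n+1}N \big) = v\big( M/I^{n+1}N \big)$ for all $n \gg 0$. (3) In the situation of (2), when $(0 :_M y_1) = 0$ and $d_1\ge 1$, the leading coefficient in (2) is $d_{\gamma} = d_1$.
   Context: For a finitely generated $\mathbb{Z}$-graded $R$-module $L=\bigoplus_{u}L_u$: $\mathrm{indeg}(L) := \inf\{n : L_n\neq 0\}$, with $\mathrm{indeg}(0)=\infty$. For $\mathfrak{p}\in\mathrm{Ass}_R(L)$, the v-number of $L$ at $\mathfrak{p}$ is $v_{\mathfrak{p}}(L) := \inf\{ u : \text{there exists } x\in L_u \text{ such that } \mathfrak{p} = (0:_R x)\}$. The v-number of $L$ is $v(L) := \inf\{v_{\mathfrak{p}}(L) : \mathfrak{p}\in\mathrm{Ass}_R(L)\}$, with $v(0)=\infty$. For an ideal $\mathfrak{b}$ (or element) of $R$, $(0:_M\mathfrak{b}) := \{x\in M:\mathfrak{b}x=0\}$. It is known that, for any graded submodule $N$ of $M$, the sets $\mathrm{Ass}_R(I^nM/I^nN)$ and $\mathrm{Ass}_R(M/I^nN)$ are each the same for all $n\gg 0$. Their eventual values are denoted $\mathcal{B}_N^M(I) := \mathrm{Ass}_R(I^nM/I^nN)$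 and $\mathcal{A}_N^M(I) := \mathrm{Ass}_R(M/I^nN)$ for all $n\gg0$. In particular $\mathcal{B}_{IN}^M(I)=\mathrm{Ass}_R(I^nM/I^{n+1}N)$ for all $n\gg0$. The Rees algebra of $J$ is $\mathscr{R}(J)=\bigoplus_{n\in\mathbb{N}}J^n$, and for a graded submodule $L$ of $M$, $\mathscr{R}(I,L)=\bigoplus_{n\in\mathbb{N}}I^nL$ is the Rees module, viewed as an $\mathscr{R}(J)$-module (an element of the $m$th summand $J^m$ maps $I^nL$ to $I^{n+m}L$). Thus $\mathscr{G}=\bigoplus_{n\ge 0}I^nM/I^{n+1}N$. One writes $\mathscr{R}(J)=R_0[x_1,\ldots,x_d,y_1,\ldots,y_c]$ with $x_i$ in the summand $J^0=R$ and, in $\mathscr{R}(J)$, $y_j$ standing for the element $y_j$ of the summand $J^1$ (so multiplication by $y_j$ maps $I^nM/I^{n+1}N$ to $I^{n+1}M/I^{n+2}N$). An ideal $J\subseteq I$ is a reduction of $I$ if $JI^m=I^{m+1}$ for some $m\ge 0$. A function $f(n)$ is eventually linear with leading coefficient $a$ if there is $b\in\mathbb{Z}$ with $f(n)=an+b$ for all $n\gg 0$. *)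

theory Defs
  imports "HOL-Library.Extended_Real" "HOL-Algebra.UnivPoly" "HOL-Algebra.Ideal_Product"
    "HOL-Algebra.Generated_Rings" "HOL-Algebra.Ring_Divisibility"
begin

section \<open>Graded rings and modules\<close>

text \<open>The subset \<open>H\<close> of \<open>G\<close> is the internal direct sum of the subgroups \<open>C i\<close>; the
  index type is \<open>nat\<close> for gradings of rings and \<open>int\<close> for gradings of modules.\<close>

definition internal_direct_sum :: "('a, 'k) ring_scheme \<Rightarrow> 'a set \<Rightarrow> ('i \<Rightarrow> 'a set) \<Rightarrow> bool"
  where "internal_direct_sum G H C \<longleftrightarrow>
    (\<forall>i. additive_subgroup (C i) G \<and> C i \<subseteq> H) \<and>
    (\<forall>x\<in>H. \<exists>!f. (\<forall>i. f i \<in> C i) \<and> finite {i. f i \<noteq> \<zero>\<^bsub>G\<^esub>} \<and>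
        x = (\<Oplus>\<^bsub>G\<^esub>i\<in>{i. f i \<noteq> \<zero>\<^bsub>G\<^esub>}. f i))"

locale graded_ring = cring R for R (structure) +
  fixes Rgr :: "nat \<Rightarrow> 'a set"
  assumes ring_decomp: "internal_direct_sum R (carrier R) Rgr"
    and mult_graded: "\<lbrakk>a \<in> Rgr m; b \<in> Rgr n\<rbrakk> \<Longrightarrow> a \<otimes> b \<in> Rgr (m + n)"

locale graded_module = graded_ring R Rgr + module R M
  for R (structure) and Rgr and M (structure) +
  fixes Mgr :: "int \<Rightarrow> 'c set"
  assumes module_decomp: "internal_direct_sum M (carrier M) Mgr"
    and smult_graded: "\<lbrakk>a \<in> Rgr m; x \<in> Mgr u\<rbrakk> \<Longrightarrow> a \<odot>\<^bsub>M\<^esub> x \<in> Mgr (int m + u)"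

definition homogeneous_ideal :: "('a, 'k) ring_scheme \<Rightarrow> (nat \<Rightarrow> 'a set) \<Rightarrow> 'a set \<Rightarrow> bool"
  where "homogeneous_ideal R Rgr I \<longleftrightarrow>
    ideal I R \<and> internal_direct_sum R I (\<lambda>n. I \<inter> Rgr n)"

definition graded_submodule ::
    "('a, 'k) ring_scheme \<Rightarrow> ('a, 'b, 'l) module_scheme \<Rightarrow> (int \<Rightarrow> 'b set) \<Rightarrow> 'b set \<Rightarrow> bool"
  where "graded_submodule R M Mgr N \<longleftrightarrow>
    submodule N R M \<and> internal_direct_sum M N (\<lambda>u. N \<inter> Mgr u)"

definition gen_submodule ::
    "('a, 'k) ring_scheme \<Rightarrow> ('a, 'b, 'l) module_scheme \<Rightarrow> 'b set \<Rightarrow> 'b set"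
  where "gen_submodule R M S = \<Inter>{H. submodule H R M \<and> S \<subseteq> H}"

definition fin_gen_module :: "('a, 'k) ring_scheme \<Rightarrow> ('a, 'b, 'l) module_scheme \<Rightarrow> bool"
  where "fin_gen_module R M \<longleftrightarrow>
    (\<exists>S. finite S \<and> S \<subseteq> carrier M \<and> gen_submodule R M S = carrier M)"


section \<open>Ideal powers, quotients and annihilators\<close>

definition ideal_power :: "('a, 'k) ring_scheme \<Rightarrow> 'a set \<Rightarrow> nat \<Rightarrow> 'a set"
  where "ideal_power R I n = I [^]\<^bsub>ideals_set R\<^esub> n"

definition ideal_smult ::
    "('a, 'k) ring_scheme \<Rightarrow> ('a, 'b, 'l) module_scheme \<Rightarrow> 'a set \<Rightarrow> 'b set \<Rightarrow> 'b set"
  where "ideal_smult R M I L = gen_submodule R M {a \<odot>\<^bsub>M\<^esub> x | a x. a \<in> I \<and> x \<in> L}"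

text \<open>\<open>pow_smult R M I n L\<close> is $I^n L$.\<close>

definition pow_smult ::
    "('a, 'k) ring_scheme \<Rightarrow> ('a, 'b, 'l) module_scheme \<Rightarrow> 'a set \<Rightarrow> nat \<Rightarrow> 'b set \<Rightarrow> 'b set"
  where "pow_smult R M I n L = ideal_smult R M (ideal_power R I n) L"

definition reduction_ideal :: "('a, 'k) ring_scheme \<Rightarrow> 'a set \<Rightarrow> 'a set \<Rightarrow> bool"
  where "reduction_ideal R J I \<longleftrightarrow> ideal J R \<and> J \<subseteq> I \<and>
    (\<exists>m. ideal_prod R J (ideal_power R I m) = ideal_power R I (m + 1))"

text \<open>\<open>subquot M A B\<close> is the quotient module $A/B$ for submodules $B \subseteq A$ of \<open>M\<close>,
  and \<open>subquot_gr M Mgr A B u\<close> is its component of degree \<open>u\<close>, the image of $A \cap M_u$.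
  The fields \<open>mult\<close> and \<open>one\<close>, which the module record inherits from the ring record,
  play no role for modules.\<close>

definition subquot :: "('a, 'b, 'l) module_scheme \<Rightarrow> 'b set \<Rightarrow> 'b set \<Rightarrow> ('a, 'b set) module"
  where "subquot M A B =
    \<lparr>carrier = (\<lambda>x. B +>\<^bsub>M\<^esub> x) ` A, monoid.mult = undefined, one = undefined,
     zero = B, add = (\<lambda>S T. S <+>\<^bsub>M\<^esub> T), smult = (\<lambda>a S. \<Union>x\<in>S. B +>\<^bsub>M\<^esub> (a \<odot>\<^bsub>M\<^esub> x))\<rparr>"

definition subquot_gr ::
    "('a, 'b, 'l) module_scheme \<Rightarrow> (int \<Rightarrow> 'b set) \<Rightarrow> 'b set \<Rightarrow> 'b set \<Rightarrow> int \<Rightarrow> 'b set set"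
  where "subquot_gr M Mgr A B u = (\<lambda>x. B +>\<^bsub>M\<^esub> x) ` (A \<inter> Mgr u)"

definition annihilator ::
    "('a, 'k) ring_scheme \<Rightarrow> ('a, 'b, 'l) module_scheme \<Rightarrow> 'b set \<Rightarrow> 'a set"
  where "annihilator R L S = {a \<in> carrier R. \<forall>x\<in>S. a \<odot>\<^bsub>L\<^esub> x = \<zero>\<^bsub>L\<^esub>}"

text \<open>\<open>module_colon M S\<close> is $(0 :_M S)$.\<close>

definition module_colon :: "('a, 'b, 'l) module_scheme \<Rightarrow> 'a set \<Rightarrow> 'b set"
  where "module_colon M S = {x \<in> carrier M. \<forall>a\<in>S. a \<odot>\<^bsub>M\<^esub> x = \<zero>\<^bsub>M\<^esub>}"

definition ideal_radical :: "('a, 'k) ring_scheme \<Rightarrow> 'a set \<Rightarrow> 'a set"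
  where "ideal_radical R I = {a \<in> carrier R. \<exists>n::nat. 0 < n \<and> a [^]\<^bsub>R\<^esub> n \<in> I}"

definition Ass :: "('a, 'k) ring_scheme \<Rightarrow> ('a, 'b, 'l) module_scheme \<Rightarrow> 'a set set"
  where "Ass R L = {p. primeideal p R \<and> (\<exists>x\<in>carrier L. p = annihilator R L {x})}"


section \<open>The initial degree and the v-number\<close>

text \<open>Infima are taken in \<^typ>\<open>ereal\<close>, where the infimum of the empty set is \<open>\<infinity>\<close>; this
  gives the values at the zero module.\<close>

definition indeg :: "('a, 'b, 'l) module_scheme \<Rightarrow> (int \<Rightarrow> 'b set) \<Rightarrow> ereal"
  where "indeg L Lgr = (INF u\<in>{u. Lgr u \<noteq> {\<zero>\<^bsub>L\<^esub>}}. ereal (real_of_int u))"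

definition v_number_at ::
    "('a, 'k) ring_scheme \<Rightarrow> ('a, 'b, 'l) module_scheme \<Rightarrow> (int \<Rightarrow> 'b set) \<Rightarrow> 'a set \<Rightarrow> ereal"
  where "v_number_at R L Lgr p =
    (INF u\<in>{u. \<exists>x\<in>Lgr u. p = annihilator R L {x}}. ereal (real_of_int u))"

definition v_number ::
    "('a, 'k) ring_scheme \<Rightarrow> ('a, 'b, 'l) module_scheme \<Rightarrow> (int \<Rightarrow> 'b set) \<Rightarrow> ereal"
  where "v_number R L Lgr = (INF p\<in>Ass R L. v_number_at R L Lgr p)"

definition eventually_linear :: "(nat \<Rightarrow> ereal) \<Rightarrow> nat \<Rightarrow> bool"
  where "eventually_linear f a \<longleftrightarrow>
    (\<exists>b::int. \<forall>\<^sub>F n in sequentially. f n = ereal (real_of_int (int a * int n + b)))"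


section \<open>Asymptotic sets of associated primes\<close>

definition eventual_value :: "(nat \<Rightarrow> 'v) \<Rightarrow> 'v"
  where "eventual_value f = (THE v. \<forall>\<^sub>F n in sequentially. f n = v)"

text \<open>The sets $\mathcal{A}_N^M(I)$ and $\mathcal{B}_N^M(I)$\<close>

definition asymp_Ass_A ::
    "('a, 'k) ring_scheme \<Rightarrow> ('a, 'b, 'l) module_scheme \<Rightarrow> 'b set \<Rightarrow> 'a set \<Rightarrow> 'a set set"
  where "asymp_Ass_A R M N I =
    eventual_value (\<lambda>n. Ass R (subquot M (carrier M) (pow_smult R M I n N)))"

definition asymp_Ass_B ::
    "('a, 'k) ring_scheme \<Rightarrow> ('a, 'b, 'l) module_scheme \<Rightarrow> 'b set \<Rightarrow> 'a set \<Rightarrow> 'a set set"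
  where "asymp_Ass_B R M N I =
    eventual_value (\<lambda>n. Ass R (subquot M (pow_smult R M I n (carrier M)) (pow_smult R M I n N)))"


section \<open>Rees algebras and Rees modules\<close>

text \<open>An element of a direct sum over \<open>nat\<close> is a finitely supported family. For the Rees
  algebra these families are the polynomials $\sum_n a_n T^n$ with $a_n \in J^n$, so that it
  is the subring $R[JT]$ of $R[T]$, and \<open>monom (UP R) a m\<close> is the element \<open>a\<close> of the summand
  $J^m$. The action on the Rees module is the corresponding convolution.\<close>

definition rees_algebra :: "('a, 'k) ring_scheme \<Rightarrow> 'a set \<Rightarrow> ('a, nat \<Rightarrow> 'a) up_ring"
  where "rees_algebra R J = (UP R)\<lparr>carrier := {p \<in> up R. \<forall>n. p n \<in> ideal_power R J n}\<rparr>"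

definition rees_module ::
    "('a, 'k) ring_scheme \<Rightarrow> ('a, 'b, 'l) module_scheme \<Rightarrow> 'a set \<Rightarrow> 'b set \<Rightarrow>
      (nat \<Rightarrow> 'a, nat \<Rightarrow> 'b) module"
  where "rees_module R M I L =
    \<lparr>carrier = {f. (\<forall>n. f n \<in> pow_smult R M I n L) \<and> finite {n. f n \<noteq> \<zero>\<^bsub>M\<^esub>}},
     monoid.mult = undefined, one = undefined,
     zero = (\<lambda>n. \<zero>\<^bsub>M\<^esub>), add = (\<lambda>f g n. f n \<oplus>\<^bsub>M\<^esub> g n),
     smult = (\<lambda>p f n. \<Oplus>\<^bsub>M\<^esub>i\<in>{..n}. p i \<odot>\<^bsub>M\<^esub> f (n - i))\<rparr>"

text \<open>$\mathscr{R}(I,L) / \mathscr{R}(I,K)$ for submodules $K \subseteq L$ of \<open>M\<close>\<close>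

definition rees_quotient ::
    "('a, 'k) ring_scheme \<Rightarrow> ('a, 'b, 'l) module_scheme \<Rightarrow> 'a set \<Rightarrow> 'b set \<Rightarrow> 'b set \<Rightarrow>
      (nat \<Rightarrow> 'a, (nat \<Rightarrow> 'b) set) module"
  where "rees_quotient R M I L K =
    subquot (rees_module R M I L) (carrier (rees_module R M I L)) (carrier (rees_module R M I K))"

end

theory Submission
  imports Defs
begin

text \<open>A graded submodule of a Rees module is a sequence \<open>A\<close> of graded submodules of \<open>M\<close> with
  \<open>y j A n \<subseteq> A (n + 1)\<close>, and these satisfy the ascending chain condition by Hilbert's basis theorem.
  For such \<open>B \<subseteq> A\<close> let \<open>f n\<close> be the initial degree of \<open>A n / B n\<close>.  If \<open>y 1\<close> is
  injective on \<open>A/B\<close>, then \<open>f (n + 1) = f n + dy 1\<close> for large \<open>n\<close>, because \<open>y 1\<close> has the smallest degree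
  among the generators.  In general the \<open>y 1\<close>-torsion is filtered by quotients killed by \<open>y 1\<close>, on which
  only the remaining generators act.  Hence \<open>f\<close> is a minimum of finitely many linear functions, and a slope
  can only come from a generator that is not nilpotent on \<open>A/B\<close>.

  The v-number at \<open>p\<close> is the initial degree of \<open>W/Z\<close>, where \<open>W = (0 : p)\<close> and \<open>Z\<close> consists of the elements of
  \<open>W\<close> that vanish in the localisation at \<open>p\<close>.  The same Noether argument shows that
  \<open>(I\<^bsup>n+1\<^esup>N : I) = I\<^bsup>n\<^esup>N\<close> in \<open>M\<close> for large \<open>n\<close>, which uses \<open>(0 : I) = 0\<close>.  So the primes containing \<open>I\<close>
  that are associated to \<open>M/I\<^bsup>n+1\<^esup>N\<close>, and their v-numbers, are already those of \<open>I\<^bsup>n\<^esup>N/I\<^bsup>n+1\<^esup>N\<close> and of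
  \<open>I\<^bsup>n\<^esup>M/I\<^bsup>n+1\<^esup>N\<close>.\<close>

section \<open>Noetherian groups with operators\<close>

text \<open>The constant sequence \<open>M\<close> is in general not generated by the
  \<open>y j\<close>, so the chain condition does not reach the colon \<open>(F (n+1) : I)\<close>
  taken inside \<open>M\<close>. Here \<open>(0 : I) = 0\<close> helps: it makes the map from
  \<open>x\<close> to \<open>(y 1 x, ..., y c x)\<close> injective, so the colon embeds into a
  finite power of the Noetherian sequence \<open>F\<close>.

  A reduction satisfies \<open>J I^n = I^(n+1)\<close> only from some exponent \<open>m\<close> on.
  The sequences therefore start at \<open>m\<close>, where the generators of \<open>J\<close> alone
  carry each power of \<open>I\<close> to the next; the shift affects only constant terms.

  The slope in the second claim is pinned down by two bounds. As the degrees are ordered, the first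
  generator that is not nilpotent bounds it from below. The same generator moves some homogeneous
  element through the sequence so that its annihilator is eventually one fixed prime, and the
  degrees along this orbit bound the v-number, and with it the initial degree, from above. The
  condition \<open>I^n0 M \<subseteq> N\<close> forces all associated primes of
  \<open>M/I^n N\<close> to contain \<open>I\<close>, which reduces \<open>M/I^(n+1) N\<close> to
  \<open>I^n M/I^(n+1) N\<close>.\<close>

definition op_subgroup :: "('g, 'k) ring_scheme \<Rightarrow> ('g \<Rightarrow> 'g) set \<Rightarrow> 'g set \<Rightarrow> bool"
  where "op_subgroup G \<Omega> V \<longleftrightarrow> additive_subgroup V G \<and> (\<forall>h\<in>\<Omega>. \<forall>x\<in>V. h x \<in> V)"

text \<open>With operators as bare functions, scalars of \<open>R\<close> and shifts by a generator
  of the Rees algebra are treated alike, and no polynomial ring has to be formed.\<close>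

definition op_noetherian :: "('g, 'k) ring_scheme \<Rightarrow> ('g \<Rightarrow> 'g) set \<Rightarrow> 'g set \<Rightarrow> bool"
  where "op_noetherian G \<Omega> E \<longleftrightarrow> op_subgroup G \<Omega> E \<and>
    (\<forall>V::nat \<Rightarrow> 'g set. (\<forall>i. op_subgroup G \<Omega> (V i) \<and> V i \<subseteq> V (Suc i) \<and> V i \<subseteq> E) \<longrightarrow>
      (\<exists>k. \<forall>i\<ge>k. V i = V k))"

text \<open>These are the polynomials in \<open>\<eta>\<close> with coefficients in
  \<open>C\<close>. The level bounds the degree strictly, so the top coefficient at level
  \<open>Suc i\<close> belongs to \<open>\<eta> ^^ i\<close>.\<close>

primrec power_span :: "('g, 'k) ring_scheme \<Rightarrow> ('g \<Rightarrow> 'g) \<Rightarrow> 'g set \<Rightarrow> nat \<Rightarrow> 'g set"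
  where "power_span G \<eta> C 0 = {\<zero>\<^bsub>G\<^esub>}"
  | "power_span G \<eta> C (Suc i) = {e \<oplus>\<^bsub>G\<^esub> (\<eta> ^^ i) c | e c. e \<in> power_span G \<eta> C i \<and> c \<in> C}"

lemma asc_chain_le: "(\<And>i::nat. V i \<subseteq> V (Suc i)) \<Longrightarrow> i \<le> j \<Longrightarrow> V i \<subseteq> V j"
  by (rule lift_Suc_mono_le)

lemma op_noetherian_chain:
  assumes "op_noetherian G \<Omega> E"
    and "\<And>i. op_subgroup G \<Omega> (V i)" "\<And>i. V i \<subseteq> V (Suc i)" "\<And>i. V i \<subseteq> E"
  shows "\<exists>k. \<forall>i\<ge>k. V i = V k"
  using assms unfolding op_noetherian_def by simp

text \<open>The diagonal chain \<open>L n n\<close> stabilises, which settles all rows from its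
  bound on. The finitely many rows below stabilise one by one, and \<open>k\<close> is the maximum
  of all these bounds. In the basis theorem \<open>i\<close> is a degree and \<open>n\<close> the
  position in a chain.\<close>

lemma op_noetherian_double_chain:
  fixes L :: "nat \<Rightarrow> nat \<Rightarrow> 'g set"
  assumes E: "op_noetherian G \<Omega> E"
    and L: "\<And>i n. op_subgroup G \<Omega> (L i n)" "\<And>i n. L i n \<subseteq> E"
    and i: "\<And>i n. L i n \<subseteq> L (Suc i) n" and n: "\<And>i n. L i n \<subseteq> L i (Suc n)"
  shows "\<exists>k. \<forall>n\<ge>k. \<forall>i. L i n = L i k"
proof -
  have mi: "L i n \<subseteq> L j n" if "i \<le> j" for i j n using asc_chain_le[of "\<lambda>i. L i n"] i that by blast
  have mn: "L i n \<subseteq> L i m" if "n \<le> m" for i m n using asc_chain_le[of "L i"] n that by blast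
  have "\<exists>k. \<forall>n\<ge>k. L n n = L k k"
    by (rule op_noetherian_chain[OF E, of "\<lambda>n. L n n"]) (use L in blast, use i n in blast, use L in blast)
  then obtain k1 where k1: "\<And>n. n \<ge> k1 \<Longrightarrow> L n n = L k1 k1" by blast
  have "\<exists>k. \<forall>n\<ge>k. L i n = L i k" for i
    by (rule op_noetherian_chain[OF E, of "L i"]) (use L n in auto)
  then obtain \<kappa> where \<kappa>: "\<And>i n. n \<ge> \<kappa> i \<Longrightarrow> L i n = L i (\<kappa> i)" by metis
  have big: "L i n = L k1 k1" if "i \<ge> k1" "n \<ge> k1" for i n
  proof
    have "L i n \<subseteq> L (max i n) (max i n)" using mi[of i "max i n" n] mn[of n "max i n" "max i n"] by auto
    also have "\<dots> = L k1 k1" by (rule k1) (use that in auto)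
    finally show "L i n \<subseteq> L k1 k1" .
    show "L k1 k1 \<subseteq> L i n" using mi[of k1 i k1] mn[of k1 n i] that by auto
  qed
  define k where "k = Max (insert k1 (\<kappa> ` {..<k1}))"
  have kk: "k \<ge> k1" "\<And>i. i < k1 \<Longrightarrow> k \<ge> \<kappa> i" unfolding k_def by (auto intro!: Max_ge)
  have "L i n = L i k" if "n \<ge> k" for i n
  proof (cases "i < k1")
    case True
    then have "\<kappa> i \<le> k" using kk by blast
    then show ?thesis using \<kappa>[of i n] \<kappa>[of i k] that by simp
  next
    case False then show ?thesis using big[of i n] big[of i k] kk that by auto
  qed
  then show ?thesis by blast
qed

context abelian_group
begin

lemma additive_subgroupI:
  assumes "H \<subseteq> carrier G" "\<zero> \<in> H" "\<And>a b. a \<in> H \<Longrightarrow> b \<in> H \<Longrightarrow> a \<oplus> b \<in> H"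
    "\<And>a. a \<in> H \<Longrightarrow> \<ominus> a \<in> H"
  shows "additive_subgroup H G"
  using assms by (auto simp: additive_subgroup_def a_inv_def intro!: subgroup.intro)

lemma add_swap4:
  assumes "a \<in> carrier G" "b \<in> carrier G" "c \<in> carrier G" "d \<in> carrier G"
  shows "(a \<oplus> b) \<oplus> (c \<oplus> d) = (a \<oplus> c) \<oplus> (b \<oplus> d)"
  using assms by (simp add: a_ac)

text \<open>Hilbert's basis theorem, for the operator \<open>\<eta>\<close> in place of the indeterminate.\<close>

lemma op_noetherian_insert:
  assumes C: "op_noetherian G \<Omega> C"
    and \<eta>: "\<And>x. x \<in> carrier G \<Longrightarrow> \<eta> x \<in> carrier G"
      "\<And>x y. x \<in> carrier G \<Longrightarrow> y \<in> carrier G \<Longrightarrow> \<eta> (x \<oplus> y) = \<eta> x \<oplus> \<eta> y"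
    and \<Omega>: "\<And>h x. h \<in> \<Omega> \<Longrightarrow> x \<in> carrier G \<Longrightarrow> h x \<in> carrier G"
      "\<And>h x y. h \<in> \<Omega> \<Longrightarrow> x \<in> carrier G \<Longrightarrow> y \<in> carrier G \<Longrightarrow> h (x \<oplus> y) = h x \<oplus> h y"
    and comm: "\<And>h x. h \<in> \<Omega> \<Longrightarrow> x \<in> carrier G \<Longrightarrow> h (\<eta> x) = \<eta> (h x)"
  shows "\<exists>U. op_noetherian G (insert \<eta> \<Omega>) U \<and> C \<subseteq> U"
proof -
  let ?U = "power_span G \<eta> C"
  have Csub: "additive_subgroup C G" and Cop: "\<And>h x. h \<in> \<Omega> \<Longrightarrow> x \<in> C \<Longrightarrow> h x \<in> C"
    using C by (auto simp: op_noetherian_def op_subgroup_def)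
  interpret C: additive_subgroup C G by fact
  have Cc: "x \<in> carrier G" if "x \<in> C" for x using that C.a_subset by blast
  have hz: "h \<zero> = \<zero>" if "\<And>x. x \<in> carrier G \<Longrightarrow> h x \<in> carrier G"
      "\<And>x y. x \<in> carrier G \<Longrightarrow> y \<in> carrier G \<Longrightarrow> h (x \<oplus> y) = h x \<oplus> h y" for h
    using that(1)[of \<zero>] that(2)[of \<zero> \<zero>] by (metis add.r_cancel_one' l_zero zero_closed)
  have hm: "h (\<ominus> x) = \<ominus> (h x)" if h: "\<And>x. x \<in> carrier G \<Longrightarrow> h x \<in> carrier G"
      "\<And>x y. x \<in> carrier G \<Longrightarrow> y \<in> carrier G \<Longrightarrow> h (x \<oplus> y) = h x \<oplus> h y" and x: "x \<in> carrier G" for h x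
    using hz[OF h] h(1)[of x] h(1)[of "\<ominus> x"] h(2)[of "\<ominus> x" x] x
    by (metis a_inv_closed l_neg minus_equality)
  have pc: "(\<eta> ^^ i) x \<in> carrier G" if "x \<in> carrier G" for i x
    using that by (induct i) (auto intro: \<eta>)
  have pa: "(\<eta> ^^ i) (x \<oplus> y) = (\<eta> ^^ i) x \<oplus> (\<eta> ^^ i) y"
    if "x \<in> carrier G" "y \<in> carrier G" for i x y
    using that by (induct i) (auto simp: \<eta> pc)
  have pz: "(\<eta> ^^ i) \<zero> = \<zero>" for i by (rule hz) (use pc pa in auto)
  have pm: "(\<eta> ^^ i) (\<ominus> x) = \<ominus> ((\<eta> ^^ i) x)" if "x \<in> carrier G" for i x
    by (rule hm) (use pc pa that in auto)
  have \<Omega>z: "h \<zero> = \<zero>" if "h \<in> \<Omega>" for h by (rule hz) (use \<Omega> that in auto)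
  have \<eta>z: "\<eta> \<zero> = \<zero>" by (rule hz) (use \<eta> in auto)
  have UI: "e \<oplus> (\<eta> ^^ i) c \<in> ?U (Suc i)" if "e \<in> ?U i" "c \<in> C" for e c i using that by auto
  have pcomm: "h ((\<eta> ^^ i) x) = (\<eta> ^^ i) (h x)" if "x \<in> carrier G" "h \<in> \<Omega>" for i x h
    using that by (induct i) (auto simp: comm pc)
  have Uc: "x \<in> carrier G" if "x \<in> ?U i" for x i
    using that by (induct i arbitrary: x) (auto simp: pc Cc)
  have U0: "\<zero> \<in> ?U i" for i
  proof (induct i)
    case (Suc i) then show ?case using UI[OF Suc C.zero_closed] by (simp add: pz)
  qed auto
  have Uadd: "x \<in> ?U i \<Longrightarrow> y \<in> ?U i \<Longrightarrow> x \<oplus> y \<in> ?U i" for x y i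
  proof (induct i arbitrary: x y)
    case (Suc i)
    then obtain e c e' c' where "e \<in> ?U i" "c \<in> C" "e' \<in> ?U i" "c' \<in> C"
      "x = e \<oplus> (\<eta> ^^ i) c" "y = e' \<oplus> (\<eta> ^^ i) c'" by auto
    moreover from this have "x \<oplus> y = (e \<oplus> e') \<oplus> (\<eta> ^^ i) (c \<oplus> c')"
      by (simp add: pa Cc add_swap4 Uc pc)
    ultimately show ?case using Suc(1) C.a_closed by auto
  qed auto
  have Uneg: "x \<in> ?U i \<Longrightarrow> \<ominus> x \<in> ?U i" for x i
  proof (induct i arbitrary: x)
    case (Suc i)
    then obtain e c where e: "e \<in> ?U i" "c \<in> C" "x = e \<oplus> (\<eta> ^^ i) c" by auto
    then have "\<ominus> x = \<ominus> e \<oplus> (\<eta> ^^ i) (\<ominus> c)"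
      by (simp add: minus_add Cc pc Uc pm)
    then show ?case using UI[OF Suc(1)[OF e(1)] C.a_inv_closed[OF e(2)]] by simp
  qed auto
  have Usuc: "?U i \<subseteq> ?U (Suc i)" for i
  proof
    fix x assume x: "x \<in> ?U i"
    then show "x \<in> ?U (Suc i)" using UI[OF x C.zero_closed] by (simp add: pz Uc)
  qed
  have Umono: "i \<le> j \<Longrightarrow> ?U i \<subseteq> ?U j" for i j by (rule asc_chain_le[of ?U, OF Usuc])
  have U\<eta>: "x \<in> ?U i \<Longrightarrow> \<eta> x \<in> ?U (Suc i)" for x i
  proof (induct i arbitrary: x)
    case 0 then show ?case using U0[of "Suc 0"] by (simp add: \<eta>z)
  next
    case (Suc i)
    then obtain e c where e: "e \<in> ?U i" "c \<in> C" "x = e \<oplus> (\<eta> ^^ i) c" by auto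
    then have "\<eta> x = \<eta> e \<oplus> (\<eta> ^^ Suc i) c" by (simp add: \<eta> Uc pc Cc)
    then show ?case using UI[OF Suc(1)[OF e(1)] e(2)] by simp
  qed
  have U\<Omega>: "h \<in> \<Omega> \<Longrightarrow> x \<in> ?U i \<Longrightarrow> h x \<in> ?U i" for x i h
  proof (induct i arbitrary: x)
    case 0 then show ?case by (simp add: \<Omega>z)
  next
    case (Suc i)
    then obtain e c where e: "e \<in> ?U i" "c \<in> C" "x = e \<oplus> (\<eta> ^^ i) c" by auto
    then have "h x = h e \<oplus> (\<eta> ^^ i) (h c)" using Suc(2) by (simp add: \<Omega> Uc pc Cc pcomm)
    then show ?case using UI[OF Suc(1)[OF Suc(2) e(1)] Cop[OF Suc(2) e(2)]] by simp
  qed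
  define U where "U = (\<Union>i. ?U i)"
  have Usub: "op_subgroup G (insert \<eta> \<Omega>) U"
  proof -
    have "additive_subgroup U G"
    proof (rule additive_subgroupI)
      fix a b assume "a \<in> U" "b \<in> U"
      then obtain i j where "a \<in> ?U i" "b \<in> ?U j" unfolding U_def by auto
      then have "a \<in> ?U (max i j)" "b \<in> ?U (max i j)" using Umono[of i "max i j"] Umono[of j "max i j"] by auto
      then show "a \<oplus> b \<in> U" using Uadd unfolding U_def by blast
    qed (use Uc U0 Uneg in \<open>unfold U_def, blast+\<close>)
    then show ?thesis using U\<eta> U\<Omega> unfolding op_subgroup_def U_def by blast
  qed
  have CU: "C \<subseteq> U"
  proof
    fix c assume c: "c \<in> C"
    then have "c \<in> ?U (Suc 0)" using UI[OF U0[of 0] c] by (simp add: Cc)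
    then show "c \<in> U" unfolding U_def by blast
  qed
  \<comment> \<open>The leading coefficients of \<open>V\<close> in degree \<open>i\<close>. An
    element of \<open>U\<close> may have several expressions as a polynomial in
    \<open>\<eta>\<close>, so the lower part \<open>e\<close> is existentially quantified.\<close>
  define L where "L V i = {c \<in> C. \<exists>e\<in>?U i. e \<oplus> (\<eta> ^^ i) c \<in> V}" for V i
  have Lsub: "op_subgroup G \<Omega> (L V i)" if V: "op_subgroup G (insert \<eta> \<Omega>) V" for V i
  proof -
    interpret V: additive_subgroup V G using V by (simp add: op_subgroup_def)
    have "additive_subgroup (L V i) G"
    proof (rule additive_subgroupI)
      show "L V i \<subseteq> carrier G" unfolding L_def using Cc by blast
      have "\<zero> \<oplus> (\<eta> ^^ i) \<zero> \<in> V" using V.zero_closed by (simp add: pz)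
      then show "\<zero> \<in> L V i" unfolding L_def using U0 C.zero_closed by blast
      fix a assume "a \<in> L V i"
      then obtain e where e: "a \<in> C" "e \<in> ?U i" "e \<oplus> (\<eta> ^^ i) a \<in> V" unfolding L_def by auto
      have "\<ominus> (e \<oplus> (\<eta> ^^ i) a) = \<ominus> e \<oplus> (\<eta> ^^ i) (\<ominus> a)"
        using e by (simp add: minus_add Cc pc Uc pm)
      then have "\<ominus> e \<oplus> (\<eta> ^^ i) (\<ominus> a) \<in> V" using V.a_inv_closed[OF e(3)] by simp
      then show "\<ominus> a \<in> L V i" unfolding L_def using e Uneg C.a_inv_closed by blast
      fix b assume "b \<in> L V i"
      then obtain f where f: "b \<in> C" "f \<in> ?U i" "f \<oplus> (\<eta> ^^ i) b \<in> V" unfolding L_def by auto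
      have "(e \<oplus> (\<eta> ^^ i) a) \<oplus> (f \<oplus> (\<eta> ^^ i) b) = (e \<oplus> f) \<oplus> (\<eta> ^^ i) (a \<oplus> b)"
        using e f by (simp add: pa Cc add_swap4 Uc pc)
      then have "(e \<oplus> f) \<oplus> (\<eta> ^^ i) (a \<oplus> b) \<in> V" using V.a_closed[OF e(3) f(3)] by simp
      then show "a \<oplus> b \<in> L V i" unfolding L_def using C.a_closed[OF e(1) f(1)] Uadd[OF e(2) f(2)] by blast
    qed
    moreover have "h a \<in> L V i" if h: "h \<in> \<Omega>" and a: "a \<in> L V i" for h a
    proof -
      obtain e where e: "a \<in> C" "e \<in> ?U i" "e \<oplus> (\<eta> ^^ i) a \<in> V" using a unfolding L_def by auto
      have "h (e \<oplus> (\<eta> ^^ i) a) = h e \<oplus> (\<eta> ^^ i) (h a)" using e h by (simp add: \<Omega> Uc pc Cc pcomm)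
      moreover have "h (e \<oplus> (\<eta> ^^ i) a) \<in> V" using V h e by (auto simp: op_subgroup_def)
      ultimately show ?thesis using h e Cop U\<Omega> unfolding L_def by auto
    qed
    ultimately show ?thesis by (simp add: op_subgroup_def)
  qed
  have Lsuc: "L V i \<subseteq> L V (Suc i)" if V: "op_subgroup G (insert \<eta> \<Omega>) V" for V i
  proof
    fix a assume "a \<in> L V i"
    then obtain e where e: "a \<in> C" "e \<in> ?U i" "e \<oplus> (\<eta> ^^ i) a \<in> V" unfolding L_def by auto
    have "\<eta> (e \<oplus> (\<eta> ^^ i) a) = \<eta> e \<oplus> (\<eta> ^^ Suc i) a" using e by (simp add: \<eta> Uc pc Cc)
    moreover have "\<eta> (e \<oplus> (\<eta> ^^ i) a) \<in> V" using V e by (auto simp: op_subgroup_def)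
    ultimately have "\<eta> e \<oplus> (\<eta> ^^ Suc i) a \<in> V" by simp
    then show "a \<in> L V (Suc i)" unfolding L_def using e U\<eta> by blast
  qed
  \<comment> \<open>Induction on the degree: an element of \<open>V'\<close> has the leading
    coefficient of some element of \<open>V\<close>, and subtracting the latter leaves an element of
    \<open>V'\<close> of smaller degree.\<close>
  have key: "V' \<inter> ?U i \<subseteq> V" if V: "op_subgroup G (insert \<eta> \<Omega>) V" "op_subgroup G (insert \<eta> \<Omega>) V'"
    "V \<subseteq> V'" and eq: "\<And>i. L V' i = L V i" for V V' i
  proof (induct i)
    case 0 show ?case using V(1) by (auto simp: op_subgroup_def dest: additive_subgroup.zero_closed)
  next
    case (Suc i)
    interpret V: additive_subgroup V G using V by (simp add: op_subgroup_def)
    interpret V': additive_subgroup V' G using V by (simp add: op_subgroup_def)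
    show ?case
    proof
      fix x assume x: "x \<in> V' \<inter> ?U (Suc i)"
      then obtain e c where e: "e \<in> ?U i" "c \<in> C" "x = e \<oplus> (\<eta> ^^ i) c" by auto
      then have "c \<in> L V' i" using x unfolding L_def by auto
      then obtain f where f: "f \<in> ?U i" "f \<oplus> (\<eta> ^^ i) c \<in> V" using eq unfolding L_def by auto
      let ?z = "f \<oplus> (\<eta> ^^ i) c"
      have c: "e \<in> carrier G" "f \<in> carrier G" "(\<eta> ^^ i) c \<in> carrier G" using e f by (auto simp: Uc pc Cc)
      have d: "x \<ominus> ?z = e \<oplus> \<ominus> f"
        using c unfolding e(3) by (simp add: minus_add minus_eq a_ac r_neg2 r_neg1 r_neg)
      have "x \<ominus> ?z \<in> ?U i" unfolding d using Uadd Uneg e f by blast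
      moreover have "x \<ominus> ?z \<in> V'" using x f V(3) V'.a_closed V'.a_inv_closed by (auto simp: minus_eq)
      ultimately have "x \<ominus> ?z \<in> V" using Suc by blast
      then have "(x \<ominus> ?z) \<oplus> ?z \<in> V" using f V.a_closed by blast
      moreover have "(x \<ominus> ?z) \<oplus> ?z = x" using c e by (simp add: minus_eq a_assoc l_neg)
      ultimately show "x \<in> V" by simp
    qed
  qed
  have "\<exists>k. \<forall>i\<ge>k. V i = V k"
    if V: "\<And>i. op_subgroup G (insert \<eta> \<Omega>) (V i) \<and> V i \<subseteq> V (Suc i) \<and> V i \<subseteq> U" for V :: "nat \<Rightarrow> 'a set"
  proof -
    have "\<exists>k. \<forall>n\<ge>k. \<forall>i. L (V n) i = L (V k) i"
      by (rule op_noetherian_double_chain[OF C]) (use V Lsub Lsuc in \<open>auto simp: L_def\<close>)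
    then obtain k where k: "\<And>n i. n \<ge> k \<Longrightarrow> L (V n) i = L (V k) i" by blast
    have "V n = V k" if "n \<ge> k" for n
    proof
      show *: "V k \<subseteq> V n" using asc_chain_le[of V] V that by blast
      show "V n \<subseteq> V k"
        using key[of "V k" "V n"] V * k[OF that] unfolding U_def by blast
    qed
    then show ?thesis by blast
  qed
  then have "op_noetherian G (insert \<eta> \<Omega>) U" using Usub by (auto simp: op_noetherian_def)
  with CU show ?thesis by blast
qed

end

section \<open>Homogeneous components\<close>

definition hcomp :: "('a, 'k) ring_scheme \<Rightarrow> ('i \<Rightarrow> 'a set) \<Rightarrow> 'a \<Rightarrow> 'i \<Rightarrow> 'a"
  where "hcomp G C x = (THE f. (\<forall>i. f i \<in> C i) \<and> finite {i. f i \<noteq> \<zero>\<^bsub>G\<^esub>} \<and>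
      x = (\<Oplus>\<^bsub>G\<^esub>i\<in>{i. f i \<noteq> \<zero>\<^bsub>G\<^esub>}. f i))"

lemma (in abelian_group) sub_add_swap:
  assumes "a \<in> carrier G" "b \<in> carrier G" "c \<in> carrier G"
  shows "(a \<ominus> b) \<oplus> (c \<oplus> b) = c \<oplus> a"
  using assms a_comm[of c b] a_comm[of c a] by (simp add: minus_eq a_assoc r_neg1)

text \<open>Developing components over an arbitrary index type covers both \<open>Rgr\<close>,
  indexed by \<open>nat\<close>, and \<open>Mgr\<close>, indexed by \<open>int\<close>.\<close>

locale graded_group = abelian_group G for G (structure) +
  fixes C :: "'i \<Rightarrow> 'a set"
  assumes decomp: "internal_direct_sum G (carrier G) C"
begin

lemma C_subgroup: "additive_subgroup (C i) G"
  using decomp by (simp add: internal_direct_sum_def)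

lemma C_carrier: "x \<in> C i \<Longrightarrow> x \<in> carrier G"
  using additive_subgroup.a_subset[OF C_subgroup] by blast

lemma C_zero: "\<zero> \<in> C i"
  by (rule additive_subgroup.zero_closed[OF C_subgroup])

lemma hcomp_all:
  assumes "x \<in> carrier G"
  shows "(\<forall>i. hcomp G C x i \<in> C i) \<and> finite {i. hcomp G C x i \<noteq> \<zero>} \<and>
    x = (\<Oplus>i\<in>{i. hcomp G C x i \<noteq> \<zero>}. hcomp G C x i)"
  unfolding hcomp_def
  by (rule theI'[where P = "\<lambda>f. (\<forall>i. f i \<in> C i) \<and> finite {i. f i \<noteq> \<zero>} \<and>
      x = (\<Oplus>i\<in>{i. f i \<noteq> \<zero>}. f i)"])
    (use decomp assms in \<open>simp add: internal_direct_sum_def\<close>)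

lemma hcomp_mem: "x \<in> carrier G \<Longrightarrow> hcomp G C x i \<in> C i"
  and hcomp_finite: "x \<in> carrier G \<Longrightarrow> finite {i. hcomp G C x i \<noteq> \<zero>}"
  and hcomp_sum: "x \<in> carrier G \<Longrightarrow> (\<Oplus>i\<in>{i. hcomp G C x i \<noteq> \<zero>}. hcomp G C x i) = x"
  using hcomp_all by auto

lemma hcomp_closed [simp]: "x \<in> carrier G \<Longrightarrow> hcomp G C x i \<in> carrier G"
  using C_carrier hcomp_mem by blast

text \<open>Any finite set outside which \<open>f\<close> vanishes will do for \<open>S\<close>, so
  components of sums and multiples can be computed without knowing which terms cancel.\<close>

lemma hcomp_eqI:
  assumes S: "finite S" and f: "\<And>i. f i \<in> C i" "\<And>i. i \<notin> S \<Longrightarrow> f i = \<zero>"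
    and x: "x = (\<Oplus>i\<in>S. f i)"
  shows "hcomp G C x = f"
proof -
  have fc: "f \<in> S \<rightarrow> carrier G" using f C_carrier by auto
  have sub: "{i. f i \<noteq> \<zero>} \<subseteq> S" using f by auto
  have "x = (\<Oplus>i\<in>{i. f i \<noteq> \<zero>}. f i)"
    unfolding x by (rule add.finprod_mono_neutral_cong_right[OF S sub]) (use fc in auto)
  moreover have "finite {i. f i \<noteq> \<zero>}" using S sub finite_subset by blast
  moreover have "x \<in> carrier G" unfolding x using fc by (rule finsum_closed)
  then have "\<exists>!f. (\<forall>i. f i \<in> C i) \<and> finite {i. f i \<noteq> \<zero>} \<and> x = (\<Oplus>i\<in>{i. f i \<noteq> \<zero>}. f i)"
    using decomp by (simp add: internal_direct_sum_def)
  ultimately show ?thesis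
    unfolding hcomp_def using f(1) by (intro the1_equality) blast+
qed

lemma hcomp_sum_superset:
  assumes x: "x \<in> carrier G" and S: "finite S" "{i. hcomp G C x i \<noteq> \<zero>} \<subseteq> S"
  shows "(\<Oplus>i\<in>S. hcomp G C x i) = x"
proof -
  have "(\<Oplus>i\<in>S. hcomp G C x i) = (\<Oplus>i\<in>{i. hcomp G C x i \<noteq> \<zero>}. hcomp G C x i)"
    by (rule add.finprod_mono_neutral_cong_right[OF S]) (use x in auto)
  then show ?thesis using hcomp_sum[OF x] by simp
qed

lemma hcomp_add:
  assumes "x \<in> carrier G" "y \<in> carrier G"
  shows "hcomp G C (x \<oplus> y) i = hcomp G C x i \<oplus> hcomp G C y i"
proof -
  let ?S = "{i. hcomp G C x i \<noteq> \<zero>} \<union> {i. hcomp G C y i \<noteq> \<zero>}"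
  have S: "finite ?S" using assms hcomp_finite by blast
  have "hcomp G C (x \<oplus> y) = (\<lambda>i. hcomp G C x i \<oplus> hcomp G C y i)"
  proof (rule hcomp_eqI[OF S])
    show "hcomp G C x i \<oplus> hcomp G C y i \<in> C i" for i
      using additive_subgroup.a_closed[OF C_subgroup] hcomp_mem assms by blast
    show "hcomp G C x i \<oplus> hcomp G C y i = \<zero>" if "i \<notin> ?S" for i using that by auto
    have "(\<Oplus>i\<in>?S. hcomp G C x i \<oplus> hcomp G C y i) = (\<Oplus>i\<in>?S. hcomp G C x i) \<oplus> (\<Oplus>i\<in>?S. hcomp G C y i)"
      by (rule finsum_addf) (use assms in auto)
    also have "\<dots> = x \<oplus> y" using hcomp_sum_superset[OF _ S] assms by auto
    finally show "x \<oplus> y = (\<Oplus>i\<in>?S. hcomp G C x i \<oplus> hcomp G C y i)" by simp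
  qed
  then show ?thesis by simp
qed

lemma hcomp_homog:
  assumes "x \<in> C i"
  shows "hcomp G C x j = (if j = i then x else \<zero>)"
proof -
  have "hcomp G C x = (\<lambda>j. if j = i then x else \<zero>)"
    by (rule hcomp_eqI[of "{i}"]) (use assms C_carrier C_zero in auto)
  then show ?thesis by simp
qed

lemma hcomp_zero [simp]: "hcomp G C \<zero> i = \<zero>"
  using hcomp_homog[OF C_zero, of i i] by simp

lemma hcomp_minus:
  assumes "x \<in> carrier G"
  shows "hcomp G C (\<ominus> x) i = \<ominus> hcomp G C x i"
proof -
  have "hcomp G C (\<ominus> x) i \<oplus> hcomp G C x i = \<zero>"
    using hcomp_add[of "\<ominus> x" x i] assms by (simp add: l_neg)
  then show ?thesis using assms by (simp add: minus_equality)
qed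

lemma finsum_in:
  assumes "finite S" "\<zero> \<in> H" "H \<subseteq> carrier G" "\<And>a b. a \<in> H \<Longrightarrow> b \<in> H \<Longrightarrow> a \<oplus> b \<in> H" "\<And>i. i \<in> S \<Longrightarrow> f i \<in> H"
  shows "(\<Oplus>i\<in>S. f i) \<in> H"
  using assms(1,5)
proof induct
  case (insert i S)
  then show ?case using assms(2-4) by (subst finsum_insert) auto
qed (use assms(2) in simp)

text \<open>This acts as an induction over homogeneous components. \<open>H\<close> is often a set
  of elements satisfying some identity, as in \<open>hM_smult_top\<close>, for which zero and sums
  are easily checked.\<close>

lemma mem_if_hcomp_mem:
  assumes "x \<in> carrier G" "\<zero> \<in> H" "H \<subseteq> carrier G" "\<And>a b. a \<in> H \<Longrightarrow> b \<in> H \<Longrightarrow> a \<oplus> b \<in> H"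
    "\<And>i. hcomp G C x i \<in> H"
  shows "x \<in> H"
  using hcomp_sum[OF assms(1)] finsum_in[OF hcomp_finite[OF assms(1)] assms(2-4), of "hcomp G C x"] assms(5) by simp

text \<open>A decomposition inside \<open>H\<close> is also one in the whole group, so uniqueness
  identifies it with the family of components.\<close>

lemma internal_direct_sum_hcomp:
  assumes H: "internal_direct_sum G H (\<lambda>i. H \<inter> C i)" and x: "x \<in> H"
  shows "hcomp G C x i \<in> H"
proof -
  obtain f where f: "\<And>i. f i \<in> H \<inter> C i" "finite {i. f i \<noteq> \<zero>}" "x = (\<Oplus>i\<in>{i. f i \<noteq> \<zero>}. f i)"
    using H x unfolding internal_direct_sum_def by blast
  have "hcomp G C x = f" by (rule hcomp_eqI[OF f(2)]) (use f in auto)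
  then show ?thesis using f by auto
qed

end

sublocale graded_ring \<subseteq> Rg: graded_group R Rgr
  by unfold_locales (rule ring_decomp)

sublocale graded_module \<subseteq> Mg: graded_group M Mgr
  by unfold_locales (rule module_decomp)

section \<open>Elementary calculus of submodules\<close>

context module
begin

lemma submodule_zero: "submodule H R M \<Longrightarrow> \<zero>\<^bsub>M\<^esub> \<in> H"
  using submoduleE[of H] by (metis all_not_in_conv R.zero_closed smult_l_null subsetD)

lemma submodule_carrier: "submodule H R M \<Longrightarrow> x \<in> H \<Longrightarrow> x \<in> carrier M"
  using submoduleE(1) by blast

lemma submodule_minus:
  "submodule H R M \<Longrightarrow> a \<in> H \<Longrightarrow> b \<in> H \<Longrightarrow> a \<ominus>\<^bsub>M\<^esub> b \<in> H"
  using submoduleE(3,5)[of H] by (simp add: M.minus_eq)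

lemma submodule_zero_set: "submodule {\<zero>\<^bsub>M\<^esub>} R M"
  by (rule submoduleI) auto

lemma submoduleI':
  assumes "H \<subseteq> carrier M" "\<zero>\<^bsub>M\<^esub> \<in> H" "\<And>a b. \<lbrakk>a \<in> H; b \<in> H\<rbrakk> \<Longrightarrow> a \<oplus>\<^bsub>M\<^esub> b \<in> H"
    "\<And>a x. \<lbrakk>a \<in> carrier R; x \<in> H\<rbrakk> \<Longrightarrow> a \<odot>\<^bsub>M\<^esub> x \<in> H"
  shows "submodule H R M"
proof (rule submoduleI[OF assms(1,2) _ assms(3,4)])
  fix a assume a: "a \<in> H"
  then have "a \<in> carrier M" using assms(1) by blast
  then have "\<ominus>\<^bsub>M\<^esub> a = (\<ominus> \<one>) \<odot>\<^bsub>M\<^esub> a" by (simp add: smult_l_minus)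
  then show "\<ominus>\<^bsub>M\<^esub> a \<in> H" using assms(4)[OF _ a] by simp
qed

lemma submodule_diff:
  assumes H: "submodule H R M" and a: "a \<in> carrier M" "b \<in> H" "a \<oplus>\<^bsub>M\<^esub> b \<in> H"
  shows "a \<in> H"
proof -
  have "b \<in> carrier M" using submodule_carrier[OF H a(2)] .
  then have "(a \<oplus>\<^bsub>M\<^esub> b) \<ominus>\<^bsub>M\<^esub> b = a" using a(1) by (simp add: M.minus_eq M.a_assoc M.r_neg)
  then show ?thesis using submodule_minus[OF H a(3,2)] by simp
qed

lemma submodule_inter: "submodule H R M \<Longrightarrow> submodule K R M \<Longrightarrow> submodule (H \<inter> K) R M"
  by (rule submoduleI') (auto dest: submoduleE submodule_zero submodule_carrier)

lemma gen_submodule_submodule: "S \<subseteq> carrier M \<Longrightarrow> submodule (gen_submodule R M S) R M"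
  unfolding gen_submodule_def
  by (rule submoduleI')
    (use carrier_is_submodule in \<open>auto intro: submoduleE submodule_zero submodule_carrier\<close>)

lemma gen_submodule_incl: "S \<subseteq> gen_submodule R M S"
  unfolding gen_submodule_def by blast

lemma gen_submodule_least: "submodule H R M \<Longrightarrow> S \<subseteq> H \<Longrightarrow> gen_submodule R M S \<subseteq> H"
  unfolding gen_submodule_def by blast

end

section \<open>The chain condition for finitely generated modules over a Noetherian ring\<close>

locale noetherian_module = module R M for R (structure) and M (structure) +
  assumes noetherian: "noetherian_ring R" and fin_gen: "fin_gen_module R M"

context module
begin

text \<open>\<open>res B x\<close> is the annihilator of the class of \<open>x\<close> modulo \<open>B\<close>.\<close>

definition res :: "'c set \<Rightarrow> 'c \<Rightarrow> 'a set"
  where "res B x = {r \<in> carrier R. r \<odot>\<^bsub>M\<^esub> x \<in> B}"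

lemma ideal_by_closure:
  assumes "I \<subseteq> carrier R" "\<zero> \<in> I" "\<And>a b. a \<in> I \<Longrightarrow> b \<in> I \<Longrightarrow> a \<oplus> b \<in> I"
    "\<And>a b. a \<in> carrier R \<Longrightarrow> b \<in> I \<Longrightarrow> a \<otimes> b \<in> I"
  shows "ideal I R"
proof (rule idealI)
  show "ring R" by (rule R.ring_axioms)
  have "\<ominus> a \<in> I" if a: "a \<in> I" for a
    using assms(4)[of "\<ominus> \<one>" a] a assms(1) by (metis R.a_inv_closed R.l_minus R.l_one R.one_closed subsetD)
  then show "subgroup I (add_monoid R)"
    using assms(1-3) by (intro subgroup.intro) (auto simp: a_inv_def[symmetric])
  show "x \<otimes> a \<in> I" "a \<otimes> x \<in> I" if "a \<in> I" "x \<in> carrier R" for a x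
    using that assms(4)[of x a] assms(1) R.m_comm[of a x] by auto
qed

lemma res_ideal:
  assumes B: "submodule B R M" and x: "x \<in> carrier M"
  shows "ideal (res B x) R"
proof (rule ideal_by_closure)
  show "\<zero> \<in> res B x" unfolding res_def using x submodule_zero[OF B] by simp
  show "a \<oplus> b \<in> res B x" if "a \<in> res B x" "b \<in> res B x" for a b
    using that x submoduleE(5)[OF B] by (auto simp: res_def smult_l_distr)
  show "a \<otimes> b \<in> res B x" if "a \<in> carrier R" "b \<in> res B x" for a b
    using that x submoduleE(4)[OF B] by (auto simp: res_def smult_assoc1)
qed (auto simp: res_def)

lemma submodule_span_sub:
  assumes H: "submodule H R M" and s: "s \<in> carrier M"
  shows "submodule {r \<odot>\<^bsub>M\<^esub> s \<oplus>\<^bsub>M\<^esub> m | r m. r \<in> carrier R \<and> m \<in> H} R M" (is "submodule ?K R M")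
proof (rule submoduleI')
  note Hc = submodule_carrier[OF H]
  show "?K \<subseteq> carrier M" using s Hc by auto
  have "\<zero>\<^bsub>M\<^esub> = \<zero> \<odot>\<^bsub>M\<^esub> s \<oplus>\<^bsub>M\<^esub> \<zero>\<^bsub>M\<^esub>" using s by simp
  then show "\<zero>\<^bsub>M\<^esub> \<in> ?K" using submodule_zero[OF H] by blast
  show "a \<oplus>\<^bsub>M\<^esub> b \<in> ?K" if ab: "a \<in> ?K" "b \<in> ?K" for a b
  proof -
    obtain r m r' m' where e: "r \<in> carrier R" "r' \<in> carrier R" "m \<in> H" "m' \<in> H"
      "a = r \<odot>\<^bsub>M\<^esub> s \<oplus>\<^bsub>M\<^esub> m" "b = r' \<odot>\<^bsub>M\<^esub> s \<oplus>\<^bsub>M\<^esub> m'" using ab by blast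
    then have "a \<oplus>\<^bsub>M\<^esub> b = (r \<oplus> r') \<odot>\<^bsub>M\<^esub> s \<oplus>\<^bsub>M\<^esub> (m \<oplus>\<^bsub>M\<^esub> m')"
      using s Hc by (simp add: smult_l_distr M.add_swap4)
    then show ?thesis using e submoduleE(5)[OF H] by blast
  qed
  show "a \<odot>\<^bsub>M\<^esub> x \<in> ?K" if ax: "a \<in> carrier R" "x \<in> ?K" for a x
  proof -
    obtain r m where e: "r \<in> carrier R" "m \<in> H" "x = r \<odot>\<^bsub>M\<^esub> s \<oplus>\<^bsub>M\<^esub> m" using ax by blast
    then have "a \<odot>\<^bsub>M\<^esub> x = (a \<otimes> r) \<odot>\<^bsub>M\<^esub> s \<oplus>\<^bsub>M\<^esub> (a \<odot>\<^bsub>M\<^esub> m)"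
      using s ax Hc by (simp add: smult_r_distr smult_assoc1)
    then show ?thesis using e ax submoduleE(4)[OF H] by blast
  qed
qed

definition chain_stable :: "'c set \<Rightarrow> bool"
  where "chain_stable E \<longleftrightarrow> (\<forall>V::nat \<Rightarrow> 'c set. (\<forall>i. submodule (V i) R M \<and> V i \<subseteq> V (Suc i) \<and> V i \<subseteq> E) \<longrightarrow>
      (\<exists>k. \<forall>i\<ge>k. V i = V k))"

lemma chain_stable_subset: "chain_stable E \<Longrightarrow> E' \<subseteq> E \<Longrightarrow> chain_stable E'"
  unfolding chain_stable_def by (meson order_trans)

lemma ideal_chain_stable:
  assumes "noetherian_ring R" and I: "\<And>i. ideal (I i) R" "\<And>i::nat. I i \<subseteq> I (Suc i)"
  shows "\<exists>k. \<forall>i\<ge>k. I i = I k"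
proof -
  have mono: "i \<le> j \<Longrightarrow> I i \<subseteq> I j" for i j by (rule asc_chain_le[of I, OF I(2)])
  have "subset.chain {I. ideal I R} (range I)"
    unfolding subset_chain_def
  proof (intro conjI ballI)
    show "range I \<subseteq> {I. ideal I R}" using I(1) by blast
    fix X Y assume "X \<in> range I" "Y \<in> range I"
    then obtain i j where "X = I i" "Y = I j" by blast
    then show "X \<subseteq> Y \<or> Y \<subseteq> X" using mono[of i j] mono[of j i] nat_le_linear[of i j] by blast
  qed
  then have "\<Union>(range I) \<in> range I"
    by (intro noetherian_ring.ideal_chain_is_trivial[OF assms(1)]) auto
  then obtain k where k: "\<Union>(range I) = I k" by auto
  have "I i = I k" if "i \<ge> k" for i using k mono[OF that] by blast
  then show ?thesis by blast
qed

text \<open>A chain below \<open>R s + H\<close> is controlled by its intersections with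
  \<open>H\<close> and by the ideals of coefficients of \<open>s\<close>. Once both are constant, an
  element of a later member differs from one of the earlier member by an element of
  \<open>H\<close>, and this difference already lies in the earlier member.\<close>

lemma chain_stable_adjoin:
  assumes noeth: "noetherian_ring R" and H: "submodule H R M" "chain_stable H" and s: "s \<in> carrier M"
  shows "chain_stable {r \<odot>\<^bsub>M\<^esub> s \<oplus>\<^bsub>M\<^esub> m | r m. r \<in> carrier R \<and> m \<in> H}" (is "chain_stable ?K")
  unfolding chain_stable_def
proof (intro allI impI)
  fix V :: "nat \<Rightarrow> 'c set"
  assume "\<forall>i. submodule (V i) R M \<and> V i \<subseteq> V (Suc i) \<and> V i \<subseteq> ?K"
  then have V: "\<And>i. submodule (V i) R M" "\<And>i. V i \<subseteq> V (Suc i)" "\<And>i. V i \<subseteq> ?K" by blast+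
  note Hc = submodule_carrier[OF H(1)]
  define I where "I i = {r \<in> carrier R. \<exists>m\<in>H. r \<odot>\<^bsub>M\<^esub> s \<oplus>\<^bsub>M\<^esub> m \<in> V i}" for i
  have "ideal (I i) R" for i
  proof (rule ideal_by_closure)
    have "\<zero> \<odot>\<^bsub>M\<^esub> s \<oplus>\<^bsub>M\<^esub> \<zero>\<^bsub>M\<^esub> \<in> V i" using s submodule_zero[OF V(1)] by simp
    then show "\<zero> \<in> I i" unfolding I_def using submodule_zero[OF H(1)] by blast
    show "a \<oplus> b \<in> I i" if ab: "a \<in> I i" "b \<in> I i" for a b
    proof -
      obtain m m' where e: "a \<in> carrier R" "b \<in> carrier R" "m \<in> H" "m' \<in> H"
        "a \<odot>\<^bsub>M\<^esub> s \<oplus>\<^bsub>M\<^esub> m \<in> V i" "b \<odot>\<^bsub>M\<^esub> s \<oplus>\<^bsub>M\<^esub> m' \<in> V i" using ab unfolding I_def by blast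
      have "(a \<oplus> b) \<odot>\<^bsub>M\<^esub> s \<oplus>\<^bsub>M\<^esub> (m \<oplus>\<^bsub>M\<^esub> m') = (a \<odot>\<^bsub>M\<^esub> s \<oplus>\<^bsub>M\<^esub> m) \<oplus>\<^bsub>M\<^esub> (b \<odot>\<^bsub>M\<^esub> s \<oplus>\<^bsub>M\<^esub> m')"
        using s e Hc by (simp add: smult_l_distr M.add_swap4)
      then have "(a \<oplus> b) \<odot>\<^bsub>M\<^esub> s \<oplus>\<^bsub>M\<^esub> (m \<oplus>\<^bsub>M\<^esub> m') \<in> V i"
        using submoduleE(5)[OF V(1) e(5,6)] by simp
      moreover have "a \<oplus> b \<in> carrier R" "m \<oplus>\<^bsub>M\<^esub> m' \<in> H" using e submoduleE(5)[OF H(1)] by auto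
      ultimately show ?thesis unfolding I_def by blast
    qed
    show "a \<otimes> b \<in> I i" if ab: "a \<in> carrier R" "b \<in> I i" for a b
    proof -
      obtain m where e: "b \<in> carrier R" "m \<in> H" "b \<odot>\<^bsub>M\<^esub> s \<oplus>\<^bsub>M\<^esub> m \<in> V i" using ab unfolding I_def by blast
      have "(a \<otimes> b) \<odot>\<^bsub>M\<^esub> s \<oplus>\<^bsub>M\<^esub> (a \<odot>\<^bsub>M\<^esub> m) = a \<odot>\<^bsub>M\<^esub> (b \<odot>\<^bsub>M\<^esub> s \<oplus>\<^bsub>M\<^esub> m)"
        using s e ab Hc by (simp add: smult_r_distr smult_assoc1)
      then have "(a \<otimes> b) \<odot>\<^bsub>M\<^esub> s \<oplus>\<^bsub>M\<^esub> (a \<odot>\<^bsub>M\<^esub> m) \<in> V i"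
        using submoduleE(4)[OF V(1) ab(1) e(3)] by simp
      moreover have "a \<otimes> b \<in> carrier R" "a \<odot>\<^bsub>M\<^esub> m \<in> H" using e ab submoduleE(4)[OF H(1)] by auto
      ultimately show ?thesis unfolding I_def by blast
    qed
  qed (auto simp: I_def)
  moreover have "I i \<subseteq> I (Suc i)" for i unfolding I_def using V(2) by blast
  ultimately obtain k1 where k1: "\<And>i. i \<ge> k1 \<Longrightarrow> I i = I k1" using ideal_chain_stable[OF noeth, of I] by blast
  have "\<exists>k. \<forall>i\<ge>k. V i \<inter> H = V k \<inter> H"
    using H(2)[unfolded chain_stable_def, rule_format, of "\<lambda>i. V i \<inter> H"] V(1,2) H(1) submodule_inter by blast
  then obtain k2 where k2: "\<And>i. i \<ge> k2 \<Longrightarrow> V i \<inter> H = V k2 \<inter> H" by blast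
  define k where "k = max k1 k2"
  have "V i = V k" if ik: "i \<ge> k" for i
  proof
    show sub: "V k \<subseteq> V i" by (rule asc_chain_le[of V, OF V(2) ik])
    have eq: "I i = I k" "V i \<inter> H = V k \<inter> H"
      using k1[of i] k1[of k] k2[of i] k2[of k] ik unfolding k_def by auto
    show "V i \<subseteq> V k"
    proof
      fix x assume x: "x \<in> V i"
      then obtain r m where e: "r \<in> carrier R" "m \<in> H" "x = r \<odot>\<^bsub>M\<^esub> s \<oplus>\<^bsub>M\<^esub> m" using V(3) by blast
      then have "r \<in> I k" using x eq unfolding I_def by blast
      then obtain m' where m': "m' \<in> H" "r \<odot>\<^bsub>M\<^esub> s \<oplus>\<^bsub>M\<^esub> m' \<in> V k" unfolding I_def by blast
      have c: "r \<odot>\<^bsub>M\<^esub> s \<in> carrier M" "m \<in> carrier M" "m' \<in> carrier M" using e m' s Hc by auto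
      have "x \<ominus>\<^bsub>M\<^esub> (r \<odot>\<^bsub>M\<^esub> s \<oplus>\<^bsub>M\<^esub> m') = m \<ominus>\<^bsub>M\<^esub> m'"
        using c unfolding e(3) by (simp add: M.minus_add M.minus_eq M.a_ac M.r_neg2 M.r_neg1 M.r_neg)
      moreover have "x \<ominus>\<^bsub>M\<^esub> (r \<odot>\<^bsub>M\<^esub> s \<oplus>\<^bsub>M\<^esub> m') \<in> V i" using submodule_minus[OF V(1) x] m' sub by blast
      moreover have "m \<ominus>\<^bsub>M\<^esub> m' \<in> H" using submodule_minus[OF H(1)] e m' by blast
      ultimately have "m \<ominus>\<^bsub>M\<^esub> m' \<in> V k" using eq by auto
      then have "(m \<ominus>\<^bsub>M\<^esub> m') \<oplus>\<^bsub>M\<^esub> (r \<odot>\<^bsub>M\<^esub> s \<oplus>\<^bsub>M\<^esub> m') \<in> V k" using submoduleE(5)[OF V(1)] m' by blast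
      moreover have "(m \<ominus>\<^bsub>M\<^esub> m') \<oplus>\<^bsub>M\<^esub> (r \<odot>\<^bsub>M\<^esub> s \<oplus>\<^bsub>M\<^esub> m') = x"
        using M.sub_add_swap[OF c(2,3,1)] e(3) by simp
      ultimately show "x \<in> V k" by simp
    qed
  qed
  then show "\<exists>k. \<forall>i\<ge>k. V i = V k" by blast
qed

end

lemma (in noetherian_module) chain_stable_carrier: "chain_stable (carrier M)"
proof -
  obtain S where S: "finite S" "S \<subseteq> carrier M" "gen_submodule R M S = carrier M"
    using fin_gen unfolding fin_gen_module_def by blast
  have "chain_stable (gen_submodule R M S)" using S(1,2)
  proof induct
    case empty
    have "gen_submodule R M {} \<subseteq> {\<zero>\<^bsub>M\<^esub>}" by (rule gen_submodule_least[OF submodule_zero_set]) simp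
    moreover have "chain_stable {\<zero>\<^bsub>M\<^esub>}" unfolding chain_stable_def
    proof (intro allI impI)
      fix V :: "nat \<Rightarrow> 'c set"
      assume "\<forall>i. submodule (V i) R M \<and> V i \<subseteq> V (Suc i) \<and> V i \<subseteq> {\<zero>\<^bsub>M\<^esub>}"
      then have "V i = {\<zero>\<^bsub>M\<^esub>}" for i using submodule_zero[of "V i"] by blast
      then show "\<exists>k. \<forall>i\<ge>k. V i = V k" by simp
    qed
    ultimately show ?case by (rule chain_stable_subset[rotated])
  next
    case (insert s S)
    let ?H = "gen_submodule R M S"
    let ?K = "{r \<odot>\<^bsub>M\<^esub> s \<oplus>\<^bsub>M\<^esub> m | r m. r \<in> carrier R \<and> m \<in> ?H}"
    have H: "submodule ?H R M" using insert gen_submodule_submodule by simp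
    have s: "s \<in> carrier M" using insert by simp
    have "s = \<one> \<odot>\<^bsub>M\<^esub> s \<oplus>\<^bsub>M\<^esub> \<zero>\<^bsub>M\<^esub>" using s by simp
    then have "s \<in> ?K" using submodule_zero[OF H] by blast
    moreover have "x \<in> ?K" if "x \<in> S" for x
    proof -
      have "x \<in> ?H" using that gen_submodule_incl by blast
      moreover from this have "x = \<zero> \<odot>\<^bsub>M\<^esub> s \<oplus>\<^bsub>M\<^esub> x" using s submodule_carrier[OF H] by simp
      ultimately show ?thesis by blast
    qed
    ultimately have "gen_submodule R M (insert s S) \<subseteq> ?K"
      by (intro gen_submodule_least submodule_span_sub[OF H s]) auto
    then show ?case using chain_stable_adjoin[OF noetherian H _ s] insert chain_stable_subset by blast
  qed
  then show ?thesis using S(3) by simp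
qed

section \<open>Sequences of submodules\<close>

text \<open>This is \<open>y 1 H + ... + y k H\<close>. Adding one summand at a time replaces finite
  sums by an induction on \<open>k\<close>.\<close>

primrec lin_comb :: "('a, 'c, 'l) module_scheme \<Rightarrow> (nat \<Rightarrow> 'a) \<Rightarrow> 'c set \<Rightarrow> nat \<Rightarrow> 'c set"
  where "lin_comb M y H 0 = {\<zero>\<^bsub>M\<^esub>}"
  | "lin_comb M y H (Suc k) = {a \<oplus>\<^bsub>M\<^esub> y (Suc k) \<odot>\<^bsub>M\<^esub> b | a b. a \<in> lin_comb M y H k \<and> b \<in> H}"

text \<open>A sequence of submodules stable under the \<open>y j\<close> plays the role of a graded submodule of a
  Rees module.\<close>

locale module_seq = module R M for R (structure) and M (structure) +
  fixes y :: "nat \<Rightarrow> 'a" and c :: nat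
  assumes y_closed: "\<And>j. j \<in> {1..c} \<Longrightarrow> y j \<in> carrier R"
begin

definition stable_seq :: "(nat \<Rightarrow> 'c set) \<Rightarrow> bool"
  where "stable_seq A \<longleftrightarrow> (\<forall>n. submodule (A n) R M) \<and>
    (\<forall>n. \<forall>j\<in>{1..c}. \<forall>x\<in>A n. y j \<odot>\<^bsub>M\<^esub> x \<in> A (Suc n))"

text \<open>The order \<open>\<le>\<close> is pointwise inclusion, so this is the chain condition
  for graded submodules: the bound \<open>k\<close> has to serve all indices \<open>n\<close> at
  once.\<close>

definition noeth_seq :: "(nat \<Rightarrow> 'c set) \<Rightarrow> bool"
  where "noeth_seq E \<longleftrightarrow> stable_seq E \<and>
    (\<forall>V::nat \<Rightarrow> nat \<Rightarrow> 'c set. (\<forall>i. stable_seq (V i) \<and> V i \<le> V (Suc i) \<and> V i \<le> E) \<longrightarrow>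
      (\<exists>k. \<forall>i\<ge>k. V i = V k))"

lemma stable_seqD:
  assumes "stable_seq A"
  shows "submodule (A n) R M" "j \<in> {1..c} \<Longrightarrow> x \<in> A n \<Longrightarrow> y j \<odot>\<^bsub>M\<^esub> x \<in> A (Suc n)"
  using assms by (auto simp: stable_seq_def)

lemma noeth_seq_stable: "noeth_seq A \<Longrightarrow> stable_seq A"
  by (simp add: noeth_seq_def)

lemma noeth_seq_chain:
  assumes "noeth_seq E" "\<And>i. stable_seq (V i)" "\<And>i. V i \<le> V (Suc i)" "\<And>i. V i \<le> E"
  shows "\<exists>k. \<forall>i\<ge>k. V i = V k"
  using assms unfolding noeth_seq_def by simp

lemma noeth_seq_subset: "noeth_seq E \<Longrightarrow> stable_seq A \<Longrightarrow> A \<le> E \<Longrightarrow> noeth_seq A"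
  unfolding noeth_seq_def by (meson order_trans)

lemma seq_mono:
  fixes V :: "nat \<Rightarrow> nat \<Rightarrow> 'c set"
  shows "(\<And>i. V i \<le> V (Suc i)) \<Longrightarrow> i \<le> j \<Longrightarrow> V i \<le> V j"
  by (rule lift_Suc_mono_le)

lemma lin_comb_carrier:
  assumes "submodule H R M" "k \<le> c" "x \<in> lin_comb M y H k"
  shows "x \<in> carrier M"
  using assms(2,3)
proof (induct k arbitrary: x)
  case (Suc k)
  then obtain a b where "a \<in> lin_comb M y H k" "b \<in> H" "x = a \<oplus>\<^bsub>M\<^esub> y (Suc k) \<odot>\<^bsub>M\<^esub> b" by auto
  then show ?case using Suc submodule_carrier[OF assms(1)] y_closed[of "Suc k"] by simp
qed auto

lemma lin_comb_submodule:
  assumes H: "submodule H R M" and "k \<le> c"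
  shows "submodule (lin_comb M y H k) R M"
  using assms(2)
proof (induct k)
  case 0 then show ?case by (simp add: submodule_zero_set)
next
  case (Suc k)
  note Hc = submodule_carrier[OF H]
  have S: "submodule (lin_comb M y H k) R M" using Suc by simp
  note Sc = submodule_carrier[OF S]
  have yk: "y (Suc k) \<in> carrier R" using y_closed Suc by simp
  have I: "a \<oplus>\<^bsub>M\<^esub> y (Suc k) \<odot>\<^bsub>M\<^esub> b \<in> lin_comb M y H (Suc k)" if "a \<in> lin_comb M y H k" "b \<in> H" for a b
    using that by auto
  show ?case
  proof (rule submoduleI')
    show "lin_comb M y H (Suc k) \<subseteq> carrier M" using lin_comb_carrier[OF H] Suc by blast
    show "\<zero>\<^bsub>M\<^esub> \<in> lin_comb M y H (Suc k)"
      using I[OF submodule_zero[OF S] submodule_zero[OF H]] yk by simp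
    fix a b assume "a \<in> lin_comb M y H (Suc k)" "b \<in> lin_comb M y H (Suc k)"
    then obtain s t u v where e: "s \<in> lin_comb M y H k" "t \<in> H" "u \<in> lin_comb M y H k" "v \<in> H"
      "a = s \<oplus>\<^bsub>M\<^esub> y (Suc k) \<odot>\<^bsub>M\<^esub> t" "b = u \<oplus>\<^bsub>M\<^esub> y (Suc k) \<odot>\<^bsub>M\<^esub> v" by auto
    then have "a \<oplus>\<^bsub>M\<^esub> b = (s \<oplus>\<^bsub>M\<^esub> u) \<oplus>\<^bsub>M\<^esub> y (Suc k) \<odot>\<^bsub>M\<^esub> (t \<oplus>\<^bsub>M\<^esub> v)"
      using yk Hc Sc by (simp add: smult_r_distr M.add_swap4)
    then show "a \<oplus>\<^bsub>M\<^esub> b \<in> lin_comb M y H (Suc k)"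
      using I[OF submoduleE(5)[OF S e(1,3)] submoduleE(5)[OF H e(2,4)]] by simp
  next
    fix a x assume a: "a \<in> carrier R" and "x \<in> lin_comb M y H (Suc k)"
    then obtain s t where e: "s \<in> lin_comb M y H k" "t \<in> H" "x = s \<oplus>\<^bsub>M\<^esub> y (Suc k) \<odot>\<^bsub>M\<^esub> t" by auto
    then have "a \<odot>\<^bsub>M\<^esub> x = (a \<odot>\<^bsub>M\<^esub> s) \<oplus>\<^bsub>M\<^esub> y (Suc k) \<odot>\<^bsub>M\<^esub> (a \<odot>\<^bsub>M\<^esub> t)"
      using yk Hc Sc a by (simp add: smult_r_distr smult_assoc1[symmetric] R.m_comm)
    then show "a \<odot>\<^bsub>M\<^esub> x \<in> lin_comb M y H (Suc k)"
      using I[OF submoduleE(4)[OF S a e(1)] submoduleE(4)[OF H a e(2)]] by simp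
  qed
qed

lemma lin_comb_gen:
  assumes H: "submodule H R M" and "k \<le> c" "j \<in> {1..k}" and x: "x \<in> H"
  shows "y j \<odot>\<^bsub>M\<^esub> x \<in> lin_comb M y H k"
  using assms(2,3)
proof (induct k)
  case (Suc k)
  show ?case
  proof (cases "j = Suc k")
    case True
    then show ?thesis using submodule_zero[OF lin_comb_submodule[OF H, of k]] Suc x
        y_closed[of j] submodule_carrier[OF H] by force
  next
    case False
    then have *: "y j \<odot>\<^bsub>M\<^esub> x \<in> lin_comb M y H k" using Suc by simp
    then have "y j \<odot>\<^bsub>M\<^esub> x \<oplus>\<^bsub>M\<^esub> y (Suc k) \<odot>\<^bsub>M\<^esub> \<zero>\<^bsub>M\<^esub> = y j \<odot>\<^bsub>M\<^esub> x"
      using lin_comb_carrier[OF H, of k] Suc y_closed[of "Suc k"] by simp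
    then show ?thesis using * submodule_zero[OF H] by force
  qed
qed simp

lemma lin_comb_least:
  assumes "submodule L R M" "\<And>j x. j \<in> {1..k} \<Longrightarrow> x \<in> H \<Longrightarrow> y j \<odot>\<^bsub>M\<^esub> x \<in> L"
  shows "lin_comb M y H k \<subseteq> L"
  using assms(2)
proof (induct k)
  case 0 then show ?case using submodule_zero[OF assms(1)] by simp
next
  case (Suc k)
  then have "lin_comb M y H k \<subseteq> L" by simp
  then show ?case using Suc(2)[of "Suc k"] submoduleE(5)[OF assms(1)] by auto
qed

lemma lin_comb_mono: "H \<subseteq> K \<Longrightarrow> lin_comb M y H k \<subseteq> lin_comb M y K k"
  by (induct k) auto

text \<open>A Noetherian graded module is generated in finitely many degrees, and beyond these each
  component comes from its predecessor through the \<open>y j\<close>.\<close>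

lemma noeth_seq_generated:
  assumes A: "noeth_seq A"
  shows "\<exists>n0. \<forall>n\<ge>n0. A (Suc n) = lin_comb M y (A n) c"
proof -
  have As: "stable_seq A" using A by (rule noeth_seq_stable)
  note Asub = stable_seqD(1)[OF As]
  \<comment> \<open>\<open>V i\<close> agrees with \<open>A\<close> up to index \<open>i\<close> and
    is generated by the \<open>y j\<close> from there on. Where this chain is constant,
    \<open>A (Suc n)\<close> equals the part generated by \<open>A n\<close>.\<close>
  define V where "V i n = rec_nat (A 0) (\<lambda>n X. if Suc n \<le> i then A (Suc n) else lin_comb M y X c) n" for i n :: nat
  have V0: "V i 0 = A 0" and VS: "V i (Suc n) = (if Suc n \<le> i then A (Suc n) else lin_comb M y (V i n) c)" for i n
    by (simp_all add: V_def)
  have VA: "n \<le> i \<Longrightarrow> V i n = A n" for i n by (cases n) (auto simp: V0 VS)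
  have Vsub: "submodule (V i n) R M" for i n
    by (induct n) (auto simp: V0 VS Asub intro: lin_comb_submodule)
  have yA: "lin_comb M y (A n) c \<subseteq> A (Suc n)" for n
    by (rule lin_comb_least[OF Asub stable_seqD(2)[OF As]])
  have VleA: "V i n \<subseteq> A n" for i n
  proof (induct n)
    case (Suc n)
    then have "lin_comb M y (V i n) c \<subseteq> A (Suc n)" using lin_comb_mono[OF Suc, of c] yA by blast
    then show ?case by (simp add: VS)
  qed (simp add: V0)
  have Vst: "stable_seq (V i)" for i
    unfolding stable_seq_def
  proof (intro conjI allI ballI)
    fix n j x assume j: "j \<in> {1..c}" and x: "x \<in> V i n"
    show "y j \<odot>\<^bsub>M\<^esub> x \<in> V i (Suc n)"
      using lin_comb_gen[OF Vsub le_refl j x] stable_seqD(2)[OF As j, of x n] VleA[of i n] x by (auto simp: VS)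
  qed (rule Vsub)
  have Vmono: "V i \<le> V (Suc i)" for i
  proof (rule le_funI)
    fix n show "V i n \<subseteq> V (Suc i) n"
    proof (induct n)
      case (Suc n)
      then show ?case using lin_comb_mono[OF Suc, of c] VleA[of i "Suc n"] by (auto simp: VS)
    qed (simp add: V0)
  qed
  obtain k where k: "\<And>i. i \<ge> k \<Longrightarrow> V i = V k"
    using noeth_seq_chain[OF A, of V, OF Vst Vmono] VleA by (auto simp: le_fun_def)
  have "A (Suc n) = lin_comb M y (A n) c" if "n \<ge> k" for n
  proof -
    have "A (Suc n) = V (Suc n) (Suc n)" using VA by simp
    also have "\<dots> = V n (Suc n)" using k[of "Suc n"] k[of n] that by simp
    also have "\<dots> = lin_comb M y (A n) c" by (simp add: VS VA)
    finally show ?thesis .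
  qed
  then show ?thesis by blast
qed

text \<open>Multiplication by \<open>a\<close> maps \<open>D\<close> to \<open>E\<close> with kernel
  \<open>?K\<close>, and a chain in \<open>D\<close> is constant once its images and its
  intersections with the kernel are. Here \<open>a\<close> acts as an element of \<open>R\<close>
  and keeps the index \<open>n\<close>, unlike a generator of the Rees algebra.\<close>

lemma noeth_seq_extension:
  assumes D: "stable_seq D" and a: "a \<in> carrier R" and E: "noeth_seq E"
    and aD: "\<And>n x. x \<in> D n \<Longrightarrow> a \<odot>\<^bsub>M\<^esub> x \<in> E n"
    and K: "noeth_seq (\<lambda>n. {x \<in> D n. a \<odot>\<^bsub>M\<^esub> x = \<zero>\<^bsub>M\<^esub>})" (is "noeth_seq ?K")
  shows "noeth_seq D"
  unfolding noeth_seq_def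
proof (intro conjI allI impI)
  fix V :: "nat \<Rightarrow> nat \<Rightarrow> 'c set"
  assume "\<forall>i. stable_seq (V i) \<and> V i \<le> V (Suc i) \<and> V i \<le> D"
  then have V: "\<And>i. stable_seq (V i)" "\<And>i. V i \<le> V (Suc i)" "\<And>i n. V i n \<subseteq> D n"
    by (auto simp: le_fun_def)
  note Vsub = stable_seqD(1)[OF V(1)]
  note Vc = submodule_carrier[OF Vsub]
  have ycomm: "r \<odot>\<^bsub>M\<^esub> (a \<odot>\<^bsub>M\<^esub> x) = a \<odot>\<^bsub>M\<^esub> (r \<odot>\<^bsub>M\<^esub> x)" if "r \<in> carrier R" "x \<in> carrier M" for r x
    using that a by (simp add: smult_assoc1[symmetric] R.m_comm)
  have "stable_seq (\<lambda>n. (\<lambda>x. a \<odot>\<^bsub>M\<^esub> x) ` V i n)" for i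
    unfolding stable_seq_def
  proof (intro conjI allI ballI)
    fix n
    show "submodule ((\<lambda>x. a \<odot>\<^bsub>M\<^esub> x) ` V i n) R M"
    proof (rule submoduleI')
      show "(\<lambda>x. a \<odot>\<^bsub>M\<^esub> x) ` V i n \<subseteq> carrier M" using a Vc by auto
      have "a \<odot>\<^bsub>M\<^esub> \<zero>\<^bsub>M\<^esub> \<in> (\<lambda>x. a \<odot>\<^bsub>M\<^esub> x) ` V i n" using submodule_zero[OF Vsub] by blast
      then show "\<zero>\<^bsub>M\<^esub> \<in> (\<lambda>x. a \<odot>\<^bsub>M\<^esub> x) ` V i n" using a by simp
      fix s t assume "s \<in> (\<lambda>x. a \<odot>\<^bsub>M\<^esub> x) ` V i n" "t \<in> (\<lambda>x. a \<odot>\<^bsub>M\<^esub> x) ` V i n"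
      then obtain p q where e: "p \<in> V i n" "q \<in> V i n" "s = a \<odot>\<^bsub>M\<^esub> p" "t = a \<odot>\<^bsub>M\<^esub> q" by blast
      then have "s \<oplus>\<^bsub>M\<^esub> t = a \<odot>\<^bsub>M\<^esub> (p \<oplus>\<^bsub>M\<^esub> q)" using a Vc by (simp add: smult_r_distr)
      then show "s \<oplus>\<^bsub>M\<^esub> t \<in> (\<lambda>x. a \<odot>\<^bsub>M\<^esub> x) ` V i n" using submoduleE(5)[OF Vsub e(1,2)] by blast
    next
      fix r s assume r: "r \<in> carrier R" and "s \<in> (\<lambda>x. a \<odot>\<^bsub>M\<^esub> x) ` V i n"
      then obtain p where e: "p \<in> V i n" "s = a \<odot>\<^bsub>M\<^esub> p" by blast
      then have "r \<odot>\<^bsub>M\<^esub> s = a \<odot>\<^bsub>M\<^esub> (r \<odot>\<^bsub>M\<^esub> p)" using ycomm[OF r] Vc by simp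
      then show "r \<odot>\<^bsub>M\<^esub> s \<in> (\<lambda>x. a \<odot>\<^bsub>M\<^esub> x) ` V i n" using submoduleE(4)[OF Vsub r e(1)] by blast
    qed
  next
    fix n j s assume j: "j \<in> {1..c}" and "s \<in> (\<lambda>x. a \<odot>\<^bsub>M\<^esub> x) ` V i n"
    then obtain p where e: "p \<in> V i n" "s = a \<odot>\<^bsub>M\<^esub> p" by blast
    then have "y j \<odot>\<^bsub>M\<^esub> s = a \<odot>\<^bsub>M\<^esub> (y j \<odot>\<^bsub>M\<^esub> p)" using ycomm[OF y_closed[OF j]] Vc by simp
    then show "y j \<odot>\<^bsub>M\<^esub> s \<in> (\<lambda>x. a \<odot>\<^bsub>M\<^esub> x) ` V i (Suc n)" using stable_seqD(2)[OF V(1) j e(1)] by blast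
  qed
  moreover have "(\<lambda>n. (\<lambda>x. a \<odot>\<^bsub>M\<^esub> x) ` V i n) \<le> (\<lambda>n. (\<lambda>x. a \<odot>\<^bsub>M\<^esub> x) ` V (Suc i) n)" for i
    using V(2)[of i] by (auto simp: le_fun_def)
  moreover have "(\<lambda>n. (\<lambda>x. a \<odot>\<^bsub>M\<^esub> x) ` V i n) \<le> E" for i
    using V(3)[of i] aD by (auto simp: le_fun_def)
  ultimately obtain k1 where
    k1: "\<And>i. i \<ge> k1 \<Longrightarrow> (\<lambda>n. (\<lambda>x. a \<odot>\<^bsub>M\<^esub> x) ` V i n) = (\<lambda>n. (\<lambda>x. a \<odot>\<^bsub>M\<^esub> x) ` V k1 n)"
    using noeth_seq_chain[OF E, of "\<lambda>i n. (\<lambda>x. a \<odot>\<^bsub>M\<^esub> x) ` V i n"] by blast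
  have Kst: "stable_seq ?K" using K by (rule noeth_seq_stable)
  have "stable_seq (\<lambda>n. V i n \<inter> ?K n)" for i
    unfolding stable_seq_def using stable_seqD[OF V(1)[of i]] stable_seqD[OF Kst] submodule_inter by blast
  moreover have "(\<lambda>n. V i n \<inter> ?K n) \<le> (\<lambda>n. V (Suc i) n \<inter> ?K n)" for i
    using V(2)[of i] by (auto simp: le_fun_def)
  moreover have "(\<lambda>n. V i n \<inter> ?K n) \<le> ?K" for i by (auto simp: le_fun_def)
  ultimately obtain k2 where k2: "\<And>i. i \<ge> k2 \<Longrightarrow> (\<lambda>n. V i n \<inter> ?K n) = (\<lambda>n. V k2 n \<inter> ?K n)"
    using noeth_seq_chain[OF K, of "\<lambda>i n. V i n \<inter> ?K n"] by blast
  have "V i = V (max k1 k2)" if i: "i \<ge> max k1 k2" for i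
  proof
    fix n
    let ?k = "max k1 k2"
    have sub: "V ?k n \<subseteq> V i n" using seq_mono[of V, OF V(2) i] by (simp add: le_fun_def)
    have eq1: "(\<lambda>x. a \<odot>\<^bsub>M\<^esub> x) ` V i n = (\<lambda>x. a \<odot>\<^bsub>M\<^esub> x) ` V ?k n"
      using fun_cong[OF k1[of i], of n] fun_cong[OF k1[of ?k], of n] i by simp
    have eq2: "V i n \<inter> ?K n = V ?k n \<inter> ?K n"
      using fun_cong[OF k2[of i], of n] fun_cong[OF k2[of ?k], of n] i by simp
    show "V i n = V ?k n"
    proof
      show "V i n \<subseteq> V ?k n"
      proof
        fix x assume x: "x \<in> V i n"
        then obtain x' where x': "x' \<in> V ?k n" "a \<odot>\<^bsub>M\<^esub> x = a \<odot>\<^bsub>M\<^esub> x'" using eq1 by blast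
        have c: "x \<in> carrier M" "x' \<in> carrier M" using x x' Vc by blast+
        have d: "x \<ominus>\<^bsub>M\<^esub> x' \<in> V i n" using submodule_minus[OF Vsub x] x' sub by blast
        have "a \<odot>\<^bsub>M\<^esub> (x \<ominus>\<^bsub>M\<^esub> x') = \<zero>\<^bsub>M\<^esub>"
          using a c x'(2) by (simp add: M.minus_eq smult_r_distr smult_r_minus M.r_neg)
        then have "x \<ominus>\<^bsub>M\<^esub> x' \<in> V ?k n" using d V(3) eq2 by blast
        then have "(x \<ominus>\<^bsub>M\<^esub> x') \<oplus>\<^bsub>M\<^esub> x' \<in> V ?k n" using x' submoduleE(5)[OF Vsub] by blast
        then show "x \<in> V ?k n" using c by (simp add: M.minus_eq M.a_assoc M.l_neg)
      qed
    qed (rule sub)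
  qed
  then show "\<exists>k. \<forall>i\<ge>k. V i = V k" by blast
qed (rule D)

end

section \<open>The group of sequences in \<open>M\<close> and Hilbert's theorem for it\<close>

lemma op_subgroupD: "op_subgroup G \<Omega> V \<Longrightarrow> h \<in> \<Omega> \<Longrightarrow> x \<in> V \<Longrightarrow> h x \<in> V"
  by (simp add: op_subgroup_def)

text \<open>It is only the ambient group on which the operators act, so no finiteness of support is
  demanded.\<close>

definition seq_group :: "('c, 'k) ring_scheme \<Rightarrow> (nat \<Rightarrow> 'c) ring"
  where "seq_group M = \<lparr>carrier = {f. \<forall>n. f n \<in> carrier M}, monoid.mult = undefined, one = undefined,
    zero = (\<lambda>n. \<zero>\<^bsub>M\<^esub>), add = (\<lambda>f g n. f n \<oplus>\<^bsub>M\<^esub> g n)\<rparr>"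

lemma seq_group_simps [simp]:
  "carrier (seq_group M) = {f. \<forall>n. f n \<in> carrier M}"
  "zero (seq_group M) = (\<lambda>n. \<zero>\<^bsub>M\<^esub>)" "add (seq_group M) f g = (\<lambda>n. f n \<oplus>\<^bsub>M\<^esub> g n)"
  by (simp_all add: seq_group_def)

context abelian_group
begin

lemma seq_group: "abelian_group (seq_group G)"
proof (rule abelian_groupI)
  fix f assume "f \<in> carrier (seq_group G)"
  then show "\<exists>g\<in>carrier (seq_group G). g \<oplus>\<^bsub>seq_group G\<^esub> f = \<zero>\<^bsub>seq_group G\<^esub>"
    by (intro bexI[of _ "\<lambda>n. \<ominus> f n"]) (auto simp: l_neg)
qed (auto simp: fun_eq_iff a_ac)

lemma seq_group_minus:
  assumes "f \<in> carrier (seq_group G)"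
  shows "\<ominus>\<^bsub>seq_group G\<^esub> f = (\<lambda>n. \<ominus> f n)"
  by (rule abelian_group.minus_equality[OF seq_group]) (use assms in \<open>auto simp: l_neg\<close>)

end

locale noeth_module_seq = noetherian_module R M + module_seq R M y c
  for R (structure) and M (structure) and y c
begin

text \<open>Multiplication by \<open>y j\<close> regarded as an element of the summand
  \<open>J^1\<close> of the Rees algebra.\<close>

abbreviation shift :: "nat \<Rightarrow> (nat \<Rightarrow> 'c) \<Rightarrow> (nat \<Rightarrow> 'c)"
  where "shift j f \<equiv> (\<lambda>n. case n of 0 \<Rightarrow> \<zero>\<^bsub>M\<^esub> | Suc m \<Rightarrow> y j \<odot>\<^bsub>M\<^esub> f m)"

abbreviation scalars :: "((nat \<Rightarrow> 'c) \<Rightarrow> (nat \<Rightarrow> 'c)) set"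
  where "scalars \<equiv> (\<lambda>r f n. r \<odot>\<^bsub>M\<^esub> f n) ` carrier R"

text \<open>Such sequences form a copy of \<open>E\<close> through \<open>f 0\<close>, so they
  inherit the chain condition of \<open>M\<close>. They are the coefficients to which the shifts are
  adjoined.\<close>

lemma op_noetherian_concentrated:
  assumes E: "submodule E R M"
  shows "op_noetherian (seq_group M) scalars {f. f 0 \<in> E \<and> (\<forall>n. f (Suc n) = \<zero>\<^bsub>M\<^esub>)}"
    (is "op_noetherian ?G _ ?C")
proof -
  interpret G: abelian_group ?G by (rule M.seq_group)
  have Cc: "f n \<in> carrier M" if "f \<in> ?C" for f n
    using that submodule_carrier[OF E] by (cases n) auto
  have "additive_subgroup ?C ?G"
  proof (rule G.additive_subgroupI)
    fix a assume a: "a \<in> ?C"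
    then have "\<ominus>\<^bsub>?G\<^esub> a = (\<lambda>n. \<ominus>\<^bsub>M\<^esub> a n)" using Cc by (intro M.seq_group_minus) auto
    then show "\<ominus>\<^bsub>?G\<^esub> a \<in> ?C" using a submoduleE(3)[OF E] by simp
  qed (use Cc submodule_zero[OF E] submoduleE(5)[OF E] in auto)
  then have C: "op_subgroup ?G scalars ?C"
    unfolding op_subgroup_def
  proof (intro conjI ballI)
    fix h f assume "h \<in> scalars" "f \<in> ?C"
    then obtain r where "r \<in> carrier R" "h = (\<lambda>f n. r \<odot>\<^bsub>M\<^esub> f n)" "f 0 \<in> E" "\<And>n. f (Suc n) = \<zero>\<^bsub>M\<^esub>" by blast
    then show "h f \<in> ?C" using submoduleE(4)[OF E] by simp
  qed
  have "\<exists>k. \<forall>i\<ge>k. V i = V k"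
    if V: "\<And>i. op_subgroup ?G scalars (V i)" "\<And>i. V i \<subseteq> V (Suc i)" "\<And>i. V i \<subseteq> ?C" for V :: "nat \<Rightarrow> (nat \<Rightarrow> 'c) set"
  proof -
    define W where "W i = (\<lambda>f. f 0) ` V i" for i
    have Wc: "W i \<subseteq> carrier M" for i
    proof
      fix x assume "x \<in> W i"
      then obtain f where f: "f \<in> V i" "x = f 0" unfolding W_def by blast
      then have "f \<in> ?C" using V(3)[of i] by blast
      then show "x \<in> carrier M" using Cc[of f 0] f(2) by simp
    qed
    have "submodule (W i) R M" for i
    proof (rule submoduleI')
      interpret Vi: additive_subgroup "V i" ?G using V(1) by (simp add: op_subgroup_def)
      show "W i \<subseteq> carrier M" by (rule Wc)
      show "\<zero>\<^bsub>M\<^esub> \<in> W i" unfolding W_def using Vi.zero_closed by (auto simp: image_iff intro!: bexI)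
      fix a b assume "a \<in> W i" "b \<in> W i"
      then obtain f g where "f \<in> V i" "g \<in> V i" "a = f 0" "b = g 0" unfolding W_def by blast
      then show "a \<oplus>\<^bsub>M\<^esub> b \<in> W i" unfolding W_def using Vi.a_closed[of f g] by (auto simp: image_iff intro!: bexI)
    next
      fix r x assume r: "r \<in> carrier R" and "x \<in> W i"
      then obtain f where f: "f \<in> V i" "x = f 0" unfolding W_def by blast
      then have "(\<lambda>n. r \<odot>\<^bsub>M\<^esub> f n) \<in> V i" 
        using op_subgroupD[OF V(1)[of i] _ f(1), of "\<lambda>f n. r \<odot>\<^bsub>M\<^esub> f n"] r by blast
      then show "r \<odot>\<^bsub>M\<^esub> x \<in> W i" unfolding W_def using f by (auto simp: image_iff intro!: bexI)
    qed
    moreover have "W i \<subseteq> W (Suc i)" for i unfolding W_def by (rule image_mono) (rule V(2))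
    ultimately obtain k where k: "\<And>i. i \<ge> k \<Longrightarrow> W i = W k"
      using chain_stable_carrier[unfolded chain_stable_def, rule_format, of W] Wc by blast
    have "V i = V k" if i: "i \<ge> k" for i
    proof
      show sub: "V k \<subseteq> V i" by (rule asc_chain_le[of V, OF V(2) i])
      show "V i \<subseteq> V k"
      proof
        fix f assume f: "f \<in> V i"
        then have "f 0 \<in> W k" using k[OF i] unfolding W_def by blast
        then obtain g where g: "g \<in> V k" "f 0 = g 0" unfolding W_def by blast
        have "f \<in> ?C" "g \<in> ?C" using f g V(3) by blast+
        then have "f n = g n" for n using g(2) by (cases n) auto
        then have "f = g" by blast
        then show "f \<in> V k" using g by simp
      qed
    qed
    then show ?thesis by blast
  qed
  with C show ?thesis unfolding op_noetherian_def by simp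
qed

text \<open>Adjoining the shifts one at a time to the copy of \<open>E 0\<close> gives a Noetherian
  group \<open>U\<close>. By \<open>gen\<close>, every element of \<open>E n\<close> placed at index
  \<open>n\<close> belongs to \<open>U\<close>. Hence a stable sequence below \<open>E\<close> can
  be recovered from the members of \<open>U\<close> that lie in it at every index, and chains
  transfer to \<open>U\<close>.\<close>

lemma noeth_seqI:
  assumes E: "stable_seq E" and gen: "\<And>n. E (Suc n) \<subseteq> lin_comb M y (E n) c"
  shows "noeth_seq E"
proof -
  let ?G = "seq_group M" and ?C = "{f. f 0 \<in> E 0 \<and> (\<forall>n. f (Suc n) = \<zero>\<^bsub>M\<^esub>)}"
  note Esub = stable_seqD(1)[OF E]
  interpret G: abelian_group ?G by (rule M.seq_group)
  have "k \<le> c \<Longrightarrow> \<exists>U. op_noetherian ?G (scalars \<union> shift ` {1..k}) U \<and> ?C \<subseteq> U" for k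
  proof (induct k)
    case 0
    then show ?case using op_noetherian_concentrated[OF Esub[of 0]] by auto
  next
    case (Suc k)
    then obtain U where U: "op_noetherian ?G (scalars \<union> shift ` {1..k}) U" "?C \<subseteq> U" by auto
    have yk: "j \<in> {1..Suc k} \<Longrightarrow> y j \<in> carrier R" for j using y_closed Suc by simp
    have sc: "shift j f \<in> carrier ?G" if "j \<in> {1..Suc k}" "f \<in> carrier ?G" for j f
      using that yk by (auto split: nat.split)
    have sa: "shift j (f \<oplus>\<^bsub>?G\<^esub> g) = shift j f \<oplus>\<^bsub>?G\<^esub> shift j g"
      if "j \<in> {1..Suc k}" "f \<in> carrier ?G" "g \<in> carrier ?G" for j f g
      using that yk[of j] by (auto simp: fun_eq_iff smult_r_distr split: nat.split)
    have "\<exists>U'. op_noetherian ?G (insert (shift (Suc k)) (scalars \<union> shift ` {1..k})) U' \<and> U \<subseteq> U'"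
    proof (rule G.op_noetherian_insert[OF U(1)])
      show "shift (Suc k) f \<in> carrier ?G" if "f \<in> carrier ?G" for f using sc that by simp
      show "shift (Suc k) (f \<oplus>\<^bsub>?G\<^esub> g) = shift (Suc k) f \<oplus>\<^bsub>?G\<^esub> shift (Suc k) g"
        if "f \<in> carrier ?G" "g \<in> carrier ?G" for f g using sa that by simp
      fix h f assume h: "h \<in> scalars \<union> shift ` {1..k}" and f: "f \<in> carrier ?G"
      then consider r where "r \<in> carrier R" "h = (\<lambda>f n. r \<odot>\<^bsub>M\<^esub> f n)" | j where "j \<in> {1..k}" "h = shift j" by blast
      note cs = this
      show "h f \<in> carrier ?G" by (rule cs) (use f sc in auto)
      show "h (f \<oplus>\<^bsub>?G\<^esub> g) = h f \<oplus>\<^bsub>?G\<^esub> h g" if "g \<in> carrier ?G" for g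
      proof (rule cs)
        fix j assume "j \<in> {1..k}" "h = shift j"
        then show ?thesis using sa[of j f g] f that by simp
      qed (use f that in \<open>auto simp: smult_r_distr\<close>)
      show "h (shift (Suc k) f) = shift (Suc k) (h f)"
      proof (rule cs)
        fix r assume "r \<in> carrier R" "h = (\<lambda>f n. r \<odot>\<^bsub>M\<^esub> f n)"
        then show ?thesis using f yk[of "Suc k"]
          by (auto simp: fun_eq_iff smult_assoc1[symmetric] R.m_comm split: nat.split)
      next
        fix j assume "j \<in> {1..k}" "h = shift j"
        then show ?thesis using f yk[of "Suc k"] yk[of j]
          by (auto simp: fun_eq_iff smult_assoc1[symmetric] R.m_comm split: nat.split)
      qed
    qed
    then obtain U' where U': "op_noetherian ?G (insert (shift (Suc k)) (scalars \<union> shift ` {1..k})) U'" "U \<subseteq> U'"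
      by blast
    have "{1..Suc k} = insert (Suc k) {1..k}" by auto
    then have "insert (shift (Suc k)) (scalars \<union> shift ` {1..k}) = scalars \<union> shift ` {1..Suc k}"
      by (simp only: image_insert Un_insert_right)
    with U' have "op_noetherian ?G (scalars \<union> shift ` {1..Suc k}) U'" by (simp only:)
    moreover have "?C \<subseteq> U'" by (rule subset_trans[OF U(2) U'(2)])
    ultimately show ?case by (intro exI conjI)
  qed
  then obtain U where U: "op_noetherian ?G (scalars \<union> shift ` {1..c}) U" "?C \<subseteq> U" by blast
  have Uop: "op_subgroup ?G (scalars \<union> shift ` {1..c}) U" using U(1) by (simp add: op_noetherian_def)
  interpret U: additive_subgroup U ?G using Uop by (simp add: op_subgroup_def)
  define \<delta> where "\<delta> n x = (\<lambda>m. if m = n then x else \<zero>\<^bsub>M\<^esub>)" for n :: nat and x :: 'c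
  have \<delta>U: "x \<in> E n \<Longrightarrow> \<delta> n x \<in> U" for n x
  proof (induct n arbitrary: x)
    case 0
    then show ?case using U(2) by (auto simp: \<delta>_def)
  next
    case (Suc n)
    note IH = Suc(1)
    have ind: "k \<le> c \<Longrightarrow> x \<in> lin_comb M y (E n) k \<Longrightarrow> \<delta> (Suc n) x \<in> U" for k x
    proof (induct k arbitrary: x)
      case 0
      then have "\<delta> (Suc n) x = (\<lambda>m. \<zero>\<^bsub>M\<^esub>)" by (auto simp: \<delta>_def)
      then show ?case using U.zero_closed by simp
    next
      case (Suc k)
      then obtain a b where e: "a \<in> lin_comb M y (E n) k" "b \<in> E n" "x = a \<oplus>\<^bsub>M\<^esub> y (Suc k) \<odot>\<^bsub>M\<^esub> b" by auto
      have "shift (Suc k) (\<delta> n b) \<in> U"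
        by (rule op_subgroupD[OF Uop]) (use IH[OF e(2)] Suc(2) in auto)
      moreover have "\<delta> (Suc n) a \<in> U" using Suc e by simp
      ultimately have "\<delta> (Suc n) a \<oplus>\<^bsub>?G\<^esub> shift (Suc k) (\<delta> n b) \<in> U" by (rule U.a_closed[rotated])
      moreover have "\<delta> (Suc n) a \<oplus>\<^bsub>?G\<^esub> shift (Suc k) (\<delta> n b) = \<delta> (Suc n) x"
        using e(3) y_closed[of "Suc k"] Suc(2) by (auto simp: \<delta>_def fun_eq_iff split: nat.split)
      ultimately show ?case by simp
    qed
    show ?case using ind[of c x] gen[of n] Suc(2) by blast
  qed
  show ?thesis unfolding noeth_seq_def
  proof (intro conjI allI impI)
    fix V :: "nat \<Rightarrow> nat \<Rightarrow> 'c set"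
    assume "\<forall>i. stable_seq (V i) \<and> V i \<le> V (Suc i) \<and> V i \<le> E"
    then have V: "\<And>i. stable_seq (V i)" "\<And>i. V i \<le> V (Suc i)" "\<And>i n. V i n \<subseteq> E n"
      by (auto simp: le_fun_def)
    note Vsub = stable_seqD(1)[OF V(1)]
    define W where "W i = {f \<in> U. \<forall>n. f n \<in> V i n}" for i
    have "op_subgroup ?G (scalars \<union> shift ` {1..c}) (W i)" for i
    proof -
      have "additive_subgroup (W i) ?G"
      proof (rule G.additive_subgroupI)
        show "W i \<subseteq> carrier ?G" unfolding W_def using U.a_subset by blast
        show "\<zero>\<^bsub>?G\<^esub> \<in> W i" unfolding W_def using U.zero_closed submodule_zero[OF Vsub] by simp
        fix a assume a: "a \<in> W i"
        then have "a \<in> carrier ?G" unfolding W_def using U.a_subset by blast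
        then show "\<ominus>\<^bsub>?G\<^esub> a \<in> W i"
          using a U.a_inv_closed[of a] submoduleE(3)[OF Vsub] by (auto simp: W_def M.seq_group_minus)
        fix b assume b: "b \<in> W i"
        show "a \<oplus>\<^bsub>?G\<^esub> b \<in> W i"
          using a b U.a_closed[of a b] submoduleE(5)[OF Vsub] by (auto simp: W_def)
      qed
      moreover have "h f \<in> W i" if h: "h \<in> scalars \<union> shift ` {1..c}" and f: "f \<in> W i" for h f
      proof -
        have "h f \<in> U" using op_subgroupD[OF Uop h] f unfolding W_def by blast
        moreover have "h f n \<in> V i n" for n
          using h f submodule_zero[OF Vsub] submoduleE(4)[OF Vsub] stable_seqD(2)[OF V(1)]
          unfolding W_def by (auto split: nat.split)
        ultimately show ?thesis by (simp add: W_def)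
      qed
      ultimately show ?thesis by (simp add: op_subgroup_def)
    qed
    moreover have "W i \<subseteq> W (Suc i)" for i using V(2)[of i] unfolding W_def le_fun_def by blast
    moreover have "W i \<subseteq> U" for i unfolding W_def by blast
    ultimately obtain k where k: "\<And>i. i \<ge> k \<Longrightarrow> W i = W k"
      using op_noetherian_chain[OF U(1), of W] by blast
    have "V i = V k" if i: "i \<ge> k" for i
    proof
      fix n
      have sub: "V k n \<subseteq> V i n" using seq_mono[of V, OF V(2) i] by (simp add: le_fun_def)
      have "V i n \<subseteq> V k n"
      proof
        fix x assume x: "x \<in> V i n"
        then have "\<delta> n x \<in> U" using \<delta>U V(3) by blast
        moreover have "\<delta> n x m \<in> V i m" for m using x submodule_zero[OF Vsub] by (simp add: \<delta>_def)
        ultimately have "\<delta> n x \<in> W i" unfolding W_def by blast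
        then have "\<delta> n x \<in> W k" using k[OF i] by simp
        then have "\<delta> n x n \<in> V k n" unfolding W_def by blast
        then show "x \<in> V k n" by (simp add: \<delta>_def)
      qed
      then show "V i n = V k n" using sub by blast
    qed
    then show "\<exists>k. \<forall>i\<ge>k. V i = V k" by blast
  qed (rule E)
qed

end

section \<open>Associated primes of sequences of subquotients\<close>

context module
begin

text \<open>The associated primes of \<open>A/B\<close>, expressed through representatives so that
  cosets enter only in \<open>Ass_subquot\<close>.\<close>

definition ass :: "'c set \<Rightarrow> 'c set \<Rightarrow> 'a set set"
  where "ass A B = {p. primeideal p R \<and> (\<exists>x\<in>A. p = res B x)}"

lemma res_mem: "r \<in> res B x \<longleftrightarrow> r \<in> carrier R \<and> r \<odot>\<^bsub>M\<^esub> x \<in> B"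
  by (simp add: res_def)

lemma res_carrier: "res B x \<subseteq> carrier R"
  by (auto simp: res_def)

lemma primeD:
  assumes "primeideal p R"
  shows "\<one> \<notin> p" "\<And>a b. a \<in> carrier R \<Longrightarrow> b \<in> carrier R \<Longrightarrow> a \<otimes> b \<in> p \<Longrightarrow> a \<in> p \<or> b \<in> p"
    "p \<subseteq> carrier R" "\<And>a b. a \<in> carrier R \<Longrightarrow> b \<in> p \<Longrightarrow> a \<otimes> b \<in> p" "\<zero> \<in> p"
    "\<And>a b. a \<in> p \<Longrightarrow> b \<in> p \<Longrightarrow> a \<ominus> b \<in> p" "\<And>a b. a \<in> p \<Longrightarrow> b \<in> p \<Longrightarrow> a \<oplus> b \<in> p"
proof -
  interpret p: primeideal p R by fact
  show "\<one> \<notin> p" using p.I_notcarr p.one_imp_carrier by blast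
  show "\<And>a b. a \<in> carrier R \<Longrightarrow> b \<in> carrier R \<Longrightarrow> a \<otimes> b \<in> p \<Longrightarrow> a \<in> p \<or> b \<in> p" by (rule p.I_prime)
  show "p \<subseteq> carrier R" by (rule p.a_subset)
  show "\<And>a b. a \<in> carrier R \<Longrightarrow> b \<in> p \<Longrightarrow> a \<otimes> b \<in> p" by (rule p.I_l_closed)
  show "\<zero> \<in> p" by (rule p.zero_closed)
  show "\<And>a b. a \<in> p \<Longrightarrow> b \<in> p \<Longrightarrow> a \<ominus> b \<in> p" by (simp add: R.minus_eq p.a_closed p.a_inv_closed)
  show "\<And>a b. a \<in> p \<Longrightarrow> b \<in> p \<Longrightarrow> a \<oplus> b \<in> p" by (rule p.a_closed)
qed

lemma ideal_set_maximal:
  assumes "noetherian_ring R" and S: "S \<noteq> {}" "\<And>I. I \<in> S \<Longrightarrow> ideal I R"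
  shows "\<exists>I\<in>S. \<forall>I'\<in>S. I \<subseteq> I' \<longrightarrow> I' = I"
proof (rule ccontr)
  assume "\<not> ?thesis"
  then have *: "\<And>I. I \<in> S \<Longrightarrow> \<exists>I'\<in>S. I \<subset> I'" by blast
  have "\<exists>f. \<forall>n::nat. f n \<in> S \<and> f n \<subset> f (Suc n)"
    using dependent_nat_choice[of "\<lambda>_ I. I \<in> S" "\<lambda>_ I I'. I \<subset> I'"] S(1) * by blast
  then obtain f where f: "\<And>n::nat. f n \<in> S" "\<And>n. f n \<subset> f (Suc n)" by blast
  have "\<exists>k. \<forall>i\<ge>k. f i = f k"
    by (rule ideal_chain_stable[OF assms(1)]) (use f S(2) in auto)
  then show False using f(2) by (metis le_SucI le_refl psubset_eq)
qed

lemma ass_self: "submodule B R M \<Longrightarrow> ass B B = {}"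
  using submoduleE(4)[of B] primeD(1) by (auto simp: ass_def res_def)

text \<open>Modulo \<open>B\<close> the element \<open>x\<close> generates a copy of the domain
  \<open>R/p\<close>, in which every nonzero element has annihilator \<open>p\<close>.\<close>

lemma res_mult_prime:
  assumes p: "primeideal p R" "p = res B x" and x: "x \<in> carrier M" and r: "r \<in> carrier R" "r \<notin> p"
  shows "res B (r \<odot>\<^bsub>M\<^esub> x) = p"
proof (intro equalityI subsetI)
  fix s assume s: "s \<in> res B (r \<odot>\<^bsub>M\<^esub> x)"
  then have "s \<otimes> r \<in> p" using p(2) r x by (simp add: res_mem smult_assoc1)
  then show "s \<in> p" using primeD(2)[OF p(1)] s r by (auto simp: res_mem)
next
  fix s assume s: "s \<in> p"
  then have sc: "s \<in> carrier R" using primeD(3)[OF p(1)] by blast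
  then have "r \<otimes> s \<in> res B x" using primeD(4)[OF p(1) r(1) s] p(2) by simp
  then have "s \<otimes> r \<in> res B x" using sc r by (simp add: R.m_comm)
  then show "s \<in> res B (r \<odot>\<^bsub>M\<^esub> x)" using sc r x by (simp add: res_mem smult_assoc1)
qed

text \<open>Let \<open>p\<close> be the annihilator of \<open>x\<close> modulo \<open>B\<close>.
  Either some multiple of \<open>x\<close> by an element outside \<open>p\<close> lies in
  \<open>V\<close>, and it still has annihilator \<open>p\<close> modulo \<open>B\<close>, or
  passing from \<open>B\<close> to \<open>V\<close> does not enlarge the annihilator of
  \<open>x\<close>.\<close>

lemma ass_filtration:
  assumes "submodule B R M" "submodule V R M" "submodule A R M" "B \<subseteq> V" "V \<subseteq> A"
  shows "ass A B \<subseteq> ass V B \<union> ass A V"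
proof
  fix p assume "p \<in> ass A B"
  then obtain x where p: "primeideal p R" "x \<in> A" "p = res B x" by (auto simp: ass_def)
  have x: "x \<in> carrier M" using submodule_carrier[OF assms(3) p(2)] .
  show "p \<in> ass V B \<union> ass A V"
  proof (cases "res V x \<subseteq> p")
    case True
    then have "p = res V x" using p(3) assms(4) by (auto simp: res_def)
    then show ?thesis using p by (auto simp: ass_def)
  next
    case False
    then obtain r where r: "r \<in> carrier R" "r \<odot>\<^bsub>M\<^esub> x \<in> V" "r \<notin> p" by (auto simp: res_def)
    then have "res B (r \<odot>\<^bsub>M\<^esub> x) = p" using res_mult_prime[OF p(1,3) x] by simp
    then show ?thesis using p(1) r(2) by (auto simp: ass_def)
  qed
qed

end

lemma increasing_in_finite_stable:
  fixes f :: "nat \<Rightarrow> 'b set"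
  assumes mono: "\<And>n. n \<ge> n0 \<Longrightarrow> f n \<subseteq> f (Suc n)" and fin: "finite (\<Union>n. f n)"
  shows "\<exists>k S. \<forall>n\<ge>k. f n = S"
proof -
  let ?S = "\<Union>n\<in>{n0..}. f n"
  have m: "f i \<subseteq> f j" if "i \<ge> n0" "i \<le> j" for i j
    using that(2)
  proof (induct j rule: dec_induct)
    case (step j)
    then show ?case using mono[of j] that(1) by auto
  qed simp
  have "finite ?S" using fin by (rule finite_subset[rotated]) blast
  moreover have "\<forall>p\<in>?S. \<exists>n\<ge>n0. p \<in> f n" by blast
  ultimately obtain N where N: "\<And>p. p \<in> ?S \<Longrightarrow> N p \<ge> n0 \<and> p \<in> f (N p)" by metis
  define k where "k = Max (insert n0 (N ` ?S))"
  have k: "k \<ge> n0" "\<And>p. p \<in> ?S \<Longrightarrow> N p \<le> k"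
    unfolding k_def using \<open>finite ?S\<close> by (auto intro: Max_ge)
  have "f n = ?S" if n: "n \<ge> k" for n
  proof
    show "f n \<subseteq> ?S" using n k(1) by fastforce
    show "?S \<subseteq> f n"
    proof
      fix p assume p: "p \<in> ?S"
      then show "p \<in> f n" using N[OF p] m[of "N p" n] k(2)[OF p] n by (meson le_trans subsetD)
    qed
  qed
  then show ?thesis by blast
qed

context noeth_module_seq
begin

lemma stable_colon:
  assumes A: "stable_seq A" and V: "stable_seq V" and p: "p \<subseteq> carrier R"
  shows "stable_seq (\<lambda>n. {w \<in> A n. \<forall>r\<in>p. r \<odot>\<^bsub>M\<^esub> w \<in> V n})" (is "stable_seq ?W")
  unfolding stable_seq_def
proof (intro conjI allI ballI)
  note As = stable_seqD(1)[OF A] and Vs = stable_seqD(1)[OF V]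
  note Ac = submodule_carrier[OF As]
  fix n
  show "submodule (?W n) R M"
  proof (rule submoduleI')
    show "?W n \<subseteq> carrier M" using Ac by blast
    show "\<zero>\<^bsub>M\<^esub> \<in> ?W n" using submodule_zero[OF As] submodule_zero[OF Vs] p by (auto simp: subset_iff)
    show "a \<oplus>\<^bsub>M\<^esub> b \<in> ?W n" if "a \<in> ?W n" "b \<in> ?W n" for a b
      using that submoduleE(5)[OF As] submoduleE(5)[OF Vs] Ac p by (auto simp: smult_r_distr subset_iff)
    show "a \<odot>\<^bsub>M\<^esub> x \<in> ?W n" if a: "a \<in> carrier R" and x: "x \<in> ?W n" for a x
    proof -
      have "r \<odot>\<^bsub>M\<^esub> (a \<odot>\<^bsub>M\<^esub> x) = a \<odot>\<^bsub>M\<^esub> (r \<odot>\<^bsub>M\<^esub> x)" if "r \<in> p" for r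
        using that a x p Ac[of x n] by (auto simp: smult_assoc1[symmetric] R.m_comm subset_iff)
      then show ?thesis using a x submoduleE(4)[OF As a] submoduleE(4)[OF Vs a] by auto
    qed
  qed
  fix j x assume j: "j \<in> {1..c}" and x: "x \<in> ?W n"
  have "r \<odot>\<^bsub>M\<^esub> (y j \<odot>\<^bsub>M\<^esub> x) = y j \<odot>\<^bsub>M\<^esub> (r \<odot>\<^bsub>M\<^esub> x)" if "r \<in> p" for r
    using that y_closed[OF j] x p Ac[of x n] by (auto simp: smult_assoc1[symmetric] R.m_comm subset_iff)
  then show "y j \<odot>\<^bsub>M\<^esub> x \<in> ?W (Suc n)" using x stable_seqD(2)[OF A j] stable_seqD(2)[OF V j] by auto
qed

text \<open>Choose \<open>p\<close> maximal among the annihilators of elements outside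
  \<open>V\<close>, over all indices together, and let \<open>V' = (V : p)\<close> inside
  \<open>A\<close>. An element of \<open>V'\<close> outside \<open>V\<close> is killed by
  \<open>p\<close>, so its annihilator is \<open>p\<close> by maximality. Thus a single prime
  suffices for every \<open>n\<close>.\<close>

lemma ass_step:
  assumes A: "stable_seq A" and V: "stable_seq V" and VA: "V \<le> A" "V \<noteq> A"
  shows "\<exists>V' p. stable_seq V' \<and> V \<le> V' \<and> V' \<le> A \<and> V' \<noteq> V \<and> (\<forall>n. ass (V' n) (V n) \<subseteq> {p})"
proof -
  note As = stable_seqD(1)[OF A] and Vs = stable_seqD(1)[OF V]
  note Ac = submodule_carrier[OF As]
  let ?S = "{res (V n) x | n x. x \<in> A n \<and> x \<notin> V n}"
  have "\<exists>n x. x \<in> A n \<and> x \<notin> V n" using VA by (auto simp: le_fun_def fun_eq_iff)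
  then have "?S \<noteq> {}" by blast
  moreover have "ideal I R" if I: "I \<in> ?S" for I
  proof -
    obtain n x where "x \<in> A n" "I = res (V n) x" using I by blast
    then show ?thesis using res_ideal[OF Vs Ac] by simp
  qed
  ultimately have "\<exists>I\<in>?S. \<forall>I'\<in>?S. I \<subseteq> I' \<longrightarrow> I' = I" by (rule ideal_set_maximal[OF noetherian])
  then obtain p where p: "p \<in> ?S" and pm: "\<forall>I'\<in>?S. p \<subseteq> I' \<longrightarrow> I' = p" by (rule bexE)
  obtain n x where x: "x \<in> A n" "x \<notin> V n" "p = res (V n) x" using p by blast
  have pc: "p \<subseteq> carrier R" unfolding x(3) by (rule res_carrier)
  define V' where "V' = (\<lambda>n. {w \<in> A n. \<forall>r\<in>p. r \<odot>\<^bsub>M\<^esub> w \<in> V n})"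
  have "V n \<subseteq> V' n" for n
    unfolding V'_def using VA(1) submoduleE(4)[OF Vs] pc by (auto simp: le_fun_def)
  moreover have "V' n \<subseteq> A n" for n unfolding V'_def by blast
  moreover have "x \<in> V' n" unfolding V'_def using x by (simp add: res_def)
  then have "V' \<noteq> V" using x(2) by blast
  moreover have "ass (V' n) (V n) \<subseteq> {p}" for n
  proof
    fix q assume "q \<in> ass (V' n) (V n)"
    then obtain w where w: "primeideal q R" "w \<in> V' n" "q = res (V n) w" by (auto simp: ass_def)
    have wA: "w \<in> A n" "\<And>r. r \<in> p \<Longrightarrow> r \<odot>\<^bsub>M\<^esub> w \<in> V n" using w(2) by (simp_all add: V'_def)
    have "\<one> \<notin> res (V n) w" using w(1,3) primeD(1) by simp
    then have "w \<notin> V n" using Ac[OF wA(1)] by (simp add: res_mem)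
    then have "res (V n) w \<in> ?S" using wA(1) by blast
    moreover have "p \<subseteq> res (V n) w" using wA(2) pc by (auto simp: res_def)
    ultimately have "res (V n) w = p" using pm by blast
    then show "q \<in> {p}" using w(3) by simp
  qed
  moreover have "stable_seq V'" unfolding V'_def by (rule stable_colon[OF A V pc])
  ultimately show ?thesis by (intro exI[of _ V'] exI[of _ p]) (simp add: le_fun_def)
qed

text \<open>Each use of \<open>ass_step\<close> adds at most one prime. If the union were infinite,
  no stage could reach \<open>A\<close>, and the steps would form an infinite strict chain.\<close>

lemma finite_ass_seq:
  assumes A: "noeth_seq A" and B: "stable_seq B" "B \<le> A"
  shows "finite (\<Union>n. ass (A n) (B n))"
proof (rule ccontr)
  assume inf: "infinite (\<Union>n. ass (A n) (B n))"
  have As: "stable_seq A" by (rule noeth_seq_stable[OF A])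
  define Q where "Q V \<longleftrightarrow> stable_seq V \<and> B \<le> V \<and> V \<le> A \<and> finite (\<Union>n. ass (V n) (B n))" for V
  have QB: "Q B" unfolding Q_def using B ass_self[OF stable_seqD(1)[OF B(1)]] by simp
  have step: "\<exists>V'. Q V' \<and> V \<le> V' \<and> V' \<noteq> V" if Q: "Q V" for V
  proof -
    have V: "stable_seq V" "B \<le> V" "V \<le> A" "finite (\<Union>n. ass (V n) (B n))" using Q by (auto simp: Q_def)
    then have "V \<noteq> A" using inf by blast
    then obtain V' p where V': "stable_seq V'" "V \<le> V'" "V' \<le> A" "V' \<noteq> V" "\<And>n. ass (V' n) (V n) \<subseteq> {p}"
      using ass_step[OF As V(1,3)] by blast
    have "ass (V' n) (B n) \<subseteq> (\<Union>n. ass (V n) (B n)) \<union> {p}" for n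
      using ass_filtration[OF stable_seqD(1)[OF B(1)] stable_seqD(1)[OF V(1)] stable_seqD(1)[OF V'(1)], of n n n]
        V(2) V'(2,5) by (fastforce simp: le_fun_def)
    then have "(\<Union>n. ass (V' n) (B n)) \<subseteq> (\<Union>n. ass (V n) (B n)) \<union> {p}" by blast
    then have "finite (\<Union>n. ass (V' n) (B n))" by (rule finite_subset) (use V(4) in simp)
    moreover have "B \<le> V'" using V(2) V'(2) by (rule order_trans)
    ultimately show ?thesis using V' unfolding Q_def by blast
  qed
  have "\<exists>f. \<forall>n::nat. Q (f n) \<and> (f n \<le> f (Suc n) \<and> f (Suc n) \<noteq> f n)"
    by (rule dependent_nat_choice) (use QB step in blast)+
  then obtain f where f: "\<And>n::nat. Q (f n)" "\<And>n. f n \<le> f (Suc n)" "\<And>n. f (Suc n) \<noteq> f n" by blast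
  have "\<exists>k. \<forall>i\<ge>k. f i = f k"
    by (rule noeth_seq_chain[OF A, of f]) (use f in \<open>auto simp: Q_def\<close>)
  then obtain k where "\<And>i. i \<ge> k \<Longrightarrow> f i = f k" by blast
  from this[of "Suc k"] show False using f(3)[of k] by simp
qed

text \<open>The elements that every \<open>y j\<close> sends into \<open>B\<close> form a stable
  sequence \<open>X\<close> below \<open>A\<close>. Eventually \<open>X (Suc n)\<close> is generated
  by the products \<open>y j x\<close> with \<open>x\<close> in \<open>X n\<close>, and these lie in
  \<open>B (Suc n)\<close> by the choice of \<open>X\<close>.\<close>

lemma colon_eventually:
  assumes A: "noeth_seq A" and B: "stable_seq B" "B \<le> A"
  shows "\<exists>n0. \<forall>n\<ge>n0. \<forall>x\<in>A n. (\<forall>j\<in>{1..c}. y j \<odot>\<^bsub>M\<^esub> x \<in> B (Suc n)) \<longrightarrow> x \<in> B n"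
proof -
  have As: "stable_seq A" by (rule noeth_seq_stable[OF A])
  note Asub = stable_seqD(1)[OF As] and Bsub = stable_seqD(1)[OF B(1)]
  note Ac = submodule_carrier[OF Asub]
  define X where "X = (\<lambda>n. {x \<in> A n. \<forall>j\<in>{1..c}. y j \<odot>\<^bsub>M\<^esub> x \<in> B (Suc n)})"
  have "stable_seq X"
    unfolding stable_seq_def
  proof (intro conjI allI ballI)
    fix n
    show "submodule (X n) R M"
    proof (rule submoduleI')
      show "X n \<subseteq> carrier M" using Ac by (auto simp: X_def)
      show "\<zero>\<^bsub>M\<^esub> \<in> X n" using submodule_zero[OF Asub] submodule_zero[OF Bsub] y_closed by (auto simp: X_def)
      show "a \<oplus>\<^bsub>M\<^esub> b \<in> X n" if "a \<in> X n" "b \<in> X n" for a b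
        using that submoduleE(5)[OF Asub] submoduleE(5)[OF Bsub] Ac y_closed by (auto simp: X_def smult_r_distr)
      show "a \<odot>\<^bsub>M\<^esub> x \<in> X n" if a: "a \<in> carrier R" and x: "x \<in> X n" for a x
      proof -
        have "y j \<odot>\<^bsub>M\<^esub> (a \<odot>\<^bsub>M\<^esub> x) = a \<odot>\<^bsub>M\<^esub> (y j \<odot>\<^bsub>M\<^esub> x)" if "j \<in> {1..c}" for j
          using y_closed[OF that] a x Ac[of x n] by (auto simp: X_def smult_assoc1[symmetric] R.m_comm)
        then show ?thesis using a x submoduleE(4)[OF Asub a] submoduleE(4)[OF Bsub a] by (auto simp: X_def)
      qed
    qed
    fix j x assume j: "j \<in> {1..c}" and x: "x \<in> X n"
    then have "y j \<odot>\<^bsub>M\<^esub> x \<in> B (Suc n)" by (simp add: X_def)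
    then show "y j \<odot>\<^bsub>M\<^esub> x \<in> X (Suc n)"
      using B(2) stable_seqD(2)[OF B(1)] unfolding X_def by (auto simp: le_fun_def)
  qed
  then have "noeth_seq X" by (rule noeth_seq_subset[OF A]) (auto simp: X_def le_fun_def)
  then obtain n0 where n0: "\<And>n. n \<ge> n0 \<Longrightarrow> X (Suc n) = lin_comb M y (X n) c"
    using noeth_seq_generated by blast
  have "X n \<subseteq> B n" if "n \<ge> Suc n0" for n
  proof -
    obtain m where m: "n = Suc m" "m \<ge> n0" using \<open>n \<ge> Suc n0\<close> by (cases n) auto
    have "lin_comb M y (X m) c \<subseteq> B (Suc m)" by (rule lin_comb_least[OF Bsub]) (auto simp: X_def)
    then show ?thesis using n0[OF m(2)] m(1) by simp
  qed
  then show ?thesis unfolding X_def by (intro exI[of _ "Suc n0"]) blast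
qed

text \<open>If each \<open>y j x\<close> were killed modulo \<open>B\<close> by some element outside
  \<open>p\<close>, the product \<open>s\<close> of these elements would kill all of them. Then
  \<open>s x\<close> would lie in \<open>B n\<close> by \<open>inj\<close>, although
  \<open>s\<close> lies outside the prime \<open>p\<close>. So some \<open>y j x\<close> has
  annihilator \<open>p\<close> again.\<close>

lemma ass_increasing:
  assumes A: "stable_seq A" and B: "stable_seq B"
    and inj: "\<And>x. x \<in> A n \<Longrightarrow> (\<And>j. j \<in> {1..c} \<Longrightarrow> y j \<odot>\<^bsub>M\<^esub> x \<in> B (Suc n)) \<Longrightarrow> x \<in> B n"
  shows "ass (A n) (B n) \<subseteq> ass (A (Suc n)) (B (Suc n))"
proof
  note Asub = stable_seqD(1)[OF A] and Bsub = stable_seqD(1)[OF B]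
  fix p assume "p \<in> ass (A n) (B n)"
  then obtain x where p: "primeideal p R" "x \<in> A n" "p = res (B n) x" by (auto simp: ass_def)
  have x: "x \<in> carrier M" using submodule_carrier[OF Asub p(2)] .
  have comm: "s \<odot>\<^bsub>M\<^esub> (y j \<odot>\<^bsub>M\<^esub> x) = y j \<odot>\<^bsub>M\<^esub> (s \<odot>\<^bsub>M\<^esub> x)" if "j \<in> {1..c}" "s \<in> carrier R" for s j
    using y_closed[OF that(1)] x that(2) by (simp add: smult_assoc1[symmetric] R.m_comm)
  have sub: "p \<subseteq> res (B (Suc n)) (y j \<odot>\<^bsub>M\<^esub> x)" if j: "j \<in> {1..c}" for j
    using p(3) comm[OF j] stable_seqD(2)[OF B j] by (auto simp: res_def)
  have "\<exists>j\<in>{1..c}. res (B (Suc n)) (y j \<odot>\<^bsub>M\<^esub> x) \<subseteq> p"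
  proof (rule ccontr)
    assume "\<not> ?thesis"
    then have nex: "\<exists>s\<in>res (B (Suc n)) (y j \<odot>\<^bsub>M\<^esub> x). s \<notin> p" if "j \<in> {1..c}" for j using that by blast
    have "k \<le> c \<Longrightarrow> \<exists>s\<in>carrier R. s \<notin> p \<and> (\<forall>j\<in>{1..k}. s \<odot>\<^bsub>M\<^esub> (y j \<odot>\<^bsub>M\<^esub> x) \<in> B (Suc n))" for k
    proof (induct k)
      case 0 then show ?case using primeD(1)[OF p(1)] by auto
    next
      case (Suc k)
      then obtain s where s: "s \<in> carrier R" "s \<notin> p" "\<And>j. j \<in> {1..k} \<Longrightarrow> s \<odot>\<^bsub>M\<^esub> (y j \<odot>\<^bsub>M\<^esub> x) \<in> B (Suc n)" by auto
      obtain t where t: "t \<in> carrier R" "t \<notin> p" "t \<odot>\<^bsub>M\<^esub> (y (Suc k) \<odot>\<^bsub>M\<^esub> x) \<in> B (Suc n)"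
        using nex[of "Suc k"] Suc(2) by (auto simp: res_def)
      have "s \<otimes> t \<notin> p" using primeD(2)[OF p(1)] s t by blast
      moreover have "(s \<otimes> t) \<odot>\<^bsub>M\<^esub> (y j \<odot>\<^bsub>M\<^esub> x) \<in> B (Suc n)" if j: "j \<in> {1..Suc k}" for j
      proof (cases "j = Suc k")
        case True
        then show ?thesis using s t x y_closed[of j] Suc(2) submoduleE(4)[OF Bsub s(1) t(3)] by (simp add: smult_assoc1)
      next
        case False
        then have "s \<odot>\<^bsub>M\<^esub> (y j \<odot>\<^bsub>M\<^esub> x) \<in> B (Suc n)" using s(3) j by simp
        from submoduleE(4)[OF Bsub t(1) this] have "(t \<otimes> s) \<odot>\<^bsub>M\<^esub> (y j \<odot>\<^bsub>M\<^esub> x) \<in> B (Suc n)"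
          using s t x y_closed[of j] Suc(2) j by (simp add: smult_assoc1)
        then show ?thesis using s t by (simp add: R.m_comm)
      qed
      ultimately show ?case using s t by (intro bexI[of _ "s \<otimes> t"]) auto
    qed
    from this[of c] obtain s where s: "s \<in> carrier R" "s \<notin> p" "\<And>j. j \<in> {1..c} \<Longrightarrow> s \<odot>\<^bsub>M\<^esub> (y j \<odot>\<^bsub>M\<^esub> x) \<in> B (Suc n)"
      by auto
    have "s \<odot>\<^bsub>M\<^esub> x \<in> B n"
      by (rule inj) (use s comm submoduleE(4)[OF Asub s(1) p(2)] in auto)
    then show False using s p(3) by (simp add: res_mem)
  qed
  then obtain j where j: "j \<in> {1..c}" "res (B (Suc n)) (y j \<odot>\<^bsub>M\<^esub> x) \<subseteq> p" by blast
  then have "p = res (B (Suc n)) (y j \<odot>\<^bsub>M\<^esub> x)" using sub by blast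
  then show "p \<in> ass (A (Suc n)) (B (Suc n))" using p(1) stable_seqD(2)[OF A j(1) p(2)] by (auto simp: ass_def)
qed

lemma ass_seq_stable:
  assumes A: "noeth_seq A" and B: "stable_seq B" "B \<le> A"
  shows "\<exists>k S. \<forall>n\<ge>k. ass (A n) (B n) = S"
proof -
  obtain n0 where n0: "\<And>n x. n \<ge> n0 \<Longrightarrow> x \<in> A n \<Longrightarrow> (\<And>j. j \<in> {1..c} \<Longrightarrow> y j \<odot>\<^bsub>M\<^esub> x \<in> B (Suc n)) \<Longrightarrow> x \<in> B n"
    using colon_eventually[OF assms] by metis
  show ?thesis
    by (rule increasing_in_finite_stable[of n0])
      (use ass_increasing[OF noeth_seq_stable[OF A] B(1)] n0 finite_ass_seq[OF assms] in blast)+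
qed

section \<open>Colons taken in the whole module\<close>

lemma noeth_zero:
  assumes "noeth_seq E"
  shows "noeth_seq (\<lambda>n. {\<zero>\<^bsub>M\<^esub>})"
proof (rule noeth_seq_subset[OF assms])
  show "stable_seq (\<lambda>n. {\<zero>\<^bsub>M\<^esub>})" by (simp add: stable_seq_def submodule_zero_set y_closed)
  show "(\<lambda>n. {\<zero>\<^bsub>M\<^esub>}) \<le> E"
    using submodule_zero[OF stable_seqD(1)[OF noeth_seq_stable[OF assms]]] by (simp add: le_fun_def)
qed

text \<open>The embedding into a power of \<open>F\<close> is carried out one coordinate at a time.
  In \<open>D k\<close> the first \<open>k\<close> products vanish, so \<open>D c\<close> is zero by
  \<open>inj\<close>, and \<open>D k\<close> is the kernel of \<open>y k\<close> on
  \<open>D (k - 1)\<close>. Thus \<open>noeth_seq_extension\<close> leads from \<open>D c\<close>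
  down to \<open>D 0\<close>.\<close>

lemma noeth_colon:
  assumes F: "noeth_seq F"
    and inj: "\<And>x. x \<in> carrier M \<Longrightarrow> (\<And>j. j \<in> {1..c} \<Longrightarrow> y j \<odot>\<^bsub>M\<^esub> x = \<zero>\<^bsub>M\<^esub>) \<Longrightarrow> x = \<zero>\<^bsub>M\<^esub>"
  shows "noeth_seq (\<lambda>n. {x \<in> carrier M. \<forall>j\<in>{1..c}. y j \<odot>\<^bsub>M\<^esub> x \<in> F n})"
proof -
  have Fs: "stable_seq F" by (rule noeth_seq_stable[OF F])
  note Fsub = stable_seqD(1)[OF Fs]
  define D where "D k n = {x \<in> carrier M. (\<forall>j\<in>{1..c}. y j \<odot>\<^bsub>M\<^esub> x \<in> F n) \<and> (\<forall>j\<in>{1..k}. y j \<odot>\<^bsub>M\<^esub> x = \<zero>\<^bsub>M\<^esub>)}" for k n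
  have st: "stable_seq (D k)" if k: "k \<le> c" for k
    unfolding stable_seq_def
  proof (intro conjI allI ballI)
    fix n
    have yc: "y j \<odot>\<^bsub>M\<^esub> (a \<odot>\<^bsub>M\<^esub> x) = a \<odot>\<^bsub>M\<^esub> (y j \<odot>\<^bsub>M\<^esub> x)" if "j \<in> {1..c}" "a \<in> carrier R" "x \<in> carrier M" for a j x
      using y_closed[OF that(1)] that by (simp add: smult_assoc1[symmetric] R.m_comm)
    have kc: "j \<in> {1..k} \<Longrightarrow> j \<in> {1..c}" for j using k by auto
    show "submodule (D k n) R M"
    proof (rule submoduleI')
      show "D k n \<subseteq> carrier M" by (auto simp: D_def)
      show "\<zero>\<^bsub>M\<^esub> \<in> D k n" using submodule_zero[OF Fsub] y_closed kc by (auto simp: D_def)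
      show "a \<oplus>\<^bsub>M\<^esub> b \<in> D k n" if "a \<in> D k n" "b \<in> D k n" for a b
        using that submoduleE(5)[OF Fsub] y_closed kc by (auto simp: D_def smult_r_distr)
      show "a \<odot>\<^bsub>M\<^esub> x \<in> D k n" if a: "a \<in> carrier R" and x: "x \<in> D k n" for a x
        using a x yc kc submoduleE(4)[OF Fsub] by (auto simp: D_def)
    qed
    fix i x assume i: "i \<in> {1..c}" and x: "x \<in> D k n"
    then show "y i \<odot>\<^bsub>M\<^esub> x \<in> D k (Suc n)"
      using yc[OF _ y_closed[OF i]] kc y_closed stable_seqD(2)[OF Fs i] by (auto simp: D_def)
  qed
  have "noeth_seq (D (c - k))" if "k \<le> c" for k
    using that
  proof (induct k)
    case 0
    have "D c n = {\<zero>\<^bsub>M\<^esub>}" for n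
    proof
      show "D c n \<subseteq> {\<zero>\<^bsub>M\<^esub>}"
      proof
        fix x assume x: "x \<in> D c n"
        have "x = \<zero>\<^bsub>M\<^esub>" by (rule inj) (use x in \<open>simp_all add: D_def\<close>)
        then show "x \<in> {\<zero>\<^bsub>M\<^esub>}" by simp
      qed
      show "{\<zero>\<^bsub>M\<^esub>} \<subseteq> D c n" using submodule_zero[OF stable_seqD(1)[OF st[OF le_refl]]] by simp
    qed
    then have "D c = (\<lambda>n. {\<zero>\<^bsub>M\<^esub>})" by blast
    then show ?case using noeth_zero[OF F] by simp
  next
    case (Suc k)
    let ?i = "c - k"
    have i: "?i \<in> {1..c}" "?i = Suc (c - Suc k)" using Suc by auto
    show ?case
    proof (rule noeth_seq_extension[OF st y_closed[OF i(1)] F])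
      show "c - Suc k \<le> c" by simp
      show "y ?i \<odot>\<^bsub>M\<^esub> x \<in> F n" if "x \<in> D (c - Suc k) n" for n x using that i(1) by (auto simp: D_def)
      have "{1..?i} = insert ?i {1..c - Suc k}" using i by auto
      then have "(\<lambda>n. {x \<in> D (c - Suc k) n. y ?i \<odot>\<^bsub>M\<^esub> x = \<zero>\<^bsub>M\<^esub>}) = D ?i"
        by (auto simp: D_def fun_eq_iff)
      then show "noeth_seq (\<lambda>n. {x \<in> D (c - Suc k) n. y ?i \<odot>\<^bsub>M\<^esub> x = \<zero>\<^bsub>M\<^esub>})" using Suc by simp
    qed
  qed
  from this[of c] have "noeth_seq (D 0)" by simp
  moreover have "D 0 = (\<lambda>n. {x \<in> carrier M. \<forall>j\<in>{1..c}. y j \<odot>\<^bsub>M\<^esub> x \<in> F n})" by (auto simp: D_def fun_eq_iff)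
  ultimately show ?thesis by simp
qed

text \<open>The \<open>y j\<close> send \<open>D n\<close> into \<open>F n\<close>, without a shift
  of the index. Generation of \<open>D (Suc n)\<close> from \<open>D n\<close> therefore places it
  already in \<open>F n\<close>, one index lower than its definition suggests.\<close>

lemma colon_carrier_eventually:
  assumes F: "noeth_seq F"
    and inj: "\<And>x. x \<in> carrier M \<Longrightarrow> (\<And>j. j \<in> {1..c} \<Longrightarrow> y j \<odot>\<^bsub>M\<^esub> x = \<zero>\<^bsub>M\<^esub>) \<Longrightarrow> x = \<zero>\<^bsub>M\<^esub>"
  shows "\<exists>n0. \<forall>n\<ge>n0. \<forall>x\<in>carrier M. (\<forall>j\<in>{1..c}. y j \<odot>\<^bsub>M\<^esub> x \<in> F (Suc n)) \<longrightarrow> x \<in> F n"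
proof -
  define D where "D = (\<lambda>n. {x \<in> carrier M. \<forall>j\<in>{1..c}. y j \<odot>\<^bsub>M\<^esub> x \<in> F n})"
  have "noeth_seq D" unfolding D_def by (rule noeth_colon[OF assms])
  then obtain n0 where n0: "\<And>n. n \<ge> n0 \<Longrightarrow> D (Suc n) = lin_comb M y (D n) c"
    using noeth_seq_generated by blast
  have "lin_comb M y (D n) c \<subseteq> F n" for n
    by (rule lin_comb_least[OF stable_seqD(1)[OF noeth_seq_stable[OF F]]]) (auto simp: D_def)
  then have "D (Suc n) \<subseteq> F n" if "n \<ge> n0" for n using n0[OF that] by simp
  then show ?thesis unfolding D_def by (intro exI[of _ n0]) blast
qed

end

section \<open>Powers of an ideal times a submodule\<close>

context module
begin

lemma ideal_smult_set: "A \<subseteq> carrier R \<Longrightarrow> L \<subseteq> carrier M \<Longrightarrow> {a \<odot>\<^bsub>M\<^esub> x | a x. a \<in> A \<and> x \<in> L} \<subseteq> carrier M"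
  by auto

lemma ideal_smult_submodule:
  assumes "ideal A R" "submodule L R M"
  shows "submodule (ideal_smult R M A L) R M"
  unfolding ideal_smult_def
  by (rule gen_submodule_submodule, rule ideal_smult_set)
    (use ideal.Icarr[OF assms(1)] submoduleE(1)[OF assms(2)] in auto)

lemma ideal_smult_gen: "a \<in> A \<Longrightarrow> x \<in> L \<Longrightarrow> a \<odot>\<^bsub>M\<^esub> x \<in> ideal_smult R M A L"
  unfolding ideal_smult_def
  by (rule subsetD[OF gen_submodule_incl]) blast

lemma ideal_smult_least:
  "submodule H R M \<Longrightarrow> (\<And>a x. a \<in> A \<Longrightarrow> x \<in> L \<Longrightarrow> a \<odot>\<^bsub>M\<^esub> x \<in> H) \<Longrightarrow> ideal_smult R M A L \<subseteq> H"
  unfolding ideal_smult_def by (rule gen_submodule_least) auto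

lemma ideal_smult_mono:
  "ideal A R \<Longrightarrow> submodule L R M \<Longrightarrow> K \<subseteq> L \<Longrightarrow> ideal_smult R M A K \<subseteq> ideal_smult R M A L"
  by (rule ideal_smult_least) (auto intro: ideal_smult_submodule ideal_smult_gen)

lemma ideal_smult_subset:
  "ideal A R \<Longrightarrow> submodule L R M \<Longrightarrow> ideal_smult R M A L \<subseteq> L"
  by (rule ideal_smult_least) (auto intro: submoduleE(4) ideal.Icarr)

lemma ideal_smult_carrier:
  assumes L: "submodule L R M"
  shows "ideal_smult R M (carrier R) L = L"
proof
  show "ideal_smult R M (carrier R) L \<subseteq> L"
    by (rule ideal_smult_least[OF L]) (rule submoduleE(4)[OF L])
  show "L \<subseteq> ideal_smult R M (carrier R) L"
  proof
    fix x assume x: "x \<in> L"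
    have "\<one> \<odot>\<^bsub>M\<^esub> x \<in> ideal_smult R M (carrier R) L" by (rule ideal_smult_gen) (use x in auto)
    then show "x \<in> ideal_smult R M (carrier R) L" using submodule_carrier[OF L x] by simp
  qed
qed

text \<open>It reduces claims about all elements of a generated ideal to claims about its
  generators.\<close>

lemma transporter_ideal:
  assumes L: "L \<subseteq> carrier M" and H: "submodule H R M"
  shows "ideal {a \<in> carrier R. \<forall>x\<in>L. a \<odot>\<^bsub>M\<^esub> x \<in> H} R"
proof (rule ideal_by_closure)
  note Hc = submodule_zero[OF H] submoduleE(4,5)[OF H]
  have Lc: "x \<in> L \<Longrightarrow> x \<in> carrier M" for x using L by blast
  show "\<zero> \<in> {a \<in> carrier R. \<forall>x\<in>L. a \<odot>\<^bsub>M\<^esub> x \<in> H}" using Lc Hc by simp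
  show "a \<oplus> b \<in> {a \<in> carrier R. \<forall>x\<in>L. a \<odot>\<^bsub>M\<^esub> x \<in> H}"
    if "a \<in> {a \<in> carrier R. \<forall>x\<in>L. a \<odot>\<^bsub>M\<^esub> x \<in> H}" "b \<in> {a \<in> carrier R. \<forall>x\<in>L. a \<odot>\<^bsub>M\<^esub> x \<in> H}" for a b
    using that Lc Hc by (simp add: smult_l_distr)
  show "a \<otimes> b \<in> {a \<in> carrier R. \<forall>x\<in>L. a \<odot>\<^bsub>M\<^esub> x \<in> H}"
    if "a \<in> carrier R" "b \<in> {a \<in> carrier R. \<forall>x\<in>L. a \<odot>\<^bsub>M\<^esub> x \<in> H}" for a b
    using that Lc Hc by (simp add: smult_assoc1)
qed blast

lemma ideal_smult_prod:
  assumes A: "ideal A R" and B: "ideal B R" and L: "submodule L R M"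
  shows "ideal_smult R M (ideal_prod R A B) L = ideal_smult R M A (ideal_smult R M B L)" (is "?l = ?r")
proof
  have Ac: "a \<in> A \<Longrightarrow> a \<in> carrier R" and Bc: "b \<in> B \<Longrightarrow> b \<in> carrier R" for a b
    using ideal.Icarr[OF A] ideal.Icarr[OF B] by auto
  note Lc = submodule_carrier[OF L]
  have BL: "submodule (ideal_smult R M B L) R M" by (rule ideal_smult_submodule[OF B L])
  have rs: "submodule ?r R M" by (rule ideal_smult_submodule[OF A BL])
  have ABi: "ideal (ideal_prod R A B) R" by (rule R.ideal_prod_is_ideal[OF A B])
  have ls: "submodule ?l R M" by (rule ideal_smult_submodule[OF ABi L])
  show "?l \<subseteq> ?r"
  proof (rule ideal_smult_least[OF rs])
    fix a x assume "a \<in> ideal_prod R A B" and x: "x \<in> L"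
    then show "a \<odot>\<^bsub>M\<^esub> x \<in> ?r"
    proof (induct rule: ideal_prod.induct)
      case (prod i j)
      have "i \<odot>\<^bsub>M\<^esub> (j \<odot>\<^bsub>M\<^esub> x) \<in> ?r" by (intro ideal_smult_gen prod x)
      then show ?case using Ac[OF prod(1)] Bc[OF prod(2)] Lc[OF x] by (simp add: smult_assoc1)
    next
      case (sum s t)
      have "s \<in> carrier R" "t \<in> carrier R" using sum ideal.Icarr[OF ABi] by auto
      then show ?case using sum x submoduleE(5)[OF rs] Lc by (simp add: smult_l_distr)
    qed
  qed
  show "?r \<subseteq> ?l"
  proof (rule ideal_smult_least[OF ls])
    fix a x assume a: "a \<in> A" and x: "x \<in> ideal_smult R M B L"
    let ?H = "{z \<in> carrier M. a \<odot>\<^bsub>M\<^esub> z \<in> ?l}"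
    have "submodule ?H R M"
    proof (rule submoduleI')
      show "\<zero>\<^bsub>M\<^esub> \<in> ?H" using submodule_zero[OF ls] Ac[OF a] by simp
      show "u \<oplus>\<^bsub>M\<^esub> v \<in> ?H" if "u \<in> ?H" "v \<in> ?H" for u v
        using that submoduleE(5)[OF ls] Ac[OF a] by (simp add: smult_r_distr)
      show "r \<odot>\<^bsub>M\<^esub> v \<in> ?H" if r: "r \<in> carrier R" and v: "v \<in> ?H" for r v
      proof -
        have "a \<odot>\<^bsub>M\<^esub> (r \<odot>\<^bsub>M\<^esub> v) = r \<odot>\<^bsub>M\<^esub> (a \<odot>\<^bsub>M\<^esub> v)"
          using r v Ac[OF a] by (simp add: smult_assoc1[symmetric] R.m_comm)
        then show ?thesis using r v submoduleE(4)[OF ls r] by simp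
      qed
    qed blast
    moreover have "b \<odot>\<^bsub>M\<^esub> z \<in> ?H" if b: "b \<in> B" and z: "z \<in> L" for b z
    proof -
      have "(a \<otimes> b) \<odot>\<^bsub>M\<^esub> z \<in> ?l" by (intro ideal_smult_gen ideal_prod.prod a b z)
      then show ?thesis using Ac[OF a] Bc[OF b] Lc[OF z] by (simp add: smult_assoc1)
    qed
    ultimately have "ideal_smult R M B L \<subseteq> ?H" by (rule ideal_smult_least)
    then show "a \<odot>\<^bsub>M\<^esub> x \<in> ?l" using x by blast
  qed
qed

lemma ideal_power_0: "ideal_power R I 0 = carrier R"
  by (simp add: ideal_power_def nat_pow_def ideals_set_def)

lemma ideal_power_Suc: "ideal_power R I (Suc n) = ideal_prod R (ideal_power R I n) I"
  by (simp add: ideal_power_def nat_pow_def ideals_set_def)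

lemma ideal_power_ideal: "ideal I R \<Longrightarrow> ideal (ideal_power R I n) R"
proof (induct n)
  case 0 then show ?case by (simp add: ideal_power_0 R.oneideal)
next
  case (Suc n) then show ?case by (simp add: ideal_power_Suc R.ideal_prod_is_ideal)
qed

lemma pow_smult_submodule: "ideal I R \<Longrightarrow> submodule L R M \<Longrightarrow> submodule (pow_smult R M I n L) R M"
  unfolding pow_smult_def by (intro ideal_smult_submodule ideal_power_ideal)

lemma pow_smult_0: "submodule L R M \<Longrightarrow> pow_smult R M I 0 L = L"
  by (simp add: pow_smult_def ideal_power_0 ideal_smult_carrier)

lemma pow_smult_Suc:
  assumes I: "ideal I R" and L: "submodule L R M"
  shows "pow_smult R M I (Suc n) L = pow_smult R M I n (ideal_smult R M I L)"
    and "pow_smult R M I (Suc n) L = ideal_smult R M I (pow_smult R M I n L)"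
proof -
  note P = ideal_power_ideal[OF I, of n]
  show "pow_smult R M I (Suc n) L = pow_smult R M I n (ideal_smult R M I L)"
    by (simp add: pow_smult_def ideal_power_Suc ideal_smult_prod[OF P I L])
  show "pow_smult R M I (Suc n) L = ideal_smult R M I (pow_smult R M I n L)"
    by (simp add: pow_smult_def ideal_power_Suc R.ideal_prod_commute[OF P I] ideal_smult_prod[OF I P L])
qed

lemma pow_smult_mono:
  "ideal I R \<Longrightarrow> submodule L R M \<Longrightarrow> K \<subseteq> L \<Longrightarrow> pow_smult R M I n K \<subseteq> pow_smult R M I n L"
  unfolding pow_smult_def by (intro ideal_smult_mono ideal_power_ideal)

lemma pow_smult_decreasing:
  assumes I: "ideal I R" and L: "submodule L R M"
  shows "pow_smult R M I (Suc n) L \<subseteq> pow_smult R M I n L"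
  unfolding pow_smult_Suc(2)[OF I L] by (intro ideal_smult_subset I pow_smult_submodule L)

lemma pow_smult_subset:
  assumes I: "ideal I R" and L: "submodule L R M"
  shows "pow_smult R M I n L \<subseteq> L"
  unfolding pow_smult_def by (intro ideal_smult_subset ideal_power_ideal I L)

lemma pow_smult_add:
  assumes I: "ideal I R" and L: "submodule L R M"
  shows "pow_smult R M I (m + n) L = pow_smult R M I m (pow_smult R M I n L)"
proof (induct m)
  case 0 then show ?case by (simp add: pow_smult_0 pow_smult_submodule[OF I L])
next
  case (Suc m) then show ?case
    by (simp add: pow_smult_Suc(2)[OF I L] pow_smult_Suc(2)[OF I pow_smult_submodule[OF I L]])
qed

lemma reduction_power:
  assumes I: "ideal I R" and J: "ideal J R"
    and m: "ideal_prod R J (ideal_power R I m) = ideal_power R I (Suc m)" and n: "n \<ge> m"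
  shows "ideal_prod R J (ideal_power R I n) = ideal_power R I (Suc n)"
  using n
proof (induct n rule: dec_induct)
  case base show ?case by (rule m)
next
  case (step n)
  have "ideal_prod R J (ideal_power R I (Suc n)) = ideal_prod R (ideal_prod R J (ideal_power R I n)) I"
    by (simp add: ideal_power_Suc[of I n] R.ideal_prod_assoc[OF J ideal_power_ideal[OF I] I])
  then show ?case by (simp add: step ideal_power_Suc[of I "Suc n"])
qed

lemma pow_smult_reduction:
  assumes I: "ideal I R" and J: "ideal J R" and L: "submodule L R M"
    and m: "ideal_prod R J (ideal_power R I m) = ideal_power R I (Suc m)" and n: "n \<ge> m"
  shows "pow_smult R M I (Suc n) L = ideal_smult R M J (pow_smult R M I n L)"
  by (simp add: pow_smult_def reduction_power[OF I J m n, symmetric] ideal_smult_prod[OF J ideal_power_ideal[OF I] L])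

end

lemma (in module_seq) ideal_smult_lin_comb:
  assumes L: "submodule L R M"
  shows "ideal_smult R M (Idl (y ` {1..c})) L \<subseteq> lin_comb M y L c"
proof (rule ideal_smult_least)
  have S: "submodule (lin_comb M y L c) R M" by (rule lin_comb_submodule[OF L le_refl])
  then show "submodule (lin_comb M y L c) R M" .
  have Lc: "L \<subseteq> carrier M" by (rule submoduleE(1)[OF L])
  have "Idl (y ` {1..c}) \<subseteq> {a \<in> carrier R. \<forall>x\<in>L. a \<odot>\<^bsub>M\<^esub> x \<in> lin_comb M y L c}"
    by (rule R.genideal_minimal[OF transporter_ideal[OF Lc S]])
      (use y_closed lin_comb_gen[OF L le_refl] in blast)
  then show "a \<odot>\<^bsub>M\<^esub> x \<in> lin_comb M y L c" if "a \<in> Idl (y ` {1..c})" "x \<in> L" for a x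
    using that by blast
qed

section \<open>Graded submodules and associated primes\<close>

lemma (in graded_ring) hcomp_minus_self:
  assumes a: "a \<in> carrier R"
  shows "hcomp R Rgr (a \<ominus> hcomp R Rgr a m) i = (if i = m then \<zero> else hcomp R Rgr a i)"
    and "(a \<ominus> hcomp R Rgr a m) \<oplus> hcomp R Rgr a m = a"
  using a Rg.hcomp_homog[OF Rg.hcomp_mem[OF a]]
  by (simp_all add: minus_eq Rg.hcomp_add Rg.hcomp_minus r_neg a_assoc l_neg)

context graded_module
begin

abbreviation "hM \<equiv> hcomp M Mgr"
abbreviation "hR \<equiv> hcomp R Rgr"

lemma hM_smult:
  assumes r: "r \<in> Rgr k" and x: "x \<in> carrier M"
  shows "hM (r \<odot>\<^bsub>M\<^esub> x) u = r \<odot>\<^bsub>M\<^esub> hM x (u - int k)"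
proof -
  have rc: "r \<in> carrier R" by (rule Rg.C_carrier[OF r])
  let ?S = "{v. hM x v \<noteq> \<zero>\<^bsub>M\<^esub>}"
  have fin: "finite ?S" by (rule Mg.hcomp_finite[OF x])
  have "hM (r \<odot>\<^bsub>M\<^esub> x) = (\<lambda>u. r \<odot>\<^bsub>M\<^esub> hM x (u - int k))"
  proof (rule Mg.hcomp_eqI[of "(\<lambda>v. v + int k) ` ?S"])
    show "finite ((\<lambda>v. v + int k) ` ?S)" using fin by simp
    show "r \<odot>\<^bsub>M\<^esub> hM x (u - int k) \<in> Mgr u" for u
      using smult_graded[OF r Mg.hcomp_mem[OF x, of "u - int k"]] by simp
    show "r \<odot>\<^bsub>M\<^esub> hM x (u - int k) = \<zero>\<^bsub>M\<^esub>" if u: "u \<notin> (\<lambda>v. v + int k) ` ?S" for u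
    proof -
      have "u - int k \<notin> ?S" using u by (metis diff_add_cancel imageI)
      then show ?thesis using rc by simp
    qed
    have "(\<Oplus>\<^bsub>M\<^esub>u\<in>(\<lambda>v. v + int k) ` ?S. r \<odot>\<^bsub>M\<^esub> hM x (u - int k)) =
        (\<Oplus>\<^bsub>M\<^esub>v\<in>?S. r \<odot>\<^bsub>M\<^esub> hM x (v + int k - int k))"
      by (rule M.finsum_reindex) (use rc x in \<open>auto simp: inj_on_def\<close>)
    also have "\<dots> = (\<Oplus>\<^bsub>M\<^esub>v\<in>?S. r \<odot>\<^bsub>M\<^esub> hM x v)" by simp
    also have "\<dots> = r \<odot>\<^bsub>M\<^esub> (\<Oplus>\<^bsub>M\<^esub>v\<in>?S. hM x v)"
      by (rule finsum_smult_ldistr[symmetric]) (use fin rc x in auto)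
    also have "\<dots> = r \<odot>\<^bsub>M\<^esub> x" by (simp add: Mg.hcomp_sum[OF x])
    finally show "r \<odot>\<^bsub>M\<^esub> x = (\<Oplus>\<^bsub>M\<^esub>u\<in>(\<lambda>v. v + int k) ` ?S. r \<odot>\<^bsub>M\<^esub> hM x (u - int k))" by simp
  qed
  then show ?thesis by simp
qed

text \<open>In degree \<open>m + t\<close> only the product of the two top components contributes,
  since any other pair of degrees with this sum has a member beyond its bound.\<close>

lemma hM_smult_top:
  assumes r: "r \<in> carrier R" "\<And>i. i > m \<Longrightarrow> hR r i = \<zero>" and x: "x \<in> carrier M" "\<And>u. u > t \<Longrightarrow> hM x u = \<zero>\<^bsub>M\<^esub>"
  shows "hM (r \<odot>\<^bsub>M\<^esub> x) (int m + t) = hR r m \<odot>\<^bsub>M\<^esub> hM x t"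
proof -
  let ?H = "{s \<in> carrier R. hM (s \<odot>\<^bsub>M\<^esub> x) (int m + t) = hR s m \<odot>\<^bsub>M\<^esub> hM x t}"
  have z: "\<zero> \<in> ?H" using x by simp
  have "r \<in> ?H"
  proof (rule Rg.mem_if_hcomp_mem[OF r(1) z])
    show "a \<oplus> b \<in> ?H" if "a \<in> ?H" "b \<in> ?H" for a b
      using that x by (simp add: smult_l_distr Mg.hcomp_add Rg.hcomp_add)
    fix i
    have ri: "hR r i \<in> Rgr i" "hR r i \<in> carrier R" using r by (auto intro: Rg.hcomp_mem)
    show "hR r i \<in> ?H"
    proof (cases "i > m")
      case True then show ?thesis using r(2) z by simp
    next
      case False
      have "hM (hR r i \<odot>\<^bsub>M\<^esub> x) (int m + t) = hR r i \<odot>\<^bsub>M\<^esub> hM x (int m + t - int i)"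
        by (rule hM_smult[OF ri(1) x(1)])
      also have "\<dots> = (if m = i then hR r i else \<zero>) \<odot>\<^bsub>M\<^esub> hM x t"
        using False ri x(1) x(2)[of "int m + t - int i"] by simp
      also have "\<dots> = hR (hR r i) m \<odot>\<^bsub>M\<^esub> hM x t"
        by (simp only: Rg.hcomp_homog[OF ri(1)])
      finally show ?thesis using ri by simp
    qed
  qed blast
  then show ?thesis by simp
qed

lemma hM_smult_homog:
  assumes r: "r \<in> carrier R" and x: "x \<in> Mgr t"
  shows "hM (r \<odot>\<^bsub>M\<^esub> x) (int m + t) = hR r m \<odot>\<^bsub>M\<^esub> x"
proof -
  have xc: "x \<in> carrier M" by (rule Mg.C_carrier[OF x])
  let ?H = "{s \<in> carrier R. hM (s \<odot>\<^bsub>M\<^esub> x) (int m + t) = hR s m \<odot>\<^bsub>M\<^esub> x}"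
  have "r \<in> ?H"
  proof (rule Rg.mem_if_hcomp_mem[OF r])
    show "\<zero> \<in> ?H" using xc by simp
    show "a \<oplus> b \<in> ?H" if "a \<in> ?H" "b \<in> ?H" for a b
      using that xc by (simp add: smult_l_distr Mg.hcomp_add Rg.hcomp_add)
    fix i
    have ri: "hR r i \<in> Rgr i" "hR r i \<in> carrier R" using r by (auto intro: Rg.hcomp_mem)
    have "hM (hR r i \<odot>\<^bsub>M\<^esub> x) (int m + t) = hR r i \<odot>\<^bsub>M\<^esub> hM x (int m + t - int i)"
      by (rule hM_smult[OF ri(1) xc])
    also have "\<dots> = (if m = i then hR r i else \<zero>) \<odot>\<^bsub>M\<^esub> x"
      using ri xc by (simp add: Mg.hcomp_homog[OF x])
    also have "\<dots> = hR (hR r i) m \<odot>\<^bsub>M\<^esub> x"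
      by (simp only: Rg.hcomp_homog[OF ri(1)])
    finally show "hR r i \<in> ?H" using ri by simp
  qed blast
  then show ?thesis by simp
qed

text \<open>Closure under components is the form in which \<open>graded_submodule\<close> is used;
  \<open>gsub_graded_submodule\<close> provides it.\<close>

definition gsub :: "'c set \<Rightarrow> bool"
  where "gsub H \<longleftrightarrow> submodule H R M \<and> (\<forall>x\<in>H. \<forall>u. hM x u \<in> H)"

lemma gsubD: "gsub H \<Longrightarrow> submodule H R M" "gsub H \<Longrightarrow> x \<in> H \<Longrightarrow> hM x u \<in> H"
  by (auto simp: gsub_def)

definition graded_ideal :: "'a set \<Rightarrow> bool"
  where "graded_ideal I \<longleftrightarrow> ideal I R \<and> (\<forall>a\<in>I. \<forall>k. hR a k \<in> I)"

lemma gsub_graded_submodule: "graded_submodule R M Mgr N \<Longrightarrow> gsub N"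
  unfolding graded_submodule_def gsub_def by (auto intro: Mg.internal_direct_sum_hcomp)

lemma graded_ideal_homogeneous: "homogeneous_ideal R Rgr I \<Longrightarrow> graded_ideal I"
  unfolding homogeneous_ideal_def graded_ideal_def by (auto intro: Rg.internal_direct_sum_hcomp)

lemma gsub_carrier: "gsub (carrier M)"
  unfolding gsub_def using carrier_is_submodule by simp

lemma mem_submodule_if_hM:
  assumes "submodule H R M" "x \<in> carrier M" "\<And>u. hM x u \<in> H"
  shows "x \<in> H"
  by (rule Mg.mem_if_hcomp_mem)
    (use assms submoduleE(1,5)[OF assms(1)] submodule_zero[OF assms(1)] in auto)

lemma smult_mem_if_hR:
  assumes "submodule H R M" "x \<in> carrier M" "r \<in> carrier R" "\<And>i. hR r i \<odot>\<^bsub>M\<^esub> x \<in> H"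
  shows "r \<odot>\<^bsub>M\<^esub> x \<in> H"
proof -
  have "r \<in> {s \<in> carrier R. s \<odot>\<^bsub>M\<^esub> x \<in> H}"
    by (rule Rg.mem_if_hcomp_mem)
      (use assms submoduleE(5)[OF assms(1)] submodule_zero[OF assms(1)] in \<open>auto simp: smult_l_distr\<close>)
  then show ?thesis by simp
qed

text \<open>A graded submodule may be prescribed by its homogeneous parts \<open>Q u\<close>, and
  then only homogeneous scalars have to be tested. The sequence \<open>Z\<close> of
  \<open>ann_degs_linear\<close> is built in this way.\<close>

lemma gsub_of_graded:
  fixes Q :: "int \<Rightarrow> 'c set"
  assumes Q: "\<And>u. Q u \<subseteq> Mgr u" "\<And>u. \<zero>\<^bsub>M\<^esub> \<in> Q u" "\<And>u a b. a \<in> Q u \<Longrightarrow> b \<in> Q u \<Longrightarrow> a \<oplus>\<^bsub>M\<^esub> b \<in> Q u"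
    "\<And>k u r x. r \<in> Rgr k \<Longrightarrow> x \<in> Q u \<Longrightarrow> r \<odot>\<^bsub>M\<^esub> x \<in> Q (int k + u)"
  shows "gsub {x \<in> carrier M. \<forall>u. hM x u \<in> Q u}" (is "gsub ?H")
proof -
  have add: "a \<oplus>\<^bsub>M\<^esub> b \<in> ?H" if "a \<in> ?H" "b \<in> ?H" for a b
    using that Q(3) by (simp add: Mg.hcomp_add)
  have "submodule ?H R M"
  proof (rule submoduleI'[OF _ _ add])
    show "\<zero>\<^bsub>M\<^esub> \<in> ?H" using Q(2) by simp
    fix r x assume r: "r \<in> carrier R" and x: "x \<in> ?H"
    then have xc: "x \<in> carrier M" by simp
    have "r \<in> {s \<in> carrier R. s \<odot>\<^bsub>M\<^esub> x \<in> ?H}"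
    proof (rule Rg.mem_if_hcomp_mem[OF r])
      show "\<zero> \<in> {s \<in> carrier R. s \<odot>\<^bsub>M\<^esub> x \<in> ?H}" using xc Q(2) by simp
      show "a \<oplus> b \<in> {s \<in> carrier R. s \<odot>\<^bsub>M\<^esub> x \<in> ?H}"
        if "a \<in> {s \<in> carrier R. s \<odot>\<^bsub>M\<^esub> x \<in> ?H}" "b \<in> {s \<in> carrier R. s \<odot>\<^bsub>M\<^esub> x \<in> ?H}" for a b
        using that xc add[of "a \<odot>\<^bsub>M\<^esub> x" "b \<odot>\<^bsub>M\<^esub> x"] by (simp add: smult_l_distr)
      fix i
      have ri: "hR r i \<in> Rgr i" "hR r i \<in> carrier R" using r by (auto intro: Rg.hcomp_mem)
      have "hM (hR r i \<odot>\<^bsub>M\<^esub> x) u \<in> Q u" for u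
        using Q(4)[OF ri(1), of "hM x (u - int i)" "u - int i"] x by (simp add: hM_smult[OF ri(1) xc])
      then show "hR r i \<in> {s \<in> carrier R. s \<odot>\<^bsub>M\<^esub> x \<in> ?H}" using ri xc by simp
    qed blast
    then show "r \<odot>\<^bsub>M\<^esub> x \<in> ?H" by blast
  qed blast
  moreover have "hM x u \<in> ?H" if "x \<in> ?H" for x u
    using that Q(2) by (auto simp: Mg.hcomp_homog[OF Mg.hcomp_mem])
  ultimately show ?thesis by (simp add: gsub_def)
qed

text \<open>The elements all of whose components lie in \<open>A L\<close> form a submodule. It
  contains every product \<open>a x\<close>, because the components of \<open>a\<close> and of
  \<open>x\<close> are in \<open>A\<close> and \<open>L\<close>, so it contains
  \<open>A L\<close>.\<close>

lemma gsub_ideal_smult: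
  assumes A: "graded_ideal A" and L: "gsub L"
  shows "gsub (ideal_smult R M A L)"
proof -
  let ?K = "ideal_smult R M A L"
  have Ai: "ideal A R" using A by (simp add: graded_ideal_def)
  note Ls = gsubD(1)[OF L]
  have K: "submodule ?K R M" by (rule ideal_smult_submodule[OF Ai Ls])
  let ?H = "{x \<in> carrier M. \<forall>u. hM x u \<in> ?K \<inter> Mgr u}"
  have "gsub ?H"
  proof (rule gsub_of_graded)
    show "r \<odot>\<^bsub>M\<^esub> x \<in> ?K \<inter> Mgr (int k + u)" if "r \<in> Rgr k" "x \<in> ?K \<inter> Mgr u" for k u r x
      using that smult_graded[of r k x u] submoduleE(4)[OF K] Rg.C_carrier[of r k] by auto
    show "a \<oplus>\<^bsub>M\<^esub> b \<in> ?K \<inter> Mgr u" if "a \<in> ?K \<inter> Mgr u" "b \<in> ?K \<inter> Mgr u" for u a b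
      using that submoduleE(5)[OF K] additive_subgroup.a_closed[OF Mg.C_subgroup] by auto
  qed (use submodule_zero[OF K] Mg.C_zero in auto)
  then have H: "submodule ?H R M" by (rule gsubD)
  have "?K \<subseteq> ?H"
  proof (rule ideal_smult_least[OF H])
    fix a x assume a: "a \<in> A" and x: "x \<in> L"
    have ac: "a \<in> carrier R" using ideal.Icarr[OF Ai a] .
    have xc: "x \<in> carrier M" by (rule submodule_carrier[OF Ls x])
    show "a \<odot>\<^bsub>M\<^esub> x \<in> ?H"
    proof (rule smult_mem_if_hR[OF H xc ac])
      fix i
      have ai: "hR a i \<in> A" "hR a i \<in> Rgr i" "hR a i \<in> carrier R"
        using A a ac by (auto simp: graded_ideal_def intro: Rg.hcomp_mem)
      have "hM (hR a i \<odot>\<^bsub>M\<^esub> x) u \<in> ?K" for u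
        unfolding hM_smult[OF ai(2) xc] by (intro ideal_smult_gen ai gsubD(2)[OF L x])
      then show "hR a i \<odot>\<^bsub>M\<^esub> x \<in> ?H" using ai xc by (simp add: Mg.hcomp_mem)
    qed
  qed
  then show ?thesis using K by (auto simp: gsub_def)
qed

lemma gsub_pow_smult:
  assumes "graded_ideal I" "gsub L"
  shows "gsub (pow_smult R M I n L)"
proof (induct n)
  case 0 then show ?case using assms by (simp add: pow_smult_0 gsubD)
next
  case (Suc n)
  have "ideal I R" using assms by (simp add: graded_ideal_def)
  then show ?case using gsub_ideal_smult[OF assms(1) Suc] by (simp add: pow_smult_Suc(2) gsubD[OF assms(2)])
qed

text \<open>As \<open>p\<close> is homogeneous, each component of \<open>r\<close> already sends
  \<open>x\<close> into \<open>B\<close>. A homogeneous factor only shifts degrees, so one component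
  of that product isolates \<open>hM x u\<close>.\<close>

lemma res_hM:
  assumes B: "gsub B" and p: "\<And>r i. r \<in> p \<Longrightarrow> hR r i \<in> p" "p \<subseteq> carrier R"
    and x: "x \<in> carrier M" "\<And>r. r \<in> p \<Longrightarrow> r \<odot>\<^bsub>M\<^esub> x \<in> B" and r: "r \<in> p"
  shows "r \<odot>\<^bsub>M\<^esub> hM x u \<in> B"
proof (rule smult_mem_if_hR[OF gsubD(1)[OF B]])
  show rc: "r \<in> carrier R" using r p(2) by blast
  show "hM x u \<in> carrier M" using x by simp
  fix i
  have "hM (hR r i \<odot>\<^bsub>M\<^esub> x) (int i + u) \<in> B" by (rule gsubD(2)[OF B]) (rule x(2)[OF p(1)[OF r]])
  then show "hR r i \<odot>\<^bsub>M\<^esub> hM x u \<in> B" by (simp add: hM_smult[OF Rg.hcomp_mem[OF rc] x(1)])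
qed

text \<open>If \<open>t\<close> is the top degree of \<open>x\<close>, then either \<open>p\<close> annihilates the top component, or a
  homogeneous element outside \<open>p\<close> kills it and shortens \<open>x\<close>.\<close>

lemma graded_ass:
  assumes B: "gsub B" and p: "primeideal p R"
  shows "x \<in> carrier M \<Longrightarrow> p = res B x \<Longrightarrow>
    (\<exists>u. p = res B (hM x u)) \<and> (\<forall>r\<in>p. \<forall>i. hR r i \<in> p)"
proof (induct "card {u. hM x u \<noteq> \<zero>\<^bsub>M\<^esub>}" arbitrary: x rule: less_induct)
  case less
  note x = less(2) and px = less(3)
  note Bs = gsubD(1)[OF B]
  note pD = primeD[OF p]
  let ?S = "{u. hM x u \<noteq> \<zero>\<^bsub>M\<^esub>}"
  have fin: "finite ?S" by (rule Mg.hcomp_finite[OF x])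
  have "?S \<noteq> {}"
  proof
    assume "?S = {}"
    then have "x \<in> B" using submodule_zero[OF Bs] by (intro mem_submodule_if_hM[OF Bs x]) auto
    then have "\<one> \<in> p" using px x by (simp add: res_mem)
    then show False using pD(1) by simp
  qed
  define t where "t = Max ?S"
  have tS: "t \<in> ?S" unfolding t_def using fin \<open>?S \<noteq> {}\<close> by (rule Max_in)
  have top: "hM x u = \<zero>\<^bsub>M\<^esub>" if "u > t" for u
    using that Max_ge[OF fin, of u] unfolding t_def by force
  let ?xt = "hM x t"
  have xt: "?xt \<in> Mgr t" "?xt \<in> carrier M" using x by (auto intro: Mg.hcomp_mem)
  show ?case
  proof (cases "\<exists>k. \<exists>r\<in>Rgr k. r \<odot>\<^bsub>M\<^esub> ?xt \<in> B \<and> r \<notin> p")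
    case True
    then obtain k r where r: "r \<in> Rgr k" "r \<odot>\<^bsub>M\<^esub> ?xt \<in> B" "r \<notin> p" by blast
    have rc: "r \<in> carrier R" by (rule Rg.C_carrier[OF r(1)])
    let ?z = "x \<ominus>\<^bsub>M\<^esub> ?xt"
    \<comment> \<open>Modulo \<open>B\<close> this agrees with \<open>r x\<close>, because
      \<open>r\<close> kills the top component. It has annihilator \<open>p\<close> and fewer
      nonzero components than \<open>x\<close>, so the induction hypothesis applies.\<close>
    let ?x' = "r \<odot>\<^bsub>M\<^esub> ?z"
    have z: "?z \<in> carrier M" using x xt by (simp add: M.minus_eq)
    have hz: "hM ?z u = (if u = t then \<zero>\<^bsub>M\<^esub> else hM x u)" for u
      using x xt by (simp add: M.minus_eq Mg.hcomp_add Mg.hcomp_minus Mg.hcomp_homog[OF xt(1)] M.r_neg)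
    have x'c: "?x' \<in> carrier M" using rc z by simp
    have split: "r \<odot>\<^bsub>M\<^esub> x = ?x' \<oplus>\<^bsub>M\<^esub> r \<odot>\<^bsub>M\<^esub> ?xt"
      using rc x xt by (simp add: smult_r_distr[symmetric] M.minus_eq M.a_assoc M.l_neg)
    have "res B ?x' = res B (r \<odot>\<^bsub>M\<^esub> x)"
    proof -
      have "s \<odot>\<^bsub>M\<^esub> ?x' \<in> B \<longleftrightarrow> s \<odot>\<^bsub>M\<^esub> (r \<odot>\<^bsub>M\<^esub> x) \<in> B" if s: "s \<in> carrier R" for s
      proof -
        have e: "s \<odot>\<^bsub>M\<^esub> (r \<odot>\<^bsub>M\<^esub> x) = s \<odot>\<^bsub>M\<^esub> ?x' \<oplus>\<^bsub>M\<^esub> s \<odot>\<^bsub>M\<^esub> (r \<odot>\<^bsub>M\<^esub> ?xt)"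
          unfolding split using s rc x'c xt by (simp add: smult_r_distr)
        have b: "s \<odot>\<^bsub>M\<^esub> (r \<odot>\<^bsub>M\<^esub> ?xt) \<in> B" by (rule submoduleE(4)[OF Bs s r(2)])
        show ?thesis unfolding e
          using submoduleE(5)[OF Bs _ b] submodule_diff[OF Bs _ b, of "s \<odot>\<^bsub>M\<^esub> ?x'"] s x'c by auto
      qed
      then show ?thesis by (auto simp: res_def)
    qed
    then have px': "p = res B ?x'" using res_mult_prime[OF p px x rc r(3)] by simp
    have hx': "hM ?x' v = r \<odot>\<^bsub>M\<^esub> hM ?z (v - int k)" for v by (rule hM_smult[OF r(1) z])
    have "{v. hM ?x' v \<noteq> \<zero>\<^bsub>M\<^esub>} \<subseteq> (\<lambda>u. u + int k) ` (?S - {t})"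
    proof
      fix v assume v: "v \<in> {v. hM ?x' v \<noteq> \<zero>\<^bsub>M\<^esub>}"
      then have "v - int k \<in> ?S - {t}" using rc unfolding hx' hz by (auto split: if_splits)
      then show "v \<in> (\<lambda>u. u + int k) ` (?S - {t})" by (metis diff_add_cancel imageI)
    qed
    then have "card {v. hM ?x' v \<noteq> \<zero>\<^bsub>M\<^esub>} \<le> card (?S - {t})"
      using fin by (meson card_image_le card_mono finite_Diff finite_imageI order_trans)
    also have "\<dots> < card ?S" using fin tS by (rule card_Diff1_less)
    finally have IH: "\<exists>v. p = res B (hM ?x' v)" "\<And>r i. r \<in> p \<Longrightarrow> hR r i \<in> p"
      using less(1)[OF _ x'c px'] by auto
    obtain v where v: "p = res B (r \<odot>\<^bsub>M\<^esub> hM ?z (v - int k))" using IH(1) unfolding hx' by blast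
    let ?u = "v - int k"
    have "?u \<noteq> t"
    proof
      assume "?u = t"
      then have "\<one> \<in> p" using v hz submodule_zero[OF Bs] rc by (simp add: res_mem)
      then show False using pD(1) by simp
    qed
    then have pv: "p = res B (r \<odot>\<^bsub>M\<^esub> hM x ?u)" using v hz by simp
    \<comment> \<open>Whatever kills the component also kills its multiple by \<open>r\<close>,
      whose annihilator is \<open>p\<close>. Conversely \<open>p\<close> is homogeneous by the
      induction hypothesis, so it kills every component of \<open>x\<close>.\<close>
    have "p = res B (hM x ?u)"
    proof
      show "res B (hM x ?u) \<subseteq> p"
      proof
        fix s assume s: "s \<in> res B (hM x ?u)"
        then have sc: "s \<in> carrier R" by (simp add: res_mem)
        have "r \<odot>\<^bsub>M\<^esub> (s \<odot>\<^bsub>M\<^esub> hM x ?u) \<in> B" using s submoduleE(4)[OF Bs rc] by (simp add: res_mem)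
        then have "s \<odot>\<^bsub>M\<^esub> (r \<odot>\<^bsub>M\<^esub> hM x ?u) \<in> B"
          using sc rc x by (simp add: smult_assoc1[symmetric] m_comm)
        then have "s \<in> res B (r \<odot>\<^bsub>M\<^esub> hM x ?u)" using sc by (simp add: res_mem)
        then show "s \<in> p" using pv by simp
      qed
      have "r \<odot>\<^bsub>M\<^esub> x \<in> B" if "r \<in> p" for r using that px by (simp add: res_mem)
      then show "p \<subseteq> res B (hM x ?u)"
        using res_hM[OF B IH(2) pD(3) x] pD(3) by (auto simp: res_mem)
    qed
    then show ?thesis using IH(2) by blast
  next
    case False
    then have out: "\<And>k r. r \<in> Rgr k \<Longrightarrow> r \<odot>\<^bsub>M\<^esub> ?xt \<in> B \<Longrightarrow> r \<in> p" by blast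
    \<comment> \<open>An element \<open>r\<close> of \<open>p\<close> is dismantled from the top.
      The top component of \<open>r x\<close> is \<open>hR r m\<close> times \<open>?xt\<close> and
      lies in \<open>B\<close>, so \<open>hR r m\<close> lies in \<open>p\<close> by
      \<open>out\<close>; subtracting it lowers the degree bound \<open>m\<close>.\<close>
    have claim: "\<forall>r\<in>p. (\<forall>i\<ge>m. hR r i = \<zero>) \<longrightarrow> (\<forall>i. hR r i \<in> p) \<and> r \<odot>\<^bsub>M\<^esub> ?xt \<in> B" for m
    proof (induct m)
      case 0
      show ?case
      proof (intro ballI impI)
        fix r assume r: "r \<in> p" "\<forall>i\<ge>0. hR r i = \<zero>"
        have "r \<in> {\<zero>}" by (rule Rg.mem_if_hcomp_mem) (use r pD(3) in auto)
        then show "(\<forall>i. hR r i \<in> p) \<and> r \<odot>\<^bsub>M\<^esub> ?xt \<in> B"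
          using r pD(5) xt submodule_zero[OF Bs] by simp
      qed
    next
      case (Suc m)
      show ?case
      proof (intro ballI impI)
        fix r assume r: "r \<in> p" "\<forall>i\<ge>Suc m. hR r i = \<zero>"
        have rc: "r \<in> carrier R" using r(1) pD(3) by blast
        have rm: "hR r m \<in> Rgr m" "hR r m \<in> carrier R" using rc by (auto intro: Rg.hcomp_mem)
        have "r \<odot>\<^bsub>M\<^esub> x \<in> B" using r(1) px by (simp add: res_mem)
        then have "hM (r \<odot>\<^bsub>M\<^esub> x) (int m + t) \<in> B" by (rule gsubD(2)[OF B])
        then have b: "hR r m \<odot>\<^bsub>M\<^esub> ?xt \<in> B" using hM_smult_top[OF rc _ x top, of m] r(2) by simp
        then have mp: "hR r m \<in> p" by (rule out[OF rm(1)])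
        let ?r = "r \<ominus> hR r m"
        have h: "hR ?r i = (if i = m then \<zero> else hR r i)" for i
          by (rule hcomp_minus_self(1)[OF rc])
        have "?r \<in> p" by (rule pD(6)[OF r(1) mp])
        moreover have "\<forall>i\<ge>m. hR ?r i = \<zero>" using r(2) by (auto simp: h le_Suc_eq Suc_le_eq)
        ultimately have *: "\<forall>i. hR ?r i \<in> p" "?r \<odot>\<^bsub>M\<^esub> ?xt \<in> B" using Suc by blast+
        have "hR r i \<in> p" for i using *(1)[rule_format, of i] mp by (cases "i = m") (auto simp: h)
        moreover have "?r \<oplus> hR r m = r" by (rule hcomp_minus_self(2)[OF rc])
        then have "r \<odot>\<^bsub>M\<^esub> ?xt = ?r \<odot>\<^bsub>M\<^esub> ?xt \<oplus>\<^bsub>M\<^esub> hR r m \<odot>\<^bsub>M\<^esub> ?xt"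
          using smult_l_distr[of ?r "hR r m" ?xt] rc rm xt by simp
        then have "r \<odot>\<^bsub>M\<^esub> ?xt \<in> B" using submoduleE(5)[OF Bs *(2) b] by simp
        ultimately show "(\<forall>i. hR r i \<in> p) \<and> r \<odot>\<^bsub>M\<^esub> ?xt \<in> B" by blast
      qed
    qed
    have all: "(\<forall>i. hR r i \<in> p) \<and> r \<odot>\<^bsub>M\<^esub> ?xt \<in> B" if r: "r \<in> p" for r
    proof -
      have f: "finite {i. hR r i \<noteq> \<zero>}" by (rule Rg.hcomp_finite) (use r pD(3) in auto)
      then obtain m where "\<forall>i\<in>{i. hR r i \<noteq> \<zero>}. i < m" using finite_nat_set_iff_bounded by auto
      then have "\<forall>i\<ge>m. hR r i = \<zero>" by (metis (mono_tags, lifting) mem_Collect_eq not_less)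
      then show ?thesis using claim[of m] r by blast
    qed
    have "p = res B ?xt"
    proof
      show "p \<subseteq> res B ?xt" using all pD(3) by (auto simp: res_mem)
      show "res B ?xt \<subseteq> p"
      proof
        fix s assume s: "s \<in> res B ?xt"
        then have sc: "s \<in> carrier R" by (simp add: res_mem)
        have "hR s i \<in> p" for i
        proof (rule out[OF Rg.hcomp_mem[OF sc]])
          have "hM (s \<odot>\<^bsub>M\<^esub> ?xt) (int i + t) \<in> B" by (rule gsubD(2)[OF B]) (use s in \<open>simp add: res_mem\<close>)
          then show "hR s i \<odot>\<^bsub>M\<^esub> ?xt \<in> B" by (simp add: hM_smult_homog[OF sc xt(1)])
        qed
        then show "s \<in> p" by (intro Rg.mem_if_hcomp_mem[OF sc pD(5,3,7)])
      qed
    qed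
    then show ?thesis using all by blast
  qed
qed

end

section \<open>Eventual linearity of initial degrees\<close>

text \<open>Working with sets of degrees and attained minima keeps extended reals and infima of
  empty sets out of the argument until \<open>lin_min_INF\<close>.\<close>

definition lin_min :: "(nat \<Rightarrow> int set) \<Rightarrow> nat \<Rightarrow> bool"
  where "lin_min S a \<longleftrightarrow> (\<exists>b. \<forall>\<^sub>F n in sequentially.
    int a * int n + b \<in> S n \<and> (\<forall>u\<in>S n. int a * int n + b \<le> u))"

lemma lin_min_cong:
  assumes "lin_min S a" "\<forall>\<^sub>F n in sequentially. S n = T n"
  shows "lin_min T a"
proof -
  obtain b where "\<forall>\<^sub>F n in sequentially. int a * int n + b \<in> S n \<and> (\<forall>u\<in>S n. int a * int n + b \<le> u)"
    using assms(1) unfolding lin_min_def by blast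
  then have "\<forall>\<^sub>F n in sequentially. int a * int n + b \<in> T n \<and> (\<forall>u\<in>T n. int a * int n + b \<le> u)"
    using assms(2) by eventually_elim simp
  then show ?thesis unfolding lin_min_def by blast
qed

lemma lin_min_union_le:
  assumes S: "lin_min S a" and T: "lin_min T a'" and le: "a < a'"
  shows "lin_min (\<lambda>n. S n \<union> T n) a"
proof -
  obtain b where b: "\<forall>\<^sub>F n in sequentially. int a * int n + b \<in> S n \<and> (\<forall>u\<in>S n. int a * int n + b \<le> u)"
    using S unfolding lin_min_def by blast
  obtain b' where b': "\<forall>\<^sub>F n in sequentially. int a' * int n + b' \<in> T n \<and> (\<forall>u\<in>T n. int a' * int n + b' \<le> u)"
    using T unfolding lin_min_def by blast
  have "\<forall>\<^sub>F n in sequentially. int a * int n + b \<le> int a' * int n + b'"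
    unfolding eventually_sequentially
  proof (intro exI allI impI)
    \<comment> \<open>The slopes differ by at least one, so from this index on the difference of the
      constant terms is compensated.\<close>
    fix n assume "nat (b - b') \<le> n"
    then have "b - b' \<le> int n" by simp
    also have "\<dots> \<le> (int a' - int a) * int n" using mult_right_mono[of 1 "int a' - int a" "int n"] le by simp
    finally show "int a * int n + b \<le> int a' * int n + b'" by (simp add: algebra_simps)
  qed
  with b b' have "\<forall>\<^sub>F n in sequentially. int a * int n + b \<in> S n \<union> T n \<and> (\<forall>u\<in>S n \<union> T n. int a * int n + b \<le> u)"
    by eventually_elim auto
  then show ?thesis unfolding lin_min_def by blast
qed

lemma lin_min_union:
  assumes S: "lin_min S a" and T: "lin_min T a'"
  shows "\<exists>a''\<in>{a, a'}. lin_min (\<lambda>n. S n \<union> T n) a''"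
proof -
  consider "a < a'" | "a' < a" | "a = a'" by linarith
  then show ?thesis
  proof cases
    case 1 then show ?thesis using lin_min_union_le[OF S T] by blast
  next
    case 2 then show ?thesis using lin_min_union_le[OF T S] by (simp add: Un_commute)
  next
    case 3
    obtain b where b: "\<forall>\<^sub>F n in sequentially. int a * int n + b \<in> S n \<and> (\<forall>u\<in>S n. int a * int n + b \<le> u)"
      using S unfolding lin_min_def by blast
    obtain b' where b': "\<forall>\<^sub>F n in sequentially. int a * int n + b' \<in> T n \<and> (\<forall>u\<in>T n. int a * int n + b' \<le> u)"
      using T 3 unfolding lin_min_def by blast
    from b b' have "\<forall>\<^sub>F n in sequentially. int a * int n + min b b' \<in> S n \<union> T n \<and>
        (\<forall>u\<in>S n \<union> T n. int a * int n + min b b' \<le> u)"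
      by eventually_elim (auto simp: min_def)
    then show ?thesis unfolding lin_min_def by blast
  qed
qed

text \<open>Quotients in the torsion filtration may vanish for large \<open>n\<close>. Admitting
  this case makes the property stable under the unions that come from a filtration.\<close>

definition lin_or_empty :: "(nat \<Rightarrow> int set) \<Rightarrow> nat set \<Rightarrow> bool"
  where "lin_or_empty S D \<longleftrightarrow> (\<forall>\<^sub>F n in sequentially. S n = {}) \<or> (\<exists>a\<in>D. lin_min S a)"

lemma lin_or_empty_union:
  assumes "lin_or_empty S D" "lin_or_empty T D"
  shows "lin_or_empty (\<lambda>n. S n \<union> T n) D"
proof (cases "(\<forall>\<^sub>F n in sequentially. S n = {}) \<or> (\<forall>\<^sub>F n in sequentially. T n = {})")
  case True
  then show ?thesis
  proof
    assume e: "\<forall>\<^sub>F n in sequentially. S n = {}"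
    then have e': "\<forall>\<^sub>F n in sequentially. T n = S n \<union> T n" by eventually_elim simp
    show ?thesis using assms(2) unfolding lin_or_empty_def
    proof
      assume "\<forall>\<^sub>F n in sequentially. T n = {}"
      with e have "\<forall>\<^sub>F n in sequentially. S n \<union> T n = {}" by eventually_elim simp
      then show "(\<forall>\<^sub>F n in sequentially. S n \<union> T n = {}) \<or> (\<exists>a\<in>D. lin_min (\<lambda>n. S n \<union> T n) a)" ..
    qed (use lin_min_cong[OF _ e'] in blast)
  next
    assume e: "\<forall>\<^sub>F n in sequentially. T n = {}"
    then have e': "\<forall>\<^sub>F n in sequentially. S n = S n \<union> T n" by eventually_elim simp
    show ?thesis using assms(1) unfolding lin_or_empty_def
    proof
      assume "\<forall>\<^sub>F n in sequentially. S n = {}"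
      with e have "\<forall>\<^sub>F n in sequentially. S n \<union> T n = {}" by eventually_elim simp
      then show "(\<forall>\<^sub>F n in sequentially. S n \<union> T n = {}) \<or> (\<exists>a\<in>D. lin_min (\<lambda>n. S n \<union> T n) a)" ..
    qed (use lin_min_cong[OF _ e'] in blast)
  qed
next
  case False
  then obtain a a' where "a \<in> D" "a' \<in> D" "lin_min S a" "lin_min T a'"
    using assms unfolding lin_or_empty_def by blast
  then show ?thesis using lin_min_union[of S a T a'] unfolding lin_or_empty_def by blast
qed

lemma lin_or_empty_mono: "lin_or_empty S D \<Longrightarrow> D \<subseteq> D' \<Longrightarrow> lin_or_empty S D'"
  unfolding lin_or_empty_def by blast

lemma int_set_least:
  fixes S :: "int set"
  assumes "S \<noteq> {}" "\<And>u. u \<in> S \<Longrightarrow> e \<le> u"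
  shows "\<exists>m\<in>S. \<forall>u\<in>S. m \<le> u"
proof -
  obtain v where v: "v \<in> S" using assms(1) by blast
  have "finite (S \<inter> {e..v})" "S \<inter> {e..v} \<noteq> {}" using v assms(2) by auto
  then have *: "Min (S \<inter> {e..v}) \<in> S \<inter> {e..v}" "\<And>u. u \<in> S \<inter> {e..v} \<Longrightarrow> Min (S \<inter> {e..v}) \<le> u"
    by (auto intro: Min_in Min_le simp del: Int_iff)
  have "Min (S \<inter> {e..v}) \<le> u" if "u \<in> S" for u
    using *(2)[of u] *(1) that assms(2)[OF that] by (cases "u \<le> v") auto
  then show ?thesis using *(1) by blast
qed

lemma (in module) ass_nonempty:
  assumes "noetherian_ring R" and A: "submodule A R M" and V: "submodule V R M" and ne: "\<not> A \<subseteq> V"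
  shows "\<exists>p. p \<in> ass A V"
proof -
  note Ac = submodule_carrier[OF A]
  let ?S = "{res V x | x. x \<in> A \<and> x \<notin> V}"
  have "?S \<noteq> {}" using ne by blast
  moreover have "ideal I R" if I: "I \<in> ?S" for I
  proof -
    obtain x where "x \<in> A" "I = res V x" using I by blast
    then show ?thesis using res_ideal[OF V Ac] by simp
  qed
  ultimately have "\<exists>I\<in>?S. \<forall>I'\<in>?S. I \<subseteq> I' \<longrightarrow> I' = I" by (rule ideal_set_maximal[OF assms(1)])
  then obtain p where p: "p \<in> ?S" and pm: "\<forall>I'\<in>?S. p \<subseteq> I' \<longrightarrow> I' = p" by (rule bexE)
  obtain x where x: "x \<in> A" "x \<notin> V" "p = res V x" using p by blast
  have xc: "x \<in> carrier M" by (rule Ac[OF x(1)])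
  have "primeideal p R"
  proof (rule primeidealI)
    show "ideal p R" unfolding x(3) by (rule res_ideal[OF V xc])
    show "cring R" by (rule R.is_cring)
    have "\<one> \<notin> p" using x xc by (simp add: res_mem)
    then show "carrier R \<noteq> p" by blast
    fix a b assume ab: "a \<in> carrier R" "b \<in> carrier R" "a \<otimes> b \<in> p"
    show "a \<in> p \<or> b \<in> p"
    proof (rule disjCI)
      assume b: "b \<notin> p"
      then have bV: "b \<odot>\<^bsub>M\<^esub> x \<notin> V" using ab x by (simp add: res_mem)
      have "p \<subseteq> res V (b \<odot>\<^bsub>M\<^esub> x)"
      proof
        fix s assume s: "s \<in> p"
        then have sc: "s \<in> carrier R" using x(3) by (simp add: res_mem)
        have "b \<odot>\<^bsub>M\<^esub> (s \<odot>\<^bsub>M\<^esub> x) \<in> V" using s x(3) submoduleE(4)[OF V ab(2)] by (simp add: res_mem)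
        then show "s \<in> res V (b \<odot>\<^bsub>M\<^esub> x)"
          using sc ab xc by (simp add: res_mem smult_assoc1[symmetric] R.m_comm)
      qed
      moreover have "b \<odot>\<^bsub>M\<^esub> x \<in> A" by (rule submoduleE(4)[OF A ab(2) x(1)])
      ultimately have "res V (b \<odot>\<^bsub>M\<^esub> x) = p" using pm bV by blast
      moreover have "a \<in> res V (b \<odot>\<^bsub>M\<^esub> x)" using ab xc x(3) by (simp add: res_mem smult_assoc1)
      ultimately show "a \<in> p" by simp
    qed
  qed
  then show ?thesis using x by (auto simp: ass_def)
qed

locale graded_module_seq = graded_module R Rgr M Mgr + noeth_module_seq R M y c
  for R (structure) and Rgr and M (structure) and Mgr and y c +
  fixes dy :: "nat \<Rightarrow> nat"
  assumes y_homog: "\<And>j. j \<in> {1..c} \<Longrightarrow> y j \<in> Rgr (dy j)" and dy_mono: "mono_on {1..c} dy"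
begin

text \<open>Scalars have degrees in \<open>nat\<close>, so the elements without components below
  \<open>e\<close> form a submodule. For \<open>e\<close> below all degrees occurring in finitely
  many generators, this submodule is everything.\<close>

lemma degrees_bounded_below: "\<exists>e. \<forall>u<e. \<forall>x\<in>carrier M. hM x u = \<zero>\<^bsub>M\<^esub>"
proof -
  obtain S where S: "finite S" "S \<subseteq> carrier M" "gen_submodule R M S = carrier M"
    using fin_gen unfolding fin_gen_module_def by blast
  let ?T = "\<Union>s\<in>S. {u. hM s u \<noteq> \<zero>\<^bsub>M\<^esub>}"
  have "finite ?T" using S Mg.hcomp_finite by (auto intro!: finite_UN_I)
  then obtain e where e: "\<And>u. u \<in> ?T \<Longrightarrow> e \<le> u" by (metis (no_types, lifting) Min_le)
  define Q where "Q u = (if u < e then {\<zero>\<^bsub>M\<^esub>} else Mgr u)" for u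
  have "gsub {x \<in> carrier M. \<forall>u. hM x u \<in> Q u}"
  proof (rule gsub_of_graded)
    show "r \<odot>\<^bsub>M\<^esub> x \<in> Q (int k + u)" if "r \<in> Rgr k" "x \<in> Q u" for k u r x
      using that smult_graded[of r k x u] Rg.C_carrier[OF that(1)] Mg.C_zero
      by (auto simp: Q_def split: if_splits)
    show "a \<oplus>\<^bsub>M\<^esub> b \<in> Q u" if "a \<in> Q u" "b \<in> Q u" for u a b
      using that additive_subgroup.a_closed[OF Mg.C_subgroup] by (auto simp: Q_def split: if_splits)
  qed (auto simp: Q_def Mg.C_zero)
  then have "submodule {x \<in> carrier M. \<forall>u. hM x u \<in> Q u} R M" by (rule gsubD)
  then have "carrier M \<subseteq> {x \<in> carrier M. \<forall>u. hM x u \<in> Q u}"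
    unfolding S(3)[symmetric]
  proof (rule gen_submodule_least)
    show "S \<subseteq> {x \<in> gen_submodule R M S. \<forall>u. hM x u \<in> Q u}"
    proof
      fix s assume s: "s \<in> S"
      then have sc: "s \<in> carrier M" using S by blast
      have "hM s u \<in> Q u" for u
      proof (cases "u < e")
        case True
        then have "u \<notin> ?T" using e[of u] by linarith
        then show ?thesis using s by (simp add: Q_def True)
      next
        case False
        then show ?thesis using Mg.hcomp_mem[OF sc, of u] by (simp add: Q_def)
      qed
      then show "s \<in> {x \<in> gen_submodule R M S. \<forall>u. hM x u \<in> Q u}" using sc S(3) by simp
    qed
  qed
  then have Qm: "hM x u \<in> Q u" if "x \<in> carrier M" for x u using that by blast
  have "hM x u = \<zero>\<^bsub>M\<^esub>" if "u < e" "x \<in> carrier M" for x u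
    using Qm[OF that(2), of u] that(1) by (simp add: Q_def)
  then show ?thesis by blast
qed

section \<open>Degrees and torsion of graded stable sequences\<close>

definition gseq :: "(nat \<Rightarrow> 'c set) \<Rightarrow> bool"
  where "gseq A \<longleftrightarrow> stable_seq A \<and> (\<forall>n. gsub (A n))"

lemma gseqD: "gseq A \<Longrightarrow> stable_seq A" "gseq A \<Longrightarrow> gsub (A n)" "gseq A \<Longrightarrow> submodule (A n) R M"
  by (auto simp: gseq_def dest: gsubD)

lemma gseqI:
  "(\<And>n. gsub (A n)) \<Longrightarrow> (\<And>n j x. j \<in> {1..c} \<Longrightarrow> x \<in> A n \<Longrightarrow> y j \<odot>\<^bsub>M\<^esub> x \<in> A (Suc n)) \<Longrightarrow> gseq A"
  by (auto simp: gseq_def stable_seq_def dest: gsubD)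

text \<open>The least element of this set, if there is one, is the initial degree of
  \<open>A n / B n\<close>.\<close>

definition degs :: "(nat \<Rightarrow> 'c set) \<Rightarrow> (nat \<Rightarrow> 'c set) \<Rightarrow> nat \<Rightarrow> int set"
  where "degs A B n = {u. \<not> A n \<inter> Mgr u \<subseteq> B n}"

lemma degs_union:
  assumes "B \<le> C" "C \<le> A"
  shows "degs A B n = degs A C n \<union> degs C B n"
  using assms unfolding degs_def le_fun_def by blast

lemma degs_bounded_below: "\<exists>e. \<forall>A B n. gseq B \<longrightarrow> (\<forall>u\<in>degs A B n. e \<le> u)"
proof -
  obtain e where e: "\<And>u x. u < e \<Longrightarrow> x \<in> carrier M \<Longrightarrow> hM x u = \<zero>\<^bsub>M\<^esub>"
    using degrees_bounded_below by blast
  have "e \<le> u" if B: "gseq B" and u: "u \<in> degs A B n" for A B n u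
  proof (rule ccontr)
    assume "\<not> e \<le> u"
    have "x \<in> B n" if x: "x \<in> Mgr u" for x
    proof -
      have "x = hM x u" by (simp add: Mg.hcomp_homog[OF x])
      also have "\<dots> = \<zero>\<^bsub>M\<^esub>" using e[of u x] \<open>\<not> e \<le> u\<close> Mg.C_carrier[OF x] by simp
      finally show ?thesis using submodule_zero[OF gseqD(3)[OF B]] by simp
    qed
    then show False using u by (auto simp: degs_def)
  qed
  then show ?thesis by blast
qed

abbreviation ypow :: "nat \<Rightarrow> nat \<Rightarrow> 'c \<Rightarrow> 'c"
  where "ypow j k \<equiv> (\<lambda>x. y j \<odot>\<^bsub>M\<^esub> x) ^^ k"

lemma ypow_closed: "j \<in> {1..c} \<Longrightarrow> x \<in> carrier M \<Longrightarrow> ypow j k x \<in> carrier M"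
  by (induct k) (auto simp: y_closed)

lemma ypow_add: "j \<in> {1..c} \<Longrightarrow> x \<in> carrier M \<Longrightarrow> z \<in> carrier M \<Longrightarrow> ypow j k (x \<oplus>\<^bsub>M\<^esub> z) = ypow j k x \<oplus>\<^bsub>M\<^esub> ypow j k z"
  by (induct k) (auto simp: y_closed ypow_closed smult_r_distr)

lemma ypow_zero: "j \<in> {1..c} \<Longrightarrow> ypow j k \<zero>\<^bsub>M\<^esub> = \<zero>\<^bsub>M\<^esub>"
  by (induct k) (auto simp: y_closed)

lemma ypow_smult:
  assumes "j \<in> {1..c}" "x \<in> carrier M" "r \<in> carrier R"
  shows "ypow j k (r \<odot>\<^bsub>M\<^esub> x) = r \<odot>\<^bsub>M\<^esub> ypow j k x"
proof (induct k)
  case (Suc k)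
  then show ?case using assms y_closed[OF assms(1)] ypow_closed[OF assms(1,2), of k]
    by (simp add: smult_assoc1[symmetric] m_comm)
qed simp

lemma ypow_stable: "stable_seq A \<Longrightarrow> j \<in> {1..c} \<Longrightarrow> x \<in> A n \<Longrightarrow> ypow j k x \<in> A (n + k)"
  by (induct k) (auto dest: stable_seqD(2))

lemma ypow_degree:
  assumes "j \<in> {1..c}" "x \<in> Mgr u"
  shows "ypow j k x \<in> Mgr (int k * int (dy j) + u)"
proof (induct k)
  case 0 then show ?case using assms by simp
next
  case (Suc k)
  show ?case using smult_graded[OF y_homog[OF assms(1)] Suc] by (simp add: algebra_simps)
qed

lemma ypow_hM:
  assumes j: "j \<in> {1..c}" and x: "x \<in> carrier M"
  shows "ypow j k (hM x u) = hM (ypow j k x) (int k * int (dy j) + u)"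
proof (induct k)
  case (Suc k)
  then show ?case using hM_smult[OF y_homog[OF j] ypow_closed[OF j x, of k]] by (simp add: algebra_simps)
qed simp

text \<open>Nilpotency of \<open>y j\<close>, as an element of degree one of the Rees algebra, on
  the direct sum of the quotients \<open>A n / B n\<close>: one exponent has to serve all
  \<open>n\<close>.\<close>

definition nilp :: "(nat \<Rightarrow> 'c set) \<Rightarrow> (nat \<Rightarrow> 'c set) \<Rightarrow> nat \<Rightarrow> bool"
  where "nilp A B j \<longleftrightarrow> (\<exists>k. \<forall>n. \<forall>x\<in>A n. ypow j k x \<in> B (n + k))"

definition tors :: "(nat \<Rightarrow> 'c set) \<Rightarrow> (nat \<Rightarrow> 'c set) \<Rightarrow> nat \<Rightarrow> nat \<Rightarrow> nat \<Rightarrow> 'c set"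
  where "tors A B j k n = {x \<in> A n. ypow j k x \<in> B (n + k)}"

lemma tors_gseq:
  assumes A: "gseq A" and B: "gseq B" and j: "j \<in> {1..c}"
  shows "gseq (tors A B j k)"
proof (rule gseqI)
  note As = gseqD(3)[OF A] and Bs = gseqD(3)[OF B]
  note Ac = submodule_carrier[OF As]
  fix n
  have "submodule (tors A B j k n) R M"
  proof (rule submoduleI')
    show "tors A B j k n \<subseteq> carrier M" using Ac by (auto simp: tors_def)
    show "\<zero>\<^bsub>M\<^esub> \<in> tors A B j k n" using submodule_zero[OF As] submodule_zero[OF Bs] by (simp add: tors_def ypow_zero[OF j])
    show "a \<oplus>\<^bsub>M\<^esub> b \<in> tors A B j k n" if "a \<in> tors A B j k n" "b \<in> tors A B j k n" for a b
      using that submoduleE(5)[OF As] submoduleE(5)[OF Bs] by (simp add: tors_def ypow_add[OF j Ac[of a n] Ac[of b n]])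
    show "a \<odot>\<^bsub>M\<^esub> x \<in> tors A B j k n" if "a \<in> carrier R" "x \<in> tors A B j k n" for a x
      using that submoduleE(4)[OF As] submoduleE(4)[OF Bs] by (simp add: tors_def ypow_smult[OF j Ac[of x n]])
  qed
  moreover have "hM x u \<in> tors A B j k n" if x: "x \<in> tors A B j k n" for x u
  proof -
    have xA: "x \<in> A n" and xB: "ypow j k x \<in> B (n + k)" using x by (simp_all add: tors_def)
    have "ypow j k (hM x u) \<in> B (n + k)"
      unfolding ypow_hM[OF j Ac[OF xA]] by (rule gsubD(2)[OF gseqD(2)[OF B] xB])
    then show ?thesis using gsubD(2)[OF gseqD(2)[OF A] xA] by (simp add: tors_def)
  qed
  ultimately show "gsub (tors A B j k n)" by (simp add: gsub_def)
  fix i x assume i: "i \<in> {1..c}" and x: "x \<in> tors A B j k n"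
  then have "ypow j k (y i \<odot>\<^bsub>M\<^esub> x) = y i \<odot>\<^bsub>M\<^esub> ypow j k x" using Ac by (intro ypow_smult j y_closed) (auto simp: tors_def)
  then show "y i \<odot>\<^bsub>M\<^esub> x \<in> tors A B j k (Suc n)"
    using x stable_seqD(2)[OF gseqD(1)[OF A] i] stable_seqD(2)[OF gseqD(1)[OF B] i] by (simp add: tors_def)
qed

lemma tors_0: "B \<le> A \<Longrightarrow> tors A B j 0 = B"
  by (auto simp: tors_def le_fun_def fun_eq_iff)

lemma tors_le: "tors A B j k \<le> A"
  by (auto simp: tors_def le_fun_def)

lemma tors_Suc: "stable_seq B \<Longrightarrow> j \<in> {1..c} \<Longrightarrow> tors A B j k \<le> tors A B j (Suc k)"
  by (auto simp: tors_def le_fun_def dest: stable_seqD(2))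

lemma tors_mono: "stable_seq B \<Longrightarrow> j \<in> {1..c} \<Longrightarrow> k \<le> k' \<Longrightarrow> tors A B j k \<le> tors A B j k'"
  by (rule seq_mono[of "tors A B j"]) (rule tors_Suc)

lemma le_tors: "stable_seq B \<Longrightarrow> j \<in> {1..c} \<Longrightarrow> B \<le> A \<Longrightarrow> B \<le> tors A B j k"
  using tors_mono[of B j 0 k A] by (simp add: tors_0)

lemma tors_stable:
  assumes "noeth_seq A" "gseq A" "gseq B" "j \<in> {1..c}"
  shows "\<exists>K. \<forall>k\<ge>K. tors A B j k = tors A B j K"
  by (rule noeth_seq_chain[OF assms(1), of "tors A B j"])
    (use assms tors_gseq tors_Suc tors_le gseqD in auto)

text \<open>The component of \<open>y j b\<close> in degree \<open>u\<close> involves only the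
  component of \<open>b\<close> in degree \<open>u - dy j\<close>.\<close>

lemma lin_comb_hM:
  assumes H: "gsub H" and B: "submodule B R M"
    and zero: "\<And>j b. j \<in> {1..c} \<Longrightarrow> b \<in> H \<inter> Mgr (u - int (dy j)) \<Longrightarrow> y j \<odot>\<^bsub>M\<^esub> b \<in> B"
  shows "k \<le> c \<Longrightarrow> x \<in> lin_comb M y H k \<Longrightarrow> hM x u \<in> B"
proof (induct k arbitrary: x)
  case 0 then show ?case using submodule_zero[OF B] by simp
next
  case (Suc k)
  note Hs = gsubD(1)[OF H]
  obtain a b where e: "a \<in> lin_comb M y H k" "b \<in> H" "x = a \<oplus>\<^bsub>M\<^esub> y (Suc k) \<odot>\<^bsub>M\<^esub> b" using Suc(3) by auto
  have j: "Suc k \<in> {1..c}" using Suc(2) by simp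
  have bc: "b \<in> carrier M" using submodule_carrier[OF Hs e(2)] .
  have ac: "a \<in> carrier M" using lin_comb_carrier[OF Hs _ e(1)] Suc(2) by simp
  have "hM x u = hM a u \<oplus>\<^bsub>M\<^esub> y (Suc k) \<odot>\<^bsub>M\<^esub> hM b (u - int (dy (Suc k)))"
    unfolding e(3) using ac bc y_closed[OF j] by (simp add: Mg.hcomp_add hM_smult[OF y_homog[OF j] bc])
  moreover have "hM a u \<in> B" using Suc(1)[OF _ e(1)] Suc(2) by simp
  moreover have "y (Suc k) \<odot>\<^bsub>M\<^esub> hM b (u - int (dy (Suc k))) \<in> B"
    by (rule zero[OF j]) (use gsubD(2)[OF H e(2)] Mg.hcomp_mem[OF bc] in blast)
  ultimately show ?case using submoduleE(5)[OF B] by simp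
qed

text \<open>Every degree at index \<open>n + 1\<close> arises from one at index \<open>n\<close>
  through a generator that does not act as zero there. Lower bounds for the growth of initial
  degrees rest on this.\<close>

lemma degs_step:
  assumes H: "gseq A" and B: "gseq B" and gen: "A (Suc n) = lin_comb M y (A n) c"
    and u: "u \<in> degs A B (Suc n)"
  shows "\<exists>j\<in>{1..c}. \<exists>b\<in>A n \<inter> Mgr (u - int (dy j)). y j \<odot>\<^bsub>M\<^esub> b \<notin> B (Suc n)"
proof (rule ccontr)
  assume neg: "\<not> ?thesis"
  obtain x where x: "x \<in> A (Suc n)" "x \<in> Mgr u" "x \<notin> B (Suc n)" using u by (auto simp: degs_def)
  have "hM x u \<in> B (Suc n)"
    by (rule lin_comb_hM[OF gseqD(2)[OF H] gseqD(3)[OF B] _ le_refl]) (use neg x(1) gen in blast)+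
  then show False using x by (simp add: Mg.hcomp_homog[OF x(2)])
qed

text \<open>On a quotient where \<open>y j\<close> acts injectively and all generators of smaller degree act as zero,
  the initial degree grows by exactly \<open>dy j\<close> in each step.\<close>

lemma degs_linear_injective:
  assumes noeth: "noeth_seq A" and A: "gseq A" and B: "gseq B" and j: "j \<in> {1..c}"
    and zero: "\<And>i n x. i \<in> {1..<j} \<Longrightarrow> x \<in> A n \<Longrightarrow> y i \<odot>\<^bsub>M\<^esub> x \<in> B (Suc n)"
    and inj: "\<And>n x. x \<in> A n \<Longrightarrow> y j \<odot>\<^bsub>M\<^esub> x \<in> B (Suc n) \<Longrightarrow> x \<in> B n"
    and ne: "\<not> A m \<subseteq> B m"
  shows "lin_min (degs A B) (dy j)"
proof -
  obtain n1 where n1: "\<And>n. n \<ge> n1 \<Longrightarrow> A (Suc n) = lin_comb M y (A n) c"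
    using noeth_seq_generated[OF noeth] by blast
  have up: "u + int (dy j) \<in> degs A B (Suc n)" if u: "u \<in> degs A B n" for u n
  proof -
    obtain x where x: "x \<in> A n" "x \<in> Mgr u" "x \<notin> B n" using u by (auto simp: degs_def)
    have "y j \<odot>\<^bsub>M\<^esub> x \<in> Mgr (u + int (dy j))" using smult_graded[OF y_homog[OF j] x(2)] by (simp add: add.commute)
    moreover have "y j \<odot>\<^bsub>M\<^esub> x \<in> A (Suc n)" by (rule stable_seqD(2)[OF gseqD(1)[OF A] j x(1)])
    moreover have "y j \<odot>\<^bsub>M\<^esub> x \<notin> B (Suc n)" using inj x by blast
    ultimately show ?thesis by (auto simp: degs_def)
  qed
  \<comment> \<open>A generator \<open>y i\<close> with \<open>y i b\<close> outside
    \<open>B\<close> has \<open>i \<ge> j\<close> by \<open>zero\<close>, so it raises the degree by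
    at least \<open>dy j\<close>; and \<open>b\<close> itself is outside \<open>B n\<close> by
    stability.\<close>
  have down: "\<exists>v\<in>degs A B n. v + int (dy j) \<le> u" if n: "n \<ge> n1" and u: "u \<in> degs A B (Suc n)" for u n
  proof -
    obtain i b where i: "i \<in> {1..c}" "b \<in> A n" "b \<in> Mgr (u - int (dy i))" "y i \<odot>\<^bsub>M\<^esub> b \<notin> B (Suc n)"
      using degs_step[OF A B n1[OF n] u] by blast
    then have "i \<notin> {1..<j}" using zero by blast
    then have "dy j \<le> dy i" using i(1) j mono_onD[OF dy_mono, of j i] by simp
    moreover have "b \<notin> B n" using i stable_seqD(2)[OF gseqD(1)[OF B]] by blast
    then have "u - int (dy i) \<in> degs A B n" using i by (auto simp: degs_def)
    ultimately show ?thesis by force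
  qed
  obtain x where x: "x \<in> A m" "x \<notin> B m" using ne by blast
  have xc: "x \<in> carrier M" by (rule submodule_carrier[OF gseqD(3)[OF A] x(1)])
  obtain u where "hM x u \<notin> B m" using mem_submodule_if_hM[OF gseqD(3)[OF B] xc] x(2) by blast
  then have "u \<in> degs A B m"
    using gsubD(2)[OF gseqD(2)[OF A] x(1)] Mg.hcomp_mem[OF xc] by (auto simp: degs_def)
  then have ne0: "degs A B m \<noteq> {}" by blast
  have nonempty: "degs A B n \<noteq> {}" if "n \<ge> m" for n
    using that
  proof (induct n rule: dec_induct)
    case base show ?case by (rule ne0)
  next
    case (step n) then show ?case using up by blast
  qed
  obtain e where e: "\<And>u n. u \<in> degs A B n \<Longrightarrow> e \<le> u" using degs_bounded_below B by blast
  \<comment> \<open>From \<open>m\<close> on the degree sets are nonempty, and from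
    \<open>n1\<close> on \<open>A\<close> is generated by its predecessor.\<close>
  define n2 where "n2 = max m n1"
  obtain f where f: "f \<in> degs A B n2" "\<And>u. u \<in> degs A B n2 \<Longrightarrow> f \<le> u"
    using int_set_least[OF nonempty[of n2], of e] e unfolding n2_def by auto
  have main: "f + int (dy j) * (int n - int n2) \<in> degs A B n \<and>
      (\<forall>u\<in>degs A B n. f + int (dy j) * (int n - int n2) \<le> u)" if n: "n \<ge> n2" for n
    using n
  proof (induct n rule: dec_induct)
    case base then show ?case using f by simp
  next
    case (step n)
    let ?g = "f + int (dy j) * (int n - int n2)"
    have g: "f + int (dy j) * (int (Suc n) - int n2) = ?g + int (dy j)" by (simp add: algebra_simps)
    have "?g + int (dy j) \<le> u" if u: "u \<in> degs A B (Suc n)" for u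
    proof -
      obtain v where "v \<in> degs A B n" "v + int (dy j) \<le> u" using down[OF _ u] step(1) unfolding n2_def by auto
      then show ?thesis using step by force
    qed
    then show ?case unfolding g using up step by blast
  qed
  have "\<forall>\<^sub>F n in sequentially. int (dy j) * int n + (f - int (dy j) * int n2) \<in> degs A B n \<and>
      (\<forall>u\<in>degs A B n. int (dy j) * int n + (f - int (dy j) * int n2) \<le> u)"
    unfolding eventually_sequentially
  proof (intro exI allI impI)
    fix n assume n: "n2 \<le> n"
    have "int (dy j) * int n + (f - int (dy j) * int n2) = f + int (dy j) * (int n - int n2)"
      by (simp add: algebra_simps)
    then show "int (dy j) * int n + (f - int (dy j) * int n2) \<in> degs A B n \<and>
      (\<forall>u\<in>degs A B n. int (dy j) * int n + (f - int (dy j) * int n2) \<le> u)" using main[OF n] by presburger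
  qed
  then show ?thesis unfolding lin_min_def by blast
qed

text \<open>Induction on the number \<open>l\<close> of generators acting as zero: the \<open>y (Suc l)\<close>-torsion is filtered with
  quotients killed by \<open>y (Suc l)\<close>, and \<open>y (Suc l)\<close> is injective modulo torsion.\<close>

lemma degs_linear_aux:
  assumes "noeth_seq A" "gseq A" "gseq B" "B \<le> A" "l \<le> c"
    and "\<And>i n x. i \<in> {1..l} \<Longrightarrow> x \<in> A n \<Longrightarrow> y i \<odot>\<^bsub>M\<^esub> x \<in> B (Suc n)"
  shows "lin_or_empty (degs A B) (dy ` {i \<in> {1..c}. \<not> nilp A B i})"
  using assms
proof (induct "c - l" arbitrary: l A B)
  case 0
  then have l: "l = c" by simp
  obtain n1 where n1: "\<And>n. n \<ge> n1 \<Longrightarrow> A (Suc n) = lin_comb M y (A n) c"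
    using noeth_seq_generated[OF 0(2)] by blast
  \<comment> \<open>All generators act as zero here, so beyond \<open>n1\<close> the sequence
    \<open>A\<close> is contained in \<open>B\<close>.\<close>
  have "degs A B (Suc n) = {}" if "n \<ge> n1" for n
  proof -
    have "lin_comb M y (A n) c \<subseteq> B (Suc n)" by (rule lin_comb_least[OF gseqD(3)[OF 0(4)] 0(7)]) (use l in auto)
    then show ?thesis using n1[OF that] by (auto simp: degs_def)
  qed
  then have "degs A B n = {}" if "n \<ge> Suc n1" for n using that by (cases n) auto
  then show ?case unfolding lin_or_empty_def eventually_sequentially by blast
next
  case (Suc d)
  note noeth = Suc(3) and A = Suc(4) and B = Suc(5) and BA = Suc(6) and zero = Suc(8)
  let ?j = "Suc l" and ?D = "dy ` {i \<in> {1..c}. \<not> nilp A B i}"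
  have j: "?j \<in> {1..c}" using Suc(2) by simp
  let ?F = "tors A B ?j"
  note Bst = gseqD(1)[OF B]
  note BF = le_tors[OF Bst j BA]
  have Fg: "gseq (?F k)" for k by (rule tors_gseq[OF A B j])
  have Fn: "noeth_seq (?F k)" for k by (rule noeth_seq_subset[OF noeth gseqD(1)[OF Fg] tors_le])
  have layer: "lin_or_empty (degs (?F (Suc k)) (?F k)) ?D" for k
  proof -
    have "lin_or_empty (degs (?F (Suc k)) (?F k)) (dy ` {i \<in> {1..c}. \<not> nilp (?F (Suc k)) (?F k) i})"
    proof (rule Suc(1)[of ?j])
      show "d = c - ?j" using Suc(2) by simp
      show "?j \<le> c" using j by simp
      show "?F k \<le> ?F (Suc k)" by (rule tors_Suc[OF Bst j])
      fix i n x assume i: "i \<in> {1..?j}" and x: "x \<in> ?F (Suc k) n"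
      show "y i \<odot>\<^bsub>M\<^esub> x \<in> ?F k (Suc n)"
      proof (cases "i = ?j")
        case True
        then show ?thesis using x stable_seqD(2)[OF gseqD(1)[OF A] j] by (simp add: tors_def funpow_swap1)
      next
        case False
        then have "i \<in> {1..l}" using i by auto
        then have "y i \<odot>\<^bsub>M\<^esub> x \<in> B (Suc n)" by (rule zero) (use x in \<open>simp add: tors_def\<close>)
        then show ?thesis using BF[of k] by (auto simp: le_fun_def)
      qed
    qed (rule Fn Fg)+
    \<comment> \<open>Nilpotency on \<open>A/B\<close> passes to each layer, so the layers
      contribute no slope outside \<open>?D\<close>.\<close>
    moreover have "nilp (?F (Suc k)) (?F k) i" if nil: "nilp A B i" for i
    proof -
      obtain t where t: "\<And>n x. x \<in> A n \<Longrightarrow> ypow i t x \<in> B (n + t)" using nil unfolding nilp_def by blast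
      have "ypow i t x \<in> ?F k (n + t)" if x: "x \<in> ?F (Suc k) n" for x n
      proof -
        have "x \<in> A n" using x by (simp add: tors_def)
        then show ?thesis using t BF[of k] by (auto simp: le_fun_def)
      qed
      then show ?thesis unfolding nilp_def by blast
    qed
    then have "dy ` {i \<in> {1..c}. \<not> nilp (?F (Suc k)) (?F k) i} \<subseteq> ?D" by blast
    ultimately show ?thesis by (rule lin_or_empty_mono)
  qed
  have tor: "lin_or_empty (degs (?F k) B) ?D" for k
  proof (induct k)
    case 0
    have "degs (?F 0) B n = {}" for n by (simp add: tors_0[OF BA] degs_def)
    then show ?case by (simp add: lin_or_empty_def)
  next
    case (Suc k)
    have "degs (?F (Suc k)) B = (\<lambda>n. degs (?F (Suc k)) (?F k) n \<union> degs (?F k) B n)"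
      using degs_union[OF BF tors_Suc[OF Bst j]] by blast
    then show ?case using lin_or_empty_union[OF layer Suc] by simp
  qed
  obtain K where K: "\<And>k. k \<ge> K \<Longrightarrow> ?F k = ?F K" using tors_stable[OF noeth A B j] by blast
  have top: "lin_or_empty (degs A (?F K)) ?D"
  proof (cases "\<exists>m. \<not> A m \<subseteq> ?F K m")
    case False
    then have "degs A (?F K) n = {}" for n by (auto simp: degs_def)
    then show ?thesis by (simp add: lin_or_empty_def)
  next
    case True
    then obtain m where m: "\<not> A m \<subseteq> ?F K m" by blast
    have "lin_min (degs A (?F K)) (dy ?j)"
    proof (rule degs_linear_injective[OF noeth A Fg j _ _ m])
      show "y i \<odot>\<^bsub>M\<^esub> x \<in> ?F K (Suc n)" if "i \<in> {1..<?j}" "x \<in> A n" for i n x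
      proof -
        have "y i \<odot>\<^bsub>M\<^esub> x \<in> B (Suc n)" by (rule zero) (use that in auto)
        then show ?thesis using BF[of K] by (auto simp: le_fun_def)
      qed
      show "x \<in> ?F K n" if "x \<in> A n" "y ?j \<odot>\<^bsub>M\<^esub> x \<in> ?F K (Suc n)" for n x
      proof -
        have "x \<in> ?F (Suc K) n" using that by (simp add: tors_def funpow_swap1)
        then show ?thesis using K[of "Suc K"] by simp
      qed
    qed
    \<comment> \<open>If \<open>y (Suc l)\<close> were nilpotent, all of \<open>A\<close> would be
      torsion, against the choice of \<open>m\<close>.\<close>
    moreover have "\<not> nilp A B ?j"
    proof
      assume "nilp A B ?j"
      then obtain t where t: "\<And>n x. x \<in> A n \<Longrightarrow> ypow ?j t x \<in> B (n + t)" unfolding nilp_def by blast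
      then have "A m \<subseteq> ?F t m" by (auto simp: tors_def)
      also have "?F t \<le> ?F (max t K)" by (rule tors_mono[OF Bst j]) simp
      then have "?F t m \<subseteq> ?F (max t K) m" by (simp add: le_fun_def)
      also have "?F (max t K) = ?F K" by (rule K) simp
      finally show False using m by simp
    qed
    ultimately show ?thesis using j unfolding lin_or_empty_def by blast
  qed
  have "degs A B = (\<lambda>n. degs A (?F K) n \<union> degs (?F K) B n)"
    using degs_union[OF BF tors_le] by blast
  then show ?case using lin_or_empty_union[OF top tor] by simp
qed

lemma degs_linear:
  assumes "noeth_seq A" "gseq A" "gseq B" "B \<le> A"
  shows "lin_or_empty (degs A B) (dy ` {i \<in> {1..c}. \<not> nilp A B i})"
  by (rule degs_linear_aux[OF assms, of 0]) auto

text \<open>A generator that is not nilpotent is injective modulo its torsion, so any associated prime of that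
  quotient is attained along the orbit of a homogeneous element.\<close>

lemma not_nilp_ass:
  assumes noeth: "noeth_seq A" and A: "gseq A" and B: "gseq B" and j: "j \<in> {1..c}" and nn: "\<not> nilp A B j"
  shows "\<exists>p b n0. primeideal p R \<and> (\<forall>n\<ge>n0. \<exists>x\<in>A n \<inter> Mgr (int (dy j) * int n + b). p = res (B n) x)"
proof -
  let ?F = "tors A B j"
  obtain K where K: "\<And>k. k \<ge> K \<Longrightarrow> ?F k = ?F K" using tors_stable[OF noeth A B j] by blast
  have Fg: "gseq (?F K)" by (rule tors_gseq[OF A B j])
  have "\<exists>n. \<not> A n \<subseteq> ?F K n" using nn unfolding nilp_def tors_def by blast
  then obtain m where "\<not> A m \<subseteq> ?F K m" by blast
  then obtain p where "p \<in> ass (A m) (?F K m)"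
    using ass_nonempty[OF noetherian gseqD(3)[OF A] gseqD(3)[OF Fg]] by blast
  then obtain z where p: "primeideal p R" "z \<in> A m" "p = res (?F K m) z" by (auto simp: ass_def)
  have zc: "z \<in> carrier M" by (rule submodule_carrier[OF gseqD(3)[OF A] p(2)])
  obtain u where u: "p = res (?F K m) (hM z u)" using graded_ass[OF gseqD(2)[OF Fg] p(1) zc p(3)] by blast
  let ?w = "hM z u"
  have w: "?w \<in> A m" "?w \<in> Mgr u" "?w \<in> carrier M"
    using gsubD(2)[OF gseqD(2)[OF A] p(2)] Mg.hcomp_mem[OF zc] zc by auto
  have "\<exists>x\<in>A n \<inter> Mgr (int (dy j) * int n + (u - int (dy j) * int m)). p = res (B n) x" if n: "n \<ge> m + K" for n
  proof -
    define k where "k = n - m"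
    have k: "n = m + k" "k \<ge> K" using n by (auto simp: k_def)
    have "ypow j k ?w \<in> A n" using ypow_stable[OF gseqD(1)[OF A] j w(1)] k by simp
    moreover have "int k * int (dy j) + u = int (dy j) * int n + (u - int (dy j) * int m)"
      using k by (simp add: algebra_simps)
    then have "ypow j k ?w \<in> Mgr (int (dy j) * int n + (u - int (dy j) * int m))"
      using ypow_degree[OF j w(2), of k] by (simp only:)
    \<comment> \<open>By definition of torsion, \<open>r\<close> kills \<open>y j^k w\<close> modulo
      \<open>B\<close> exactly if \<open>r w\<close> is torsion of level \<open>k\<close>. For
      \<open>k \<ge> K\<close> this is torsion of level \<open>K\<close>, so the annihilator stays
      equal to \<open>p\<close>.\<close>
    moreover have "res (B n) (ypow j k ?w) = p"
    proof -
      have "r \<odot>\<^bsub>M\<^esub> ypow j k ?w \<in> B n \<longleftrightarrow> r \<odot>\<^bsub>M\<^esub> ?w \<in> ?F K m" if r: "r \<in> carrier R" for r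
      proof -
        have "r \<odot>\<^bsub>M\<^esub> ypow j k ?w \<in> B n \<longleftrightarrow> r \<odot>\<^bsub>M\<^esub> ?w \<in> ?F k m"
          using ypow_smult[OF j w(3) r, of k] submoduleE(4)[OF gseqD(3)[OF A] r w(1)] k(1) by (simp add: tors_def)
        then show ?thesis using K[OF k(2)] by simp
      qed
      then show ?thesis unfolding u by (auto simp: res_def)
    qed
    ultimately show ?thesis by (intro bexI[of _ "ypow j k ?w"]) auto
  qed
  then show ?thesis using p(1) by blast
qed

lemma ann_degs_linear:
  assumes noeth: "noeth_seq A" and A: "gseq A" and B: "gseq B" and BA: "B \<le> A"
    and p: "primeideal p R" and ph: "\<And>r i. r \<in> p \<Longrightarrow> hR r i \<in> p"
  shows "lin_or_empty (\<lambda>n. {u. \<exists>x\<in>A n \<inter> Mgr u. p = res (B n) x}) (dy ` {1..c})"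
proof -
  note pD = primeD[OF p]
  note As = gseqD(3)[OF A] and Bs = gseqD(3)[OF B]
  note Ac = submodule_carrier[OF As]
  define W where "W = (\<lambda>n. {w \<in> A n. \<forall>r\<in>p. r \<odot>\<^bsub>M\<^esub> w \<in> B n})"
  have Wst: "stable_seq W" unfolding W_def by (rule stable_colon[OF gseqD(1)[OF A] gseqD(1)[OF B] pD(3)])
  have Wh: "hM x u \<in> W n" if x: "x \<in> W n" for x u n
  proof -
    have xA: "x \<in> A n" and xp: "\<And>r. r \<in> p \<Longrightarrow> r \<odot>\<^bsub>M\<^esub> x \<in> B n" using x by (auto simp: W_def)
    have "r \<odot>\<^bsub>M\<^esub> hM x u \<in> B n" if "r \<in> p" for r
      by (rule res_hM[OF gseqD(2)[OF B] ph pD(3) Ac[OF xA] xp that])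
    then show ?thesis using gsubD(2)[OF gseqD(2)[OF A] xA] by (simp add: W_def)
  qed
  have W: "gseq W" using Wst Wh by (auto simp: gseq_def gsub_def dest: stable_seqD(1))
  note Ws = stable_seqD(1)[OF Wst]
  note Wc = submodule_carrier[OF Ws]
  have WA: "W \<le> A" by (auto simp: W_def le_fun_def)
  define Q where "Q n u = {x \<in> W n \<inter> Mgr u. \<exists>k. \<exists>s\<in>Rgr k. s \<notin> p \<and> s \<odot>\<^bsub>M\<^esub> x \<in> B n}" for n u
  define Z where "Z = (\<lambda>n. {x \<in> carrier M. \<forall>u. hM x u \<in> Q n u})"
  \<comment> \<open>The components of the unit cannot all lie in \<open>p\<close>. Such an
    \<open>s\<close> witnesses that zero belongs to every \<open>Q n u\<close>.\<close>
  have "\<exists>k. \<exists>s\<in>Rgr k. s \<notin> p"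
  proof (rule ccontr)
    assume "\<not> ?thesis"
    then have h: "hR \<one> i \<in> p" for i using Rg.hcomp_mem[OF one_closed] by blast
    have "\<one> \<in> p" by (rule Rg.mem_if_hcomp_mem[OF one_closed pD(5,3,7) h])
    then show False using pD(1) by simp
  qed
  then obtain k0 s0 where s0: "s0 \<in> Rgr k0" "s0 \<notin> p" by blast
  have s0c: "s0 \<in> carrier R" by (rule Rg.C_carrier[OF s0(1)])
  have Q0: "\<zero>\<^bsub>M\<^esub> \<in> Q n u" for n u
    unfolding Q_def using submodule_zero[OF Ws] Mg.C_zero s0 s0c submodule_zero[OF Bs]
    by (auto intro!: exI[of _ k0] bexI[of _ s0])
  have Qsmult: "r \<odot>\<^bsub>M\<^esub> x \<in> Q n (int k + u)" if r: "r \<in> Rgr k" and x: "x \<in> Q n u" for n k u r x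
  proof -
    obtain l s where s: "s \<in> Rgr l" "s \<notin> p" "s \<odot>\<^bsub>M\<^esub> x \<in> B n" using x by (auto simp: Q_def)
    have xW: "x \<in> W n" "x \<in> Mgr u" using x by (auto simp: Q_def)
    have rc: "r \<in> carrier R" and sc: "s \<in> carrier R" using Rg.C_carrier r s by blast+
    have "s \<odot>\<^bsub>M\<^esub> (r \<odot>\<^bsub>M\<^esub> x) = r \<odot>\<^bsub>M\<^esub> (s \<odot>\<^bsub>M\<^esub> x)" using rc sc Wc[OF xW(1)] by (simp add: smult_assoc1[symmetric] m_comm)
    then have "s \<odot>\<^bsub>M\<^esub> (r \<odot>\<^bsub>M\<^esub> x) \<in> B n" using submoduleE(4)[OF Bs rc s(3)] by simp
    moreover have "r \<odot>\<^bsub>M\<^esub> x \<in> W n" by (rule submoduleE(4)[OF Ws rc xW(1)])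
    moreover have "r \<odot>\<^bsub>M\<^esub> x \<in> Mgr (int k + u)" by (rule smult_graded[OF r xW(2)])
    ultimately show ?thesis using s unfolding Q_def by blast
  qed
  have Qadd: "a \<oplus>\<^bsub>M\<^esub> b \<in> Q n u" if a: "a \<in> Q n u" and b: "b \<in> Q n u" for n u a b
  proof -
    obtain l s where s: "s \<in> Rgr l" "s \<notin> p" "s \<odot>\<^bsub>M\<^esub> a \<in> B n" using a by (auto simp: Q_def)
    obtain l' t where t: "t \<in> Rgr l'" "t \<notin> p" "t \<odot>\<^bsub>M\<^esub> b \<in> B n" using b by (auto simp: Q_def)
    have aW: "a \<in> W n" "a \<in> Mgr u" and bW: "b \<in> W n" "b \<in> Mgr u" using a b by (auto simp: Q_def)
    have sc: "s \<in> carrier R" and tc: "t \<in> carrier R" using Rg.C_carrier s t by blast+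
    have "(s \<otimes> t) \<odot>\<^bsub>M\<^esub> (a \<oplus>\<^bsub>M\<^esub> b) = t \<odot>\<^bsub>M\<^esub> (s \<odot>\<^bsub>M\<^esub> a) \<oplus>\<^bsub>M\<^esub> s \<odot>\<^bsub>M\<^esub> (t \<odot>\<^bsub>M\<^esub> b)"
      using sc tc Wc[OF aW(1)] Wc[OF bW(1)] by (simp add: smult_r_distr smult_assoc1[symmetric] m_comm)
    then have "(s \<otimes> t) \<odot>\<^bsub>M\<^esub> (a \<oplus>\<^bsub>M\<^esub> b) \<in> B n"
      using submoduleE(5)[OF Bs submoduleE(4)[OF Bs tc s(3)] submoduleE(4)[OF Bs sc t(3)]] by simp
    moreover have "s \<otimes> t \<notin> p" using pD(2)[OF sc tc] s t by blast
    moreover have "s \<otimes> t \<in> Rgr (l + l')" by (rule mult_graded[OF s(1) t(1)])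
    moreover have "a \<oplus>\<^bsub>M\<^esub> b \<in> W n" by (rule submoduleE(5)[OF Ws aW(1) bW(1)])
    moreover have "a \<oplus>\<^bsub>M\<^esub> b \<in> Mgr u" by (rule additive_subgroup.a_closed[OF Mg.C_subgroup aW(2) bW(2)])
    ultimately show ?thesis unfolding Q_def by blast
  qed
  have Z: "gseq Z"
  proof (rule gseqI)
    show "gsub (Z n)" for n
      unfolding Z_def
    proof (rule gsub_of_graded)
      show "Q n u \<subseteq> Mgr u" for u by (auto simp: Q_def)
    qed (rule Q0 Qadd Qsmult; assumption)+
    fix n j x assume j: "j \<in> {1..c}" and x: "x \<in> Z n"
    have xc: "x \<in> carrier M" using x by (simp add: Z_def)
    have yc: "y j \<in> carrier R" by (rule y_closed[OF j])
    have "y j \<odot>\<^bsub>M\<^esub> hM x v \<in> Q (Suc n) (int (dy j) + v)" for v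
    proof -
      have q: "hM x v \<in> Q n v" using x by (simp add: Z_def)
      then obtain l s where s: "s \<in> Rgr l" "s \<notin> p" "s \<odot>\<^bsub>M\<^esub> hM x v \<in> B n" by (auto simp: Q_def)
      have xW: "hM x v \<in> W n" "hM x v \<in> Mgr v" using q by (auto simp: Q_def)
      have sc: "s \<in> carrier R" by (rule Rg.C_carrier[OF s(1)])
      have "s \<odot>\<^bsub>M\<^esub> (y j \<odot>\<^bsub>M\<^esub> hM x v) = y j \<odot>\<^bsub>M\<^esub> (s \<odot>\<^bsub>M\<^esub> hM x v)"
        using yc sc xc by (simp add: smult_assoc1[symmetric] m_comm)
      then have "s \<odot>\<^bsub>M\<^esub> (y j \<odot>\<^bsub>M\<^esub> hM x v) \<in> B (Suc n)"
        using stable_seqD(2)[OF gseqD(1)[OF B] j s(3)] by simp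
      moreover have "y j \<odot>\<^bsub>M\<^esub> hM x v \<in> W (Suc n)" by (rule stable_seqD(2)[OF Wst j xW(1)])
      moreover have "y j \<odot>\<^bsub>M\<^esub> hM x v \<in> Mgr (int (dy j) + v)" by (rule smult_graded[OF y_homog[OF j] xW(2)])
      ultimately show ?thesis using s unfolding Q_def by blast
    qed
    from this[of "_ - int (dy j)"] show "y j \<odot>\<^bsub>M\<^esub> x \<in> Z (Suc n)"
      using xc yc by (simp add: Z_def hM_smult[OF y_homog[OF j] xc])
  qed
  have ZW: "Z \<le> W"
  proof (rule le_funI, rule subsetI)
    fix n x assume "x \<in> Z n"
    then have "x \<in> carrier M" "\<And>u. hM x u \<in> W n" by (auto simp: Z_def Q_def)
    then show "x \<in> W n" by (rule mem_submodule_if_hM[OF Ws])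
  qed
  have "degs W Z n = {u. \<exists>x\<in>A n \<inter> Mgr u. p = res (B n) x}" for n
  proof -
    have "x \<in> W n \<and> x \<notin> Z n \<longleftrightarrow> p = res (B n) x" if x: "x \<in> A n" "x \<in> Mgr u" for x u
    proof
      have xc: "x \<in> carrier M" by (rule Ac[OF x(1)])
      note hx = Mg.hcomp_homog[OF x(2)]
      show "p = res (B n) x" if "x \<in> W n \<and> x \<notin> Z n"
      proof
        have xW: "x \<in> W n" and xZ: "x \<notin> Z n" using that by auto
        show "p \<subseteq> res (B n) x" using xW pD(3) by (auto simp: W_def res_def)
        show "res (B n) x \<subseteq> p"
        proof
          fix s assume s: "s \<in> res (B n) x"
          then have sc: "s \<in> carrier R" by (simp add: res_mem)
          have "hR s i \<in> p" for i
          proof (rule ccontr)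
            assume out: "hR s i \<notin> p"
            have "hM (s \<odot>\<^bsub>M\<^esub> x) (int i + u) \<in> B n"
              by (rule gsubD(2)[OF gseqD(2)[OF B]]) (use s in \<open>simp add: res_mem\<close>)
            then have "hR s i \<odot>\<^bsub>M\<^esub> x \<in> B n" by (simp add: hM_smult_homog[OF sc x(2)])
            then have "x \<in> Q n u" unfolding Q_def using xW x(2) out Rg.hcomp_mem[OF sc] by blast
            then have "hM x v \<in> Q n v" for v using Q0 by (simp add: hx)
            then show False using xZ xc by (simp add: Z_def)
          qed
          then show "s \<in> p" by (intro Rg.mem_if_hcomp_mem[OF sc pD(5,3,7)])
        qed
      qed
      show "x \<in> W n \<and> x \<notin> Z n" if px: "p = res (B n) x"
      proof
        show "x \<in> W n" using x(1) px by (auto simp: W_def res_mem)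
        show "x \<notin> Z n"
        proof
          assume "x \<in> Z n"
          then have "hM x u \<in> Q n u" by (simp add: Z_def)
          then have "x \<in> Q n u" by (simp add: hx)
          then obtain l s where s: "s \<in> Rgr l" "s \<notin> p" "s \<odot>\<^bsub>M\<^esub> x \<in> B n" by (auto simp: Q_def)
          then have "s \<in> res (B n) x" using Rg.C_carrier[OF s(1)] by (simp add: res_mem)
          then show False using s(2) px by simp
        qed
      qed
    qed
    then show ?thesis using WA unfolding degs_def le_fun_def by blast
  qed
  then have "degs W Z = (\<lambda>n. {u. \<exists>x\<in>A n \<inter> Mgr u. p = res (B n) x})" by blast
  moreover have "lin_or_empty (degs W Z) (dy ` {i \<in> {1..c}. \<not> nilp W Z i})"
    by (rule degs_linear[OF noeth_seq_subset[OF noeth Wst WA] W Z ZW])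
  ultimately have "lin_or_empty (\<lambda>n. {u. \<exists>x\<in>A n \<inter> Mgr u. p = res (B n) x}) (dy ` {i \<in> {1..c}. \<not> nilp W Z i})"
    by (simp only:)
  then show ?thesis by (rule lin_or_empty_mono) blast
qed

end

section \<open>Limits of linear minima\<close>

lemma lin_min_shift:
  assumes "lin_min (\<lambda>n. S (n + k)) a"
  shows "lin_min S a"
proof -
  obtain b where "\<forall>\<^sub>F n in sequentially. int a * int n + b \<in> S (n + k) \<and> (\<forall>u\<in>S (n + k). int a * int n + b \<le> u)"
    using assms unfolding lin_min_def by blast
  then obtain n0 where n0: "\<And>n. n \<ge> n0 \<Longrightarrow> int a * int n + b \<in> S (n + k) \<and> (\<forall>u\<in>S (n + k). int a * int n + b \<le> u)"
    unfolding eventually_sequentially by blast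
  have "\<forall>\<^sub>F n in sequentially. int a * int n + (b - int a * int k) \<in> S n \<and> (\<forall>u\<in>S n. int a * int n + (b - int a * int k) \<le> u)"
    unfolding eventually_sequentially
  proof (intro exI allI impI)
    fix n assume n: "n0 + k \<le> n"
    then have "int a * int (n - k) + b = int a * int n + (b - int a * int k)" "n - k + k = n" "n - k \<ge> n0"
      by (auto simp: of_nat_diff algebra_simps)
    then show "int a * int n + (b - int a * int k) \<in> S n \<and> (\<forall>u\<in>S n. int a * int n + (b - int a * int k) \<le> u)"
      using n0[of "n - k"] by presburger
  qed
  then show ?thesis unfolding lin_min_def by blast
qed

lemma lin_min_le_slope:
  assumes S: "lin_min S a" and e: "\<forall>\<^sub>F n in sequentially. int d * int n + b \<in> S n"
  shows "a \<le> d"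
proof (rule ccontr)
  assume "\<not> a \<le> d"
  then have ad: "int a - int d \<ge> 1" by simp
  obtain b' where "\<forall>\<^sub>F n in sequentially. int a * int n + b' \<in> S n \<and> (\<forall>u\<in>S n. int a * int n + b' \<le> u)"
    using S unfolding lin_min_def by blast
  then have "\<forall>\<^sub>F n in sequentially. int a * int n + b' \<le> int d * int n + b"
    using e by eventually_elim blast
  then obtain n0 where n0: "\<And>n. n \<ge> n0 \<Longrightarrow> int a * int n + b' \<le> int d * int n + b"
    unfolding eventually_sequentially by blast
  \<comment> \<open>Slopes that differ by at least one separate by more than \<open>b - b'\<close>
    at this index, which contradicts the comparison from \<open>n0\<close> on.\<close>
  define n where "n = max n0 (nat (b - b' + 1))"
  have "int n \<le> (int a - int d) * int n" using mult_right_mono[OF ad, of "int n"] by simp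
  also have "\<dots> \<le> b - b'" using n0[of n] by (simp add: n_def algebra_simps)
  also have "\<dots> < int n" unfolding n_def by linarith
  finally show False by simp
qed

lemma lin_min_subset_slope:
  assumes S: "lin_min S a" and T: "lin_min T a'" and sub: "\<forall>\<^sub>F n in sequentially. S n \<subseteq> T n"
  shows "a' \<le> a"
proof -
  obtain b where "\<forall>\<^sub>F n in sequentially. int a * int n + b \<in> S n \<and> (\<forall>u\<in>S n. int a * int n + b \<le> u)"
    using S unfolding lin_min_def by blast
  then have "\<forall>\<^sub>F n in sequentially. int a * int n + b \<in> T n" using sub by eventually_elim blast
  then show ?thesis by (rule lin_min_le_slope[OF T])
qed

lemma lin_min_INF:
  assumes "lin_min S a"
  shows "eventually_linear (\<lambda>n. INF u\<in>S n. ereal (real_of_int u)) a"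
proof -
  obtain b where "\<forall>\<^sub>F n in sequentially. int a * int n + b \<in> S n \<and> (\<forall>u\<in>S n. int a * int n + b \<le> u)"
    using assms unfolding lin_min_def by blast
  then have "\<forall>\<^sub>F n in sequentially. (INF u\<in>S n. ereal (real_of_int u)) = ereal (real_of_int (int a * int n + b))"
  proof eventually_elim
    case (elim n)
    show ?case
    proof (rule antisym)
      show "(INF u\<in>S n. ereal (real_of_int u)) \<le> ereal (real_of_int (int a * int n + b))"
        by (rule INF_lower) (use elim in blast)
      show "ereal (real_of_int (int a * int n + b)) \<le> (INF u\<in>S n. ereal (real_of_int u))"
      proof (rule INF_greatest)
        fix u assume "u \<in> S n"
        then have "int a * int n + b \<le> u" using elim by blast
        then show "ereal (real_of_int (int a * int n + b)) \<le> ereal (real_of_int u)"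
          by (simp only: ereal_less_eq of_int_le_iff)
      qed
    qed
  qed
  then show ?thesis unfolding eventually_linear_def by blast
qed

lemma lin_or_empty_UN:
  assumes "finite S" "\<And>p. p \<in> S \<Longrightarrow> lin_or_empty (V p) D"
  shows "lin_or_empty (\<lambda>n. \<Union>p\<in>S. V p n) D"
  using assms
proof induct
  case empty then show ?case by (simp add: lin_or_empty_def)
next
  case (insert p S)
  have "lin_or_empty (\<lambda>n. V p n \<union> (\<Union>p\<in>S. V p n)) D" by (rule lin_or_empty_union) (use insert in auto)
  then show ?case by simp
qed

lemma lin_or_empty_lin_min:
  assumes "lin_or_empty S D" "\<forall>\<^sub>F n in sequentially. S n \<noteq> {}"
  shows "\<exists>a\<in>D. lin_min S a"
proof -
  have "\<not> (\<forall>\<^sub>F n in sequentially. S n = {})"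
  proof
    assume "\<forall>\<^sub>F n in sequentially. S n = {}"
    with assms(2) have "\<forall>\<^sub>F n::nat in sequentially. False" by eventually_elim simp
    then show False by simp
  qed
  then show ?thesis using assms(1) unfolding lin_or_empty_def by blast
qed

lemma eventual_value_eqI:
  assumes "\<forall>\<^sub>F n in sequentially. f n = v"
  shows "eventual_value f = v"
  unfolding eventual_value_def
proof (rule the_equality)
  show "\<forall>\<^sub>F n in sequentially. f n = v" by (rule assms)
  fix w assume "\<forall>\<^sub>F n in sequentially. f n = w"
  with assms have "\<forall>\<^sub>F n::nat in sequentially. w = v" by eventually_elim simp
  then show "w = v" by simp
qed

section \<open>Asymptotics of the v-number\<close>

text \<open>The parameter \<open>m\<close> is an exponent with \<open>J I^m = I^(m+1)\<close>, where
  \<open>J\<close> is the ideal generated by the \<open>y j\<close>.\<close>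

locale asymptotic_v = graded_module_seq R Rgr M Mgr y c dy
  for R (structure) and Rgr and M (structure) and Mgr and y c dy +
  fixes I :: "'a set" and N :: "'c set" and m :: nat
  assumes I: "graded_ideal I" and N: "gsub N" and yI: "\<And>j. j \<in> {1..c} \<Longrightarrow> y j \<in> I"
    and red: "ideal_prod R (Idl (y ` {1..c})) (ideal_power R I m) = ideal_power R I (Suc m)"
    and colon: "module_colon M I = {\<zero>\<^bsub>M\<^esub>}"
begin

definition PM :: "nat \<Rightarrow> 'c set" where "PM n = pow_smult R M I n (carrier M)"
definition PN :: "nat \<Rightarrow> 'c set" where "PN n = pow_smult R M I n N"

text \<open>Started at \<open>m\<close>, the sequence \<open>E\<close> satisfies
  \<open>E (Suc n) = J E n\<close>, as \<open>noeth_seqI\<close> requires. Since \<open>B\<close> is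
  one power of \<open>I\<close> ahead, \<open>E/B\<close> is a tail of the module called G in the
  theorem.\<close>

abbreviation E :: "nat \<Rightarrow> 'c set" where "E \<equiv> \<lambda>n. PM (m + n)"
abbreviation F :: "nat \<Rightarrow> 'c set" where "F \<equiv> \<lambda>n. PN (m + n)"
abbreviation B :: "nat \<Rightarrow> 'c set" where "B \<equiv> \<lambda>n. PN (Suc (m + n))"

lemma Ii: "ideal I R"
  using I by (simp add: graded_ideal_def)

lemma J_ideal: "ideal (Idl (y ` {1..c})) R"
  by (rule genideal_ideal) (use y_closed in auto)

lemmas Ms = gsubD(1)[OF gsub_carrier]
lemmas Ns = gsubD(1)[OF N]

lemma PM_gsub: "gsub (PM n)" and PN_gsub: "gsub (PN n)"
  unfolding PM_def PN_def by (intro gsub_pow_smult I gsub_carrier N)+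

lemmas PM_sub = gsubD(1)[OF PM_gsub]
lemmas PN_sub = gsubD(1)[OF PN_gsub]

lemma I_PM: "a \<in> I \<Longrightarrow> x \<in> PM n \<Longrightarrow> a \<odot>\<^bsub>M\<^esub> x \<in> PM (Suc n)"
  unfolding PM_def pow_smult_Suc(2)[OF Ii Ms] by (rule ideal_smult_gen)

lemma I_PN: "a \<in> I \<Longrightarrow> x \<in> PN n \<Longrightarrow> a \<odot>\<^bsub>M\<^esub> x \<in> PN (Suc n)"
  unfolding PN_def pow_smult_Suc(2)[OF Ii Ns] by (rule ideal_smult_gen)

lemma PN_PM: "PN n \<subseteq> PM n"
  unfolding PM_def PN_def by (rule pow_smult_mono[OF Ii Ms submoduleE(1)[OF Ns]])

lemma PN_Suc: "PN (Suc n) \<subseteq> PN n"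
  unfolding PN_def by (rule pow_smult_decreasing[OF Ii Ns])

lemma E_gseq: "gseq E" and F_gseq: "gseq F" and B_gseq: "gseq B"
  by (rule gseqI; use PM_gsub PN_gsub I_PM I_PN yI in simp)+

lemma E_noeth: "noeth_seq E"
proof (rule noeth_seqI[OF gseqD(1)[OF E_gseq]])
  fix n
  have "E (Suc n) = ideal_smult R M (Idl (y ` {1..c})) (E n)"
    unfolding PM_def using pow_smult_reduction[OF Ii J_ideal Ms red, of "m + n"] by simp
  also have "\<dots> \<subseteq> lin_comb M y (E n) c" by (rule ideal_smult_lin_comb[OF PM_sub])
  finally show "E (Suc n) \<subseteq> lin_comb M y (E n) c" .
qed

lemma F_noeth: "noeth_seq F"
  by (rule noeth_seq_subset[OF E_noeth gseqD(1)[OF F_gseq]]) (auto simp: le_fun_def dest: subsetD[OF PN_PM])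

lemma B_le_F: "B \<le> F" and B_le_E: "B \<le> E"
  using PN_Suc PN_PM by (auto simp: le_fun_def)

lemma power_mem_ideal_power: "s \<in> I \<Longrightarrow> s [^] n \<in> ideal_power R I n"
proof (induct n)
  case 0 then show ?case by (simp add: ideal_power_0)
next
  case (Suc n) then show ?case by (simp add: ideal_power_Suc ideal_prod.prod)
qed

lemma power_notin_prime:
  assumes p: "primeideal p R" and s: "s \<in> carrier R" "s \<notin> p"
  shows "s [^] (n::nat) \<notin> p"
proof (induct n)
  case 0 then show ?case using primeD(1)[OF p] by simp
next
  case (Suc n) then show ?case using primeD(2)[OF p nat_pow_closed[OF s(1)] s(1)] s by auto
qed

text \<open>An element killed by all \<open>y j\<close> is killed by \<open>J\<close> and therefore
  by \<open>I^(m+1)\<close>, which is contained in \<open>J\<close>. Removing one factor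
  \<open>I\<close> at a time with \<open>(0 : I) = 0\<close> leaves only zero.\<close>

lemma faithful:
  assumes x: "x \<in> carrier M" and z: "\<And>j. j \<in> {1..c} \<Longrightarrow> y j \<odot>\<^bsub>M\<^esub> x = \<zero>\<^bsub>M\<^esub>"
  shows "x = \<zero>\<^bsub>M\<^esub>"
proof -
  have "ideal {a \<in> carrier R. \<forall>w\<in>{x}. a \<odot>\<^bsub>M\<^esub> w \<in> {\<zero>\<^bsub>M\<^esub>}} R"
    by (rule transporter_ideal[OF _ submodule_zero_set]) (use x in simp)
  then have "Idl (y ` {1..c}) \<subseteq> {a \<in> carrier R. \<forall>w\<in>{x}. a \<odot>\<^bsub>M\<^esub> w \<in> {\<zero>\<^bsub>M\<^esub>}}"
    by (rule genideal_minimal) (use y_closed z in auto)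
  then have J: "a \<odot>\<^bsub>M\<^esub> x = \<zero>\<^bsub>M\<^esub>" if "a \<in> Idl (y ` {1..c})" for a using that by blast
  have "a \<odot>\<^bsub>M\<^esub> x = \<zero>\<^bsub>M\<^esub>" if "a \<in> ideal_power R I (Suc m)" for a
    using J ideal_prod_inter[OF J_ideal ideal_power_ideal[OF Ii, of m]] that unfolding red[symmetric] by blast
  moreover have "(\<forall>a\<in>ideal_power R I k. a \<odot>\<^bsub>M\<^esub> x = \<zero>\<^bsub>M\<^esub>) \<Longrightarrow> x = \<zero>\<^bsub>M\<^esub>" for k
  proof (induct k)
    case 0
    then have "\<one> \<odot>\<^bsub>M\<^esub> x = \<zero>\<^bsub>M\<^esub>" by (simp add: ideal_power_0)
    then show ?case using x by simp
  next
    case (Suc k)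
    have "b \<odot>\<^bsub>M\<^esub> x = \<zero>\<^bsub>M\<^esub>" if b: "b \<in> ideal_power R I k" for b
    proof -
      have bc: "b \<in> carrier R" by (rule ideal.Icarr[OF ideal_power_ideal[OF Ii] b])
      have "a \<odot>\<^bsub>M\<^esub> (b \<odot>\<^bsub>M\<^esub> x) = \<zero>\<^bsub>M\<^esub>" if a: "a \<in> I" for a
      proof -
        have ac: "a \<in> carrier R" by (rule ideal.Icarr[OF Ii a])
        have "b \<otimes> a \<in> ideal_power R I (Suc k)" unfolding ideal_power_Suc by (rule ideal_prod.prod[OF b a])
        then have "(b \<otimes> a) \<odot>\<^bsub>M\<^esub> x = \<zero>\<^bsub>M\<^esub>" using Suc(2) by blast
        then show ?thesis using ac bc x by (simp add: smult_assoc1[symmetric] m_comm)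
      qed
      then have "b \<odot>\<^bsub>M\<^esub> x \<in> module_colon M I" using bc x by (simp add: module_colon_def)
      then show ?thesis using colon by simp
    qed
    then show ?case using Suc(1) by blast
  qed
  ultimately show ?thesis by blast
qed

text \<open>The key step \<open>(I\<^bsup>n+1\<^esup>N :\<^sub>M I) = I\<^bsup>n\<^esup>N\<close> for large \<open>n\<close>: by noetherianity the left hand side is
  eventually \<open>J\<close> times its predecessor, hence contained in \<open>I\<^bsup>n\<^esup>N\<close>.\<close>

lemma colon_power:
  "\<exists>n1. \<forall>n\<ge>n1. \<forall>x\<in>carrier M. I \<subseteq> res (PN (Suc n)) x \<longrightarrow> x \<in> PN n"
proof -
  obtain n0 where n0: "\<And>n x. n \<ge> n0 \<Longrightarrow> x \<in> carrier M \<Longrightarrow> (\<forall>j\<in>{1..c}. y j \<odot>\<^bsub>M\<^esub> x \<in> F (Suc n)) \<Longrightarrow> x \<in> F n"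
    using colon_carrier_eventually[OF F_noeth faithful] by blast
  have "x \<in> PN n" if n: "n \<ge> m + n0" and x: "x \<in> carrier M" and Ix: "I \<subseteq> res (PN (Suc n)) x" for n x
  proof -
    define l where "l = n - m"
    have l: "n = m + l" "l \<ge> n0" using n by (auto simp: l_def)
    have "y j \<odot>\<^bsub>M\<^esub> x \<in> F (Suc l)" if "j \<in> {1..c}" for j
      using Ix yI[OF that] l by (auto simp: res_mem subset_iff)
    then show ?thesis using n0[OF l(2) x] l(1) by blast
  qed
  then show ?thesis by blast
qed

text \<open>In the localisation at \<open>p\<close> the ideal \<open>I\<close> becomes the unit
  ideal, so \<open>I^n N\<close> and \<open>N\<close> agree there. Without localising, this is
  expressed by an element \<open>t = s^n\<close> outside \<open>p\<close>, with \<open>s\<close> in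
  \<open>I\<close>, for which \<open>t N \<subseteq> I^n N \<subseteq> N\<close>.\<close>

lemma ass_away:
  assumes nI: "\<not> I \<subseteq> p"
  shows "p \<in> ass (carrier M) (PN n) \<longleftrightarrow> p \<in> ass (carrier M) N"
proof (cases "primeideal p R")
  case False then show ?thesis by (simp add: ass_def)
next
  case p: True
  note pD = primeD[OF p]
  obtain s where s: "s \<in> I" "s \<notin> p" using nI by blast
  have sc: "s \<in> carrier R" by (rule ideal.Icarr[OF Ii s(1)])
  let ?t = "s [^] n"
  have tc: "?t \<in> carrier R" using sc by simp
  have tp: "?t \<notin> p" by (rule power_notin_prime[OF p sc s(2)])
  have tN: "?t \<odot>\<^bsub>M\<^esub> x \<in> PN n" if "x \<in> N" for x
    unfolding PN_def pow_smult_def by (rule ideal_smult_gen[OF power_mem_ideal_power[OF s(1)] that])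
  have PNN: "PN n \<subseteq> N" unfolding PN_def by (rule pow_smult_subset[OF Ii Ns])
  show ?thesis
  proof
    assume "p \<in> ass (carrier M) (PN n)"
    then obtain x where x: "x \<in> carrier M" "p = res (PN n) x" by (auto simp: ass_def)
    have "p = res N x"
    proof
      show "p \<subseteq> res N x" using x PNN by (auto simp: res_def)
      show "res N x \<subseteq> p"
      proof
        fix r assume r: "r \<in> res N x"
        then have rc: "r \<in> carrier R" by (simp add: res_mem)
        have "?t \<odot>\<^bsub>M\<^esub> (r \<odot>\<^bsub>M\<^esub> x) \<in> PN n" by (rule tN) (use r in \<open>simp add: res_mem\<close>)
        then have "?t \<otimes> r \<in> p" using x rc tc by (simp add: res_mem smult_assoc1)
        then show "r \<in> p" using pD(2)[OF tc rc] tp by blast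
      qed
    qed
    then show "p \<in> ass (carrier M) N" using p x by (auto simp: ass_def)
  next
    assume "p \<in> ass (carrier M) N"
    then obtain x where x: "x \<in> carrier M" "p = res N x" by (auto simp: ass_def)
    have "p = res (PN n) (?t \<odot>\<^bsub>M\<^esub> x)"
    proof
      show "p \<subseteq> res (PN n) (?t \<odot>\<^bsub>M\<^esub> x)"
      proof
        fix r assume r: "r \<in> p"
        then have rc: "r \<in> carrier R" using pD(3) by blast
        have "?t \<odot>\<^bsub>M\<^esub> (r \<odot>\<^bsub>M\<^esub> x) \<in> PN n" by (rule tN) (use r x in \<open>simp add: res_mem\<close>)
        then show "r \<in> res (PN n) (?t \<odot>\<^bsub>M\<^esub> x)"
          using x rc tc by (simp add: res_mem smult_assoc1[symmetric] m_comm)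
      qed
      show "res (PN n) (?t \<odot>\<^bsub>M\<^esub> x) \<subseteq> p"
      proof
        fix r assume r: "r \<in> res (PN n) (?t \<odot>\<^bsub>M\<^esub> x)"
        then have rc: "r \<in> carrier R" by (simp add: res_mem)
        have "r \<odot>\<^bsub>M\<^esub> (?t \<odot>\<^bsub>M\<^esub> x) \<in> N" using r PNN by (auto simp: res_mem)
        then have "r \<otimes> ?t \<in> p" using x rc tc by (simp add: res_mem smult_assoc1)
        then show "r \<in> p" using pD(2)[OF rc tc] tp by blast
      qed
    qed
    then show "p \<in> ass (carrier M) (PN n)" using p x tc by (auto simp: ass_def)
  qed
qed

text \<open>Primes containing \<open>I\<close> are those of \<open>F/B\<close> by
  \<open>colon_power\<close>, and these stabilise. The remaining ones are primes of
  \<open>M/N\<close>, independently of \<open>n\<close>. This shows that the eventual value in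
  \<open>asymp_Ass_A\<close> is attained.\<close>

lemma ass_M_stable: "\<exists>k S. \<forall>n\<ge>k. ass (carrier M) (PN n) = S"
proof -
  obtain n1 where n1: "\<And>n x. n \<ge> n1 \<Longrightarrow> x \<in> carrier M \<Longrightarrow> I \<subseteq> res (PN (Suc n)) x \<Longrightarrow> x \<in> PN n"
    using colon_power by blast
  obtain k S where S: "\<And>n. n \<ge> k \<Longrightarrow> ass (F n) (B n) = S"
    using ass_seq_stable[OF F_noeth gseqD(1)[OF B_gseq] B_le_F] by blast
  have "ass (carrier M) (PN n) = S \<union> {p \<in> ass (carrier M) N. \<not> I \<subseteq> p}" if n: "n \<ge> Suc (m + n1 + k)" for n
  proof -
    define l where "l = n - Suc m"
    have l: "n = Suc (m + l)" "l \<ge> k" "m + l \<ge> n1" using n by (auto simp: l_def)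
    have "p \<in> ass (carrier M) (PN n) \<longleftrightarrow> p \<in> ass (F l) (B l)" if Ip: "I \<subseteq> p" for p
      using n1[OF l(3)] submodule_carrier[OF PN_sub] Ip unfolding ass_def l(1) by blast
    moreover have "I \<subseteq> p" if "p \<in> ass (F l) (B l)" for p
    proof -
      obtain x where x: "x \<in> F l" "p = res (B l) x" using \<open>p \<in> ass (F l) (B l)\<close> by (auto simp: ass_def)
      show ?thesis using I_PN[OF _ x(1)] ideal.Icarr[OF Ii] unfolding x(2) by (auto simp: res_mem)
    qed
    ultimately show ?thesis using S[OF l(2)] ass_away[of _ n] by blast
  qed
  then show ?thesis by blast
qed

text \<open>Its infimum is the v-number of \<open>A/V\<close> at \<open>p\<close>; see
  \<open>v_number_at_subquot\<close>.\<close>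

definition vset :: "'c set \<Rightarrow> 'c set \<Rightarrow> 'a set \<Rightarrow> int set"
  where "vset A V p = {u. \<exists>x\<in>A \<inter> Mgr u. p = res V x}"

lemma vset_nonempty:
  assumes V: "gsub V" and p: "p \<in> ass A V" and A: "gsub A"
  shows "vset A V p \<noteq> {}" "r \<in> p \<Longrightarrow> hR r i \<in> p"
proof -
  obtain x where x: "primeideal p R" "x \<in> A" "p = res V x" using p by (auto simp: ass_def)
  have xc: "x \<in> carrier M" by (rule submodule_carrier[OF gsubD(1)[OF A] x(2)])
  note g = graded_ass[OF V x(1) xc x(3)]
  then obtain u where "p = res V (hM x u)" by blast
  then have "u \<in> vset A V p" unfolding vset_def using gsubD(2)[OF A x(2)] Mg.hcomp_mem[OF xc] by blast
  then show "vset A V p \<noteq> {}" by blast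
  show "r \<in> p \<Longrightarrow> hR r i \<in> p" using g by blast
qed

lemma ass_vset: "primeideal p R \<Longrightarrow> vset A V p \<noteq> {} \<Longrightarrow> p \<in> ass A V"
  by (auto simp: ass_def vset_def)

lemma vset_degs: "primeideal p R \<Longrightarrow> vset (E n) (B n) p \<subseteq> degs E B n"
proof
  fix u assume p: "primeideal p R" and "u \<in> vset (E n) (B n) p"
  then obtain x where x: "x \<in> E n" "x \<in> Mgr u" "p = res (B n) x" by (auto simp: vset_def)
  have "x \<notin> B n" using primeD(1)[OF p] x Mg.C_carrier[OF x(2)] by (auto simp: res_mem)
  then show "u \<in> degs E B n" using x by (auto simp: degs_def)
qed

text \<open>The bound \<open>n1\<close> does not depend on \<open>p\<close>, so the equality also
  serves for the v-number, which is an infimum over all associated primes.\<close>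

lemma vset_eventually_eq:
  "\<exists>n1. \<forall>n\<ge>n1. \<forall>p. I \<subseteq> p \<longrightarrow>
    vset (carrier M) (PN (Suc n)) p = vset (PN n) (PN (Suc n)) p \<and>
    vset (carrier M) (PN (Suc n)) p = vset (PM n) (PN (Suc n)) p"
proof -
  obtain n1 where n1: "\<And>n x. n \<ge> n1 \<Longrightarrow> x \<in> carrier M \<Longrightarrow> I \<subseteq> res (PN (Suc n)) x \<Longrightarrow> x \<in> PN n"
    using colon_power by blast
  have "vset (carrier M) (PN (Suc n)) p = vset (PN n) (PN (Suc n)) p \<and>
    vset (carrier M) (PN (Suc n)) p = vset (PM n) (PN (Suc n)) p" if n: "n \<ge> n1" and p: "I \<subseteq> p" for n p
  proof -
    have "vset (carrier M) (PN (Suc n)) p \<subseteq> vset (PN n) (PN (Suc n)) p"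
      unfolding vset_def using n1[OF n] p by blast
    moreover have "vset (PN n) (PN (Suc n)) p \<subseteq> vset (PM n) (PN (Suc n)) p"
      unfolding vset_def using PN_PM by blast
    moreover have "vset (PM n) (PN (Suc n)) p \<subseteq> vset (carrier M) (PN (Suc n)) p"
      unfolding vset_def using submodule_carrier[OF PM_sub] by blast
    ultimately show ?thesis by blast
  qed
  then show ?thesis by blast
qed

lemma v_at_linear:
  assumes p: "\<forall>\<^sub>F n in sequentially. p \<in> ass (carrier M) (PN n)" and Ip: "I \<subseteq> p"
  shows "\<exists>a\<in>dy ` {1..c}. lin_min (\<lambda>n. vset (carrier M) (PN n) p) a"
proof -
  obtain k where k: "\<And>n. n \<ge> k \<Longrightarrow> p \<in> ass (carrier M) (PN n)"
    using p unfolding eventually_sequentially by blast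
  have pp: "primeideal p R" using k[OF le_refl] by (simp add: ass_def)
  have ph: "hR r i \<in> p" if "r \<in> p" for r i by (rule vset_nonempty(2)[OF PN_gsub k[OF le_refl] gsub_carrier that])
  have lin: "lin_or_empty (\<lambda>n. vset (F n) (B n) p) (dy ` {1..c})"
    unfolding vset_def by (rule ann_degs_linear[OF F_noeth F_gseq B_gseq B_le_F pp ph])
  obtain n1 where *: "\<forall>n\<ge>n1. \<forall>p. I \<subseteq> p \<longrightarrow>
      vset (carrier M) (PN (Suc n)) p = vset (PN n) (PN (Suc n)) p \<and>
      vset (carrier M) (PN (Suc n)) p = vset (PM n) (PN (Suc n)) p"
    using vset_eventually_eq by (rule exE)
  have n1: "vset (carrier M) (PN (Suc n)) p = vset (PN n) (PN (Suc n)) p" if "n \<ge> n1" for n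
    using *[rule_format, OF that Ip] by (rule conjunct1)
  \<comment> \<open>The term \<open>B n\<close> is \<open>PN (n + Suc m)\<close>. This shift is
    undone at the end by \<open>lin_min_shift\<close> and changes only the constant term.\<close>
  have eq: "vset (F n) (B n) p = vset (carrier M) (PN (n + Suc m)) p" if "n \<ge> n1" for n
    using n1[of "m + n"] that by (simp add: add.commute)
  have "vset (F n) (B n) p \<noteq> {}" if "n \<ge> max n1 k" for n
  proof -
    have "p \<in> ass (carrier M) (PN (n + Suc m))" using k[of "n + Suc m"] that by simp
    from vset_nonempty(1)[OF PN_gsub this gsub_carrier] show ?thesis using eq[of n] that by simp
  qed
  then have "\<forall>\<^sub>F n in sequentially. vset (F n) (B n) p \<noteq> {}" unfolding eventually_sequentially by blast
  then obtain a where a: "a \<in> dy ` {1..c}" "lin_min (\<lambda>n. vset (F n) (B n) p) a"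
    using lin_or_empty_lin_min[OF lin] by blast
  have "\<forall>\<^sub>F n in sequentially. vset (F n) (B n) p = vset (carrier M) (PN (n + Suc m)) p"
    unfolding eventually_sequentially using eq by blast
  then have "lin_min (\<lambda>n. vset (carrier M) (PN (n + Suc m)) p) a" by (rule lin_min_cong[OF a(2)])
  then have "lin_min (\<lambda>n. vset (carrier M) (PN n) p) a"
    by (rule lin_min_shift[of "\<lambda>n. vset (carrier M) (PN n) p" "Suc m" a])
  then show ?thesis using a(1) by blast
qed

text \<open>This spells out that \<open>y j\<close>, placed in the summand \<open>J^1\<close>, lies
  in the radical of the annihilator of G; see \<open>monom_mem_radical_iff\<close>. The condition
  \<open>k > 0\<close> mirrors \<open>ideal_radical\<close>.\<close>

definition nil :: "nat \<Rightarrow> bool"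
  where "nil j \<longleftrightarrow> (\<exists>k>0. \<forall>n. \<forall>x\<in>PM n. ypow j k x \<in> PN (Suc (n + k)))"

lemma ypow_PM: "j \<in> {1..c} \<Longrightarrow> x \<in> PM n \<Longrightarrow> ypow j k x \<in> PM (n + k)"
proof (induct k)
  case (Suc k)
  then show ?case using I_PM[OF yI[OF Suc(2)]] by simp
qed simp

text \<open>The sequences \<open>E\<close> and \<open>B\<close> see only indices from
  \<open>m\<close> on, so \<open>m\<close> further multiplications by \<open>y j\<close> first move
  an element into this range. One more multiplication makes the exponent positive.\<close>

lemma nil_iff_nilp:
  assumes j: "j \<in> {1..c}"
  shows "nil j \<longleftrightarrow> nilp E B j"
proof
  assume "nil j"
  then obtain k where "\<And>n x. x \<in> PM n \<Longrightarrow> ypow j k x \<in> PN (Suc (n + k))" unfolding nil_def by blast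
  then have "\<forall>n. \<forall>x\<in>E n. ypow j k x \<in> B (n + k)" by (metis add.assoc)
  then show "nilp E B j" unfolding nilp_def by blast
next
  assume "nilp E B j"
  then obtain k where k: "\<And>n x. x \<in> E n \<Longrightarrow> ypow j k x \<in> B (n + k)" unfolding nilp_def by blast
  have "ypow j (Suc (k + m)) x \<in> PN (Suc (n + Suc (k + m)))" if x: "x \<in> PM n" for n x
  proof -
    have "ypow j m x \<in> E n" using ypow_PM[OF j x, of m] by (simp add: add.commute)
    from k[OF this] have "ypow j (k + m) x \<in> PN (Suc (m + (n + k)))" by (simp add: funpow_add)
    from I_PN[OF yI[OF j] this] show ?thesis by (simp add: ac_simps)
  qed
  then show "nil j" unfolding nil_def by (intro exI[of _ "Suc (k + m)"]) blast
qed

text \<open>The slope is \<open>dy i\<close> for some generator that is not nilpotent, and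
  \<open>\<gamma> \<le> i\<close> gives one inequality. The orbit of an element under
  \<open>y \<gamma>\<close> gives the other. The indices may differ, but the degrees agree.\<close>

lemma indeg_slope:
  assumes ne: "\<forall>\<^sub>F n in sequentially. degs E B n \<noteq> {}"
    and \<gamma>: "\<gamma> = Inf {j. 1 \<le> j \<and> j \<le> c \<and> \<not> nil j}"
  shows "\<gamma> \<in> {1..c}" "\<not> nil \<gamma>" "lin_min (degs E B) (dy \<gamma>)"
proof -
  let ?S = "{j. 1 \<le> j \<and> j \<le> c \<and> \<not> nil j}"
  obtain i where i: "i \<in> {1..c}" "\<not> nilp E B i" "lin_min (degs E B) (dy i)"
    using lin_or_empty_lin_min[OF degs_linear[OF E_noeth E_gseq B_gseq B_le_E] ne] by blast
  then have iS: "i \<in> ?S" using nil_iff_nilp by auto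
  then have "\<gamma> \<in> ?S" unfolding \<gamma> using Inf_nat_def1[of ?S] by blast
  then show \<gamma>c: "\<gamma> \<in> {1..c}" and \<gamma>n: "\<not> nil \<gamma>" by auto
  have "\<gamma> \<le> i" unfolding \<gamma> by (rule wellorder_Inf_le1[OF iS])
  then have le: "dy \<gamma> \<le> dy i" using mono_onD[OF dy_mono \<gamma>c i(1)] by simp
  obtain p b n0 where p: "primeideal p R" "\<And>n. n \<ge> n0 \<Longrightarrow> \<exists>x\<in>E n \<inter> Mgr (int (dy \<gamma>) * int n + b). p = res (B n) x"
    using not_nilp_ass[OF E_noeth E_gseq B_gseq \<gamma>c] \<gamma>n nil_iff_nilp[OF \<gamma>c] by blast
  then have "int (dy \<gamma>) * int n + b \<in> degs E B n" if "n \<ge> n0" for n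
    using vset_degs[OF p(1), of n] p(2)[OF that] unfolding vset_def by blast
  then have "\<forall>\<^sub>F n in sequentially. int (dy \<gamma>) * int n + b \<in> degs E B n"
    unfolding eventually_sequentially by blast
  then have "dy i \<le> dy \<gamma>" by (rule lin_min_le_slope[OF i(3)])
  then have "dy i = dy \<gamma>" using le by simp
  then show "lin_min (degs E B) (dy \<gamma>)" using i(3) by simp
qed

text \<open>The set of primes is finite and eventually constant, so linearity follows prime by
  prime. The slope is at most \<open>dy \<gamma>\<close> because of the orbit from
  \<open>not_nilp_ass\<close>, whose prime belongs to that set, and at least
  \<open>dy \<gamma>\<close> because a v-number is never below the initial degree.\<close>

lemma v_slope:
  assumes \<gamma>: "\<gamma> \<in> {1..c}" "\<not> nil \<gamma>" "lin_min (degs E B) (dy \<gamma>)"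
  shows "lin_min (\<lambda>n. \<Union>p\<in>ass (E n) (B n). vset (E n) (B n) p) (dy \<gamma>)"
proof -
  obtain k S where S: "\<And>n. n \<ge> k \<Longrightarrow> ass (E n) (B n) = S"
    using ass_seq_stable[OF E_noeth gseqD(1)[OF B_gseq] B_le_E] by blast
  have "S \<subseteq> (\<Union>n. ass (E n) (B n))" using S[OF le_refl] by blast
  then have finS: "finite S" using finite_ass_seq[OF E_noeth gseqD(1)[OF B_gseq] B_le_E] by (rule finite_subset)
  have Sp: "primeideal p R" "\<And>r i. r \<in> p \<Longrightarrow> hR r i \<in> p" if "p \<in> S" for p
  proof -
    have pa: "p \<in> ass (E k) (B k)" using that S by simp
    then show "primeideal p R" by (simp add: ass_def)
    show "hR r i \<in> p" if "r \<in> p" for r i by (rule vset_nonempty(2)[OF PN_gsub pa PM_gsub that])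
  qed
  let ?V = "\<lambda>n. \<Union>p\<in>S. vset (E n) (B n) p"
  have lin: "lin_or_empty ?V (dy ` {1..c})"
    by (rule lin_or_empty_UN[OF finS], unfold vset_def, rule ann_degs_linear[OF E_noeth E_gseq B_gseq B_le_E Sp])
  obtain p b n0 where p: "primeideal p R" "\<And>n. n \<ge> n0 \<Longrightarrow> \<exists>x\<in>E n \<inter> Mgr (int (dy \<gamma>) * int n + b). p = res (B n) x"
    using not_nilp_ass[OF E_noeth E_gseq B_gseq \<gamma>(1)] \<gamma>(2) nil_iff_nilp[OF \<gamma>(1)] by blast
  have pv: "int (dy \<gamma>) * int n + b \<in> vset (E n) (B n) p" if "n \<ge> n0" for n
    using p(2)[OF that] unfolding vset_def by blast
  then have "p \<in> ass (E (max n0 k)) (B (max n0 k))" by (intro ass_vset[OF p(1)]) (metis empty_iff max.cobounded1)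
  then have "p \<in> S" using S[of "max n0 k"] by simp
  then have mem: "\<forall>\<^sub>F n in sequentially. int (dy \<gamma>) * int n + b \<in> ?V n"
    unfolding eventually_sequentially using pv by blast
  then have "\<forall>\<^sub>F n in sequentially. ?V n \<noteq> {}" by eventually_elim blast
  then obtain a where a: "lin_min ?V a" using lin_or_empty_lin_min[OF lin] by blast
  have "a \<le> dy \<gamma>" by (rule lin_min_le_slope[OF a mem])
  moreover have "\<forall>\<^sub>F n in sequentially. ?V n \<subseteq> degs E B n"
    using vset_degs Sp(1) by (intro always_eventually allI UN_least) blast
  then have "dy \<gamma> \<le> a" by (rule lin_min_subset_slope[OF a \<gamma>(3)])
  ultimately have "lin_min ?V (dy \<gamma>)" using a by simp
  moreover have "\<forall>\<^sub>F n in sequentially. ?V n = (\<Union>p\<in>ass (E n) (B n). vset (E n) (B n) p)"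
    unfolding eventually_sequentially by (intro exI[of _ k] allI impI) (simp add: S)
  ultimately show ?thesis by (rule lin_min_cong)
qed

text \<open>From \<open>I^(n+n0) M \<subseteq> I^n N\<close> it follows that a power of each element
  of \<open>I\<close> annihilates \<open>M/I^n N\<close>, and \<open>p\<close> is prime.\<close>

lemma I_subset_ass:
  assumes n0: "PM n0 \<subseteq> N" and p: "p \<in> ass (carrier M) (PN n)"
  shows "I \<subseteq> p"
proof
  fix s assume s: "s \<in> I"
  have sc: "s \<in> carrier R" by (rule ideal.Icarr[OF Ii s])
  obtain x where x: "primeideal p R" "x \<in> carrier M" "p = res (PN n) x" using p by (auto simp: ass_def)
  have "PM (n + n0) = pow_smult R M I n (PM n0)" unfolding PM_def by (rule pow_smult_add[OF Ii Ms])
  also have "\<dots> \<subseteq> PN n" unfolding PN_def by (rule pow_smult_mono[OF Ii Ns n0])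
  finally have "PM (n + n0) \<subseteq> PN n" .
  moreover have "s [^] (n + n0) \<odot>\<^bsub>M\<^esub> x \<in> PM (n + n0)"
    unfolding PM_def pow_smult_def by (rule ideal_smult_gen[OF power_mem_ideal_power[OF s] x(2)])
  ultimately have "s [^] (n + n0) \<in> p" unfolding x(3) using sc by (auto simp: res_mem)
  then show "s \<in> p" using power_notin_prime[OF x(1) sc, of "n + n0"] by blast
qed

text \<open>The degrees of \<open>I\<^bsup>n\<^esup>M\<close> grow at least like \<open>n dy 1\<close>, so \<open>y 1\<^bsup>ks\<^esup>\<close> cannot map a nonzero element of
  lowest degree into \<open>I\<^bsup>(k+1)s\<^esup>M\<close> for large \<open>s\<close>.\<close>

lemma not_nil_1:
  assumes c: "1 \<le> c" and inj: "module_colon M {y 1} = {\<zero>\<^bsub>M\<^esub>}" and d: "1 \<le> dy 1" and ne: "carrier M \<noteq> {\<zero>\<^bsub>M\<^esub>}"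
  shows "\<not> nil 1"
proof
  assume "nil 1"
  then obtain k where k: "\<And>n x. x \<in> PM n \<Longrightarrow> ypow 1 k x \<in> PN (Suc (n + k))" unfolding nil_def by blast
  have j: "1 \<in> {1..c}" using c by simp
  have k': "ypow 1 k x \<in> PM (n + Suc k)" if "x \<in> PM n" for x n
    using k[OF that] PN_PM[of "Suc (n + k)"] by auto
  \<comment> \<open>Each block of \<open>k\<close> multiplications by \<open>y 1\<close> gains
    \<open>k + 1\<close> powers of \<open>I\<close>, one more than the number of factors.\<close>
  have iter: "ypow 1 (k * s) x \<in> PM (s * Suc k)" if x: "x \<in> PM 0" for x s
  proof (induct s)
    case 0 show ?case using x by simp
  next
    case (Suc s)
    from k'[OF this] have "ypow 1 (k + k * s) x \<in> PM (s * Suc k + Suc k)" by (simp add: funpow_add)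
    then show ?case by (simp add: algebra_simps)
  qed
  have PM0: "PM 0 = carrier M" unfolding PM_def by (rule pow_smult_0[OF Ms])
  \<comment> \<open>Relative to the zero sequence, \<open>degs\<close> records the degrees of the
    modules themselves, so \<open>degs_step\<close> applies to \<open>E\<close>.\<close>
  define Zs where "Zs = (\<lambda>n::nat. {\<zero>\<^bsub>M\<^esub>})"
  have "gsub {\<zero>\<^bsub>M\<^esub>}" unfolding gsub_def using submodule_zero_set by simp
  then have Zs: "gseq Zs" unfolding Zs_def by (intro gseqI) (auto simp: y_closed)
  let ?D = "{u. \<not> carrier M \<inter> Mgr u \<subseteq> {\<zero>\<^bsub>M\<^esub>}}"
  have D: "?D = degs PM Zs 0" by (simp add: degs_def Zs_def PM0)
  obtain x where x: "x \<in> carrier M" "x \<noteq> \<zero>\<^bsub>M\<^esub>" using ne by blast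
  obtain u where "hM x u \<noteq> \<zero>\<^bsub>M\<^esub>" using mem_submodule_if_hM[OF submodule_zero_set x(1)] x(2) by blast
  moreover have "hM x u \<in> carrier M \<inter> Mgr u" using Mg.hcomp_mem[OF x(1)] x(1) by simp
  ultimately have "u \<in> ?D" by blast
  then have "?D \<noteq> {}" by blast
  moreover obtain e0 where "\<And>u. u \<in> degs PM Zs 0 \<Longrightarrow> e0 \<le> u" using degs_bounded_below Zs by blast
  ultimately obtain e where e: "e \<in> ?D" "\<And>u. u \<in> ?D \<Longrightarrow> e \<le> u"
    using int_set_least[of ?D e0] unfolding D by blast
  have low: "e + int (dy 1) * int n \<le> u" if "u \<in> degs E Zs n" for n u
    using that
  proof (induct n arbitrary: u)
    case 0
    then have "u \<in> ?D" using submodule_carrier[OF PM_sub] by (auto simp: degs_def Zs_def)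
    then show ?case using e(2) by simp
  next
    case (Suc n)
    have gen: "E (Suc n) = lin_comb M y (E n) c"
    proof
      have "E (Suc n) = ideal_smult R M (Idl (y ` {1..c})) (E n)"
        unfolding PM_def using pow_smult_reduction[OF Ii J_ideal Ms red, of "m + n"] by simp
      also have "\<dots> \<subseteq> lin_comb M y (E n) c" by (rule ideal_smult_lin_comb[OF PM_sub])
      finally show "E (Suc n) \<subseteq> lin_comb M y (E n) c" .
      show "lin_comb M y (E n) c \<subseteq> E (Suc n)"
        by (rule lin_comb_least[OF PM_sub]) (use I_PM yI in simp)
    qed
    obtain i b where b: "i \<in> {1..c}" "b \<in> E n" "b \<in> Mgr (u - int (dy i))" "y i \<odot>\<^bsub>M\<^esub> b \<notin> Zs (Suc n)"
      using degs_step[OF E_gseq Zs gen Suc(2)] by blast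
    have "b \<noteq> \<zero>\<^bsub>M\<^esub>" using b(4) y_closed[OF b(1)] by (auto simp: Zs_def)
    then have "u - int (dy i) \<in> degs E Zs n" using b by (auto simp: degs_def Zs_def)
    then have "e + int (dy 1) * int n \<le> u - int (dy i)" by (rule Suc(1))
    moreover have "dy 1 \<le> dy i" using mono_onD[OF dy_mono j b(1)] b(1) by simp
    ultimately show ?case by (simp add: algebra_simps)
  qed
  obtain z where z: "z \<in> Mgr e" "z \<noteq> \<zero>\<^bsub>M\<^esub>" using e(1) by blast
  have zc: "z \<in> carrier M" by (rule Mg.C_carrier[OF z(1)])
  have nz: "ypow 1 l z \<noteq> \<zero>\<^bsub>M\<^esub>" for l
  proof (induct l)
    case 0 show ?case using z by simp
  next
    case (Suc l)
    have "y 1 \<odot>\<^bsub>M\<^esub> ypow 1 l z \<noteq> \<zero>\<^bsub>M\<^esub>"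
    proof
      assume "y 1 \<odot>\<^bsub>M\<^esub> ypow 1 l z = \<zero>\<^bsub>M\<^esub>"
      then have "ypow 1 l z \<in> module_colon M {y 1}" using ypow_closed[OF j zc] by (simp add: module_colon_def)
      then show False using inj Suc by simp
    qed
    then show ?case by simp
  qed
  \<comment> \<open>With \<open>s = m + 1\<close> the exponent \<open>s (k + 1)\<close> equals
    \<open>m + (k s + 1)\<close>. So \<open>w\<close> lies in \<open>E\<close> at index
    \<open>k s + 1\<close>, where all degrees are at least \<open>e + dy 1 (k s + 1)\<close>, but
    its degree is only \<open>e + dy 1 k s\<close>.\<close>
  let ?s = "Suc m" and ?w = "ypow 1 (k * Suc m) z"
  have "?w \<in> PM (?s * Suc k)" by (rule iter) (use zc PM0 in simp)
  moreover have "?s * Suc k = m + (k * ?s + 1)" by (simp add: algebra_simps)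
  ultimately have "?w \<in> E (k * ?s + 1)" by (simp only:)
  moreover have "?w \<in> Mgr (int (k * ?s) * int (dy 1) + e)" by (rule ypow_degree[OF j z(1)])
  ultimately have "int (k * ?s) * int (dy 1) + e \<in> degs E Zs (k * ?s + 1)"
    using nz[of "k * ?s"] by (auto simp: degs_def Zs_def)
  from low[OF this] show False using d by (simp add: algebra_simps)
qed

end

section \<open>Subquotients and Rees modules\<close>

context abelian_group
begin

lemma coset_absorb:
  assumes B: "additive_subgroup B G" and h: "h \<in> B" and z: "z \<in> carrier G"
  shows "B +> (h \<oplus> z) = B +> z"
proof -
  interpret B: additive_subgroup B G by fact
  have hc: "h \<in> carrier G" using h B.a_subset by blast
  have mem: "w \<in> B +> z \<longleftrightarrow> (\<exists>b\<in>B. w = b \<oplus> z)" for w z by (auto simp: a_r_coset_def')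
  show ?thesis
  proof (intro equalityI subsetI)
    fix w assume "w \<in> B +> (h \<oplus> z)"
    then obtain b where b: "b \<in> B" "w = b \<oplus> (h \<oplus> z)" unfolding mem by blast
    then have "w = (b \<oplus> h) \<oplus> z" using hc z B.a_subset by (simp add: a_assoc subsetD)
    then show "w \<in> B +> z" unfolding mem using B.a_closed[OF b(1) h] by blast
  next
    fix w assume "w \<in> B +> z"
    then obtain b where b: "b \<in> B" "w = b \<oplus> z" unfolding mem by blast
    then have "w = (b \<oplus> \<ominus> h) \<oplus> (h \<oplus> z)" using hc z B.a_subset by (simp add: a_assoc r_neg1 subsetD)
    then show "w \<in> B +> (h \<oplus> z)" unfolding mem using B.a_closed[OF b(1) B.a_inv_closed[OF h]] by blast
  qed
qed

lemma coset_eq_iff: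
  assumes B: "additive_subgroup B G" and x: "x \<in> carrier G"
  shows "B +> x = B \<longleftrightarrow> x \<in> B"
proof
  interpret B: additive_subgroup B G by fact
  assume "B +> x = B"
  moreover have "\<zero> \<oplus> x \<in> B +> x" unfolding a_r_coset_def' using B.zero_closed by blast
  ultimately show "x \<in> B" using x by simp
next
  interpret B: additive_subgroup B G by fact
  assume xB: "x \<in> B"
  have "B +> (x \<oplus> \<zero>) = B +> \<zero>" by (rule coset_absorb[OF B xB]) simp
  also have "\<dots> = B"
  proof -
    have "b \<oplus> \<zero> = b" if "b \<in> B" for b using that B.a_subset by (simp add: subsetD)
    then show ?thesis by (simp add: a_r_coset_def')
  qed
  finally show "B +> x = B" using x by simp
qed

end

text \<open>\<open>L\<close> need only be a group with assumptions on the single scalar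
  \<open>a\<close>. Thus the lemma serves both \<open>M\<close> and the Rees module, for which only
  the group structure is established.\<close>

lemma smult_subquot:
  fixes L (structure)
  assumes L: "abelian_group L" and B: "additive_subgroup B L" and x: "x \<in> carrier L"
    and a: "a \<odot> x \<in> carrier L" "\<And>h. h \<in> B \<Longrightarrow> a \<odot> h \<in> B" "\<And>h. h \<in> B \<Longrightarrow> a \<odot> (h \<oplus> x) = a \<odot> h \<oplus> a \<odot> x"
  shows "smult (subquot L A B) a (B +> x) = B +> (a \<odot> x)"
proof -
  interpret abelian_group L by fact
  have "\<zero> \<in> B" by (rule additive_subgroup.zero_closed[OF B])
  have "B +> (a \<odot> z) = B +> (a \<odot> x)" if "z \<in> B +> x" for z
  proof -
    obtain h where "h \<in> B" "z = h \<oplus> x" using \<open>z \<in> B +> x\<close> unfolding a_r_coset_def' by blast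
    then show ?thesis using coset_absorb[OF B a(2) a(1)] a(3) by simp
  qed
  moreover have "B +> x \<noteq> {}" using \<open>\<zero> \<in> B\<close> unfolding a_r_coset_def' by blast
  ultimately show ?thesis by (simp add: subquot_def)
qed

context module
begin

lemma submodule_additive: "submodule B R M \<Longrightarrow> additive_subgroup B M"
  by (simp add: additive_subgroup_def submodule_def)

lemma annihilator_subquot:
  assumes B: "submodule B R M" and x: "x \<in> carrier M"
  shows "annihilator R (subquot M A B) {B +>\<^bsub>M\<^esub> x} = res B x"
proof -
  note Bs = submodule_additive[OF B]
  have "smult (subquot M A B) a (B +>\<^bsub>M\<^esub> x) = zero (subquot M A B) \<longleftrightarrow> a \<odot>\<^bsub>M\<^esub> x \<in> B" if a: "a \<in> carrier R" for a
  proof -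
    have "smult (subquot M A B) a (B +>\<^bsub>M\<^esub> x) = B +>\<^bsub>M\<^esub> (a \<odot>\<^bsub>M\<^esub> x)"
      by (rule smult_subquot[OF M.abelian_group_axioms Bs x])
        (use a x submoduleE(4)[OF B] submodule_carrier[OF B] in \<open>simp_all add: smult_r_distr\<close>)
    moreover have "zero (subquot M A B) = B" by (simp add: subquot_def)
    ultimately show ?thesis using M.coset_eq_iff[OF Bs, of "a \<odot>\<^bsub>M\<^esub> x"] a x by simp
  qed
  then show ?thesis by (auto simp: annihilator_def res_def)
qed

lemma Ass_subquot:
  assumes B: "submodule B R M" and A: "submodule A R M"
  shows "Ass R (subquot M A B) = ass A B"
proof -
  have "carrier (subquot M A B) = (\<lambda>x. B +>\<^bsub>M\<^esub> x) ` A" by (simp add: subquot_def)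
  then show ?thesis
    using annihilator_subquot[OF B submodule_carrier[OF A]] by (auto simp: Ass_def ass_def)
qed

end

context asymptotic_v
begin

lemma v_number_at_subquot:
  assumes V: "submodule V R M" and A: "submodule A R M"
  shows "v_number_at R (subquot M A V) (subquot_gr M Mgr A V) p = (INF u\<in>vset A V p. ereal (real_of_int u))"
proof -
  have "(\<exists>X\<in>subquot_gr M Mgr A V u. p = annihilator R (subquot M A V) {X}) \<longleftrightarrow> (\<exists>x\<in>A \<inter> Mgr u. p = res V x)" for u
  proof -
    have "annihilator R (subquot M A V) {V +>\<^bsub>M\<^esub> x} = res V x" if "x \<in> A \<inter> Mgr u" for x
      by (rule annihilator_subquot[OF V submodule_carrier[OF A]]) (use that in blast)
    then show ?thesis by (simp add: subquot_gr_def)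
  qed
  then show ?thesis by (simp add: v_number_at_def vset_def)
qed

lemma indeg_subquot:
  assumes V: "submodule V R M" and A: "submodule A R M"
  shows "indeg (subquot M A V) (subquot_gr M Mgr A V) =
    (INF u\<in>{u. \<not> A \<inter> Mgr u \<subseteq> V}. ereal (real_of_int u))"
proof -
  have "subquot_gr M Mgr A V u \<noteq> {zero (subquot M A V)} \<longleftrightarrow> \<not> A \<inter> Mgr u \<subseteq> V" for u
  proof -
    have "V +>\<^bsub>M\<^esub> x = V \<longleftrightarrow> x \<in> V" if "x \<in> A" for x
      by (rule M.coset_eq_iff[OF submodule_additive[OF V] submodule_carrier[OF A that]])
    moreover have "\<zero>\<^bsub>M\<^esub> \<in> A \<inter> Mgr u" using submodule_zero[OF A] Mg.C_zero by blast
    moreover have "zero (subquot M A V) = V" by (simp add: subquot_def)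
    ultimately show ?thesis unfolding subquot_gr_def by auto
  qed
  then show ?thesis by (simp add: indeg_def)
qed

lemma v_number_subquot:
  assumes V: "submodule V R M" and A: "submodule A R M"
  shows "v_number R (subquot M A V) (subquot_gr M Mgr A V) =
    (INF u\<in>(\<Union>p\<in>ass A V. vset A V p). ereal (real_of_int u))"
proof -
  have "(INF p\<in>ass A V. INF u\<in>vset A V p. ereal (real_of_int u)) =
    (INF u\<in>(\<Union>p\<in>ass A V. vset A V p). ereal (real_of_int u))"
    by (rule antisym) (auto intro!: INF_greatest intro: INF_lower2 INF_lower)
  then show ?thesis by (simp add: v_number_def v_number_at_subquot[OF V A] Ass_subquot[OF V A])
qed

section \<open>The Rees module as a group and the action of monomials\<close>

lemma rees_carrier:
  "f \<in> carrier (rees_module R M I L) \<longleftrightarrow> (\<forall>n. f n \<in> pow_smult R M I n L) \<and> finite {n. f n \<noteq> \<zero>\<^bsub>M\<^esub>}"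
  by (simp add: rees_module_def)

lemma rees_nth: "f \<in> carrier (rees_module R M I L) \<Longrightarrow> f n \<in> pow_smult R M I n L"
  by (simp add: rees_carrier)

lemma rees_nth_carrier:
  "submodule L R M \<Longrightarrow> f \<in> carrier (rees_module R M I L) \<Longrightarrow> f n \<in> carrier M"
  by (rule submodule_carrier[OF pow_smult_submodule[OF Ii] rees_nth])

lemma rees_add_closed:
  assumes L: "submodule L R M" and f: "f \<in> carrier (rees_module R M I L)" and g: "g \<in> carrier (rees_module R M I L)"
  shows "(\<lambda>n. f n \<oplus>\<^bsub>M\<^esub> g n) \<in> carrier (rees_module R M I L)"
proof -
  have "{n. f n \<oplus>\<^bsub>M\<^esub> g n \<noteq> \<zero>\<^bsub>M\<^esub>} \<subseteq> {n. f n \<noteq> \<zero>\<^bsub>M\<^esub>} \<union> {n. g n \<noteq> \<zero>\<^bsub>M\<^esub>}" by auto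
  then have "finite {n. f n \<oplus>\<^bsub>M\<^esub> g n \<noteq> \<zero>\<^bsub>M\<^esub>}"
    by (rule finite_subset) (use f g in \<open>simp add: rees_carrier\<close>)
  then show ?thesis using f g submoduleE(5)[OF pow_smult_submodule[OF Ii L]] by (simp add: rees_carrier)
qed

lemma rees_minus_closed:
  assumes L: "submodule L R M" and f: "f \<in> carrier (rees_module R M I L)"
  shows "(\<lambda>n. \<ominus>\<^bsub>M\<^esub> f n) \<in> carrier (rees_module R M I L)"
proof -
  have fc: "f n \<in> carrier M" for n by (rule rees_nth_carrier[OF L f])
  have "{n. \<ominus>\<^bsub>M\<^esub> f n \<noteq> \<zero>\<^bsub>M\<^esub>} \<subseteq> {n. f n \<noteq> \<zero>\<^bsub>M\<^esub>}" using fc by auto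
  then have "finite {n. \<ominus>\<^bsub>M\<^esub> f n \<noteq> \<zero>\<^bsub>M\<^esub>}" by (rule finite_subset) (use f in \<open>simp add: rees_carrier\<close>)
  then show ?thesis using f submoduleE(3)[OF pow_smult_submodule[OF Ii L]] by (simp add: rees_carrier)
qed

lemma rees_group:
  assumes L: "submodule L R M"
  shows "abelian_group (rees_module R M I L)"
proof (rule abelian_groupI)
  let ?L = "rees_module R M I L"
  have ops: "zero ?L = (\<lambda>n. \<zero>\<^bsub>M\<^esub>)" "\<And>f g. f \<oplus>\<^bsub>?L\<^esub> g = (\<lambda>n. f n \<oplus>\<^bsub>M\<^esub> g n)" by (simp_all add: rees_module_def)
  have c: "f n \<in> carrier M" if "f \<in> carrier ?L" for f n
    by (rule rees_nth_carrier[OF L that])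
  show "\<zero>\<^bsub>?L\<^esub> \<in> carrier ?L" using submodule_zero[OF pow_smult_submodule[OF Ii L]] by (simp add: ops rees_carrier)
  fix f assume f: "f \<in> carrier ?L"
  show "\<zero>\<^bsub>?L\<^esub> \<oplus>\<^bsub>?L\<^esub> f = f" using c[OF f] by (simp add: ops)
  have "(\<lambda>n. \<ominus>\<^bsub>M\<^esub> f n) \<oplus>\<^bsub>?L\<^esub> f = \<zero>\<^bsub>?L\<^esub>" using c[OF f] by (simp add: ops M.l_neg)
  then show "\<exists>g\<in>carrier ?L. g \<oplus>\<^bsub>?L\<^esub> f = \<zero>\<^bsub>?L\<^esub>" using rees_minus_closed[OF L f] by blast
  fix g assume g: "g \<in> carrier ?L"
  show "f \<oplus>\<^bsub>?L\<^esub> g \<in> carrier ?L" using rees_add_closed[OF L f g] by (simp add: ops)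
  show "f \<oplus>\<^bsub>?L\<^esub> g = g \<oplus>\<^bsub>?L\<^esub> f" using c[OF f] c[OF g] by (simp add: ops M.a_comm)
  fix h assume h: "h \<in> carrier ?L"
  show "f \<oplus>\<^bsub>?L\<^esub> g \<oplus>\<^bsub>?L\<^esub> h = f \<oplus>\<^bsub>?L\<^esub> (g \<oplus>\<^bsub>?L\<^esub> h)" using c[OF f] c[OF g] c[OF h] by (simp add: ops M.a_assoc)
qed

lemma rees_subgroup:
  assumes L: "submodule L R M" and K: "submodule K R M" and KL: "K \<subseteq> L"
  shows "additive_subgroup (carrier (rees_module R M I K)) (rees_module R M I L)"
proof (rule abelian_group.additive_subgroupI[OF rees_group[OF L]])
  let ?L = "rees_module R M I L" and ?K = "rees_module R M I K"
  have ops: "zero ?L = (\<lambda>n. \<zero>\<^bsub>M\<^esub>)" "\<And>f g. f \<oplus>\<^bsub>?L\<^esub> g = (\<lambda>n. f n \<oplus>\<^bsub>M\<^esub> g n)" by (simp_all add: rees_module_def)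
  show sub: "carrier ?K \<subseteq> carrier ?L"
    using subsetD[OF pow_smult_mono[OF Ii L KL]] by (auto simp: rees_carrier)
  show "\<zero>\<^bsub>?L\<^esub> \<in> carrier ?K" using submodule_zero[OF pow_smult_submodule[OF Ii K]] by (simp add: ops rees_carrier)
  fix f assume f: "f \<in> carrier ?K"
  show "f \<oplus>\<^bsub>?L\<^esub> g \<in> carrier ?K" if "g \<in> carrier ?K" for g using rees_add_closed[OF K f that] by (simp add: ops)
  have c: "f n \<in> carrier M" for n by (rule rees_nth_carrier[OF K f])
  have mL: "(\<lambda>n. \<ominus>\<^bsub>M\<^esub> f n) \<in> carrier ?L" using rees_minus_closed[OF K f] sub by blast
  have "(\<lambda>n. \<ominus>\<^bsub>M\<^esub> f n) \<oplus>\<^bsub>?L\<^esub> f = \<zero>\<^bsub>?L\<^esub>" using c by (simp add: ops M.l_neg)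
  then have "\<ominus>\<^bsub>?L\<^esub> f = (\<lambda>n. \<ominus>\<^bsub>M\<^esub> f n)"
    by (rule abelian_group.minus_equality[OF rees_group[OF L] _ subsetD[OF sub f] mL])
  then show "\<ominus>\<^bsub>?L\<^esub> f \<in> carrier ?K" using rees_minus_closed[OF K f] by simp
qed

lemma monom_apply: "a \<in> carrier R \<Longrightarrow> monom (UP R) a k i = (if i = k then a else \<zero>)"
  by (simp add: UP_def)

lemma monom_smult:
  assumes a: "a \<in> carrier R" and f: "\<And>n. f n \<in> carrier M"
  shows "monom (UP R) a k \<odot>\<^bsub>rees_module R M I L\<^esub> f = (\<lambda>n. if k \<le> n then a \<odot>\<^bsub>M\<^esub> f (n - k) else \<zero>\<^bsub>M\<^esub>)"
proof
  fix n
  have "(monom (UP R) a k \<odot>\<^bsub>rees_module R M I L\<^esub> f) n = (\<Oplus>\<^bsub>M\<^esub>i\<in>{..n}. if i = k then a \<odot>\<^bsub>M\<^esub> f (n - i) else \<zero>\<^bsub>M\<^esub>)"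
    unfolding rees_module_def using a f by (simp add: monom_apply) (intro M.finsum_cong', auto)
  also have "\<dots> = (if k \<le> n then a \<odot>\<^bsub>M\<^esub> f (n - k) else \<zero>\<^bsub>M\<^esub>)"
  proof (cases "k \<le> n")
    case True
    then show ?thesis
      using M.add.finprod_singleton_swap[of k "{..n}" "\<lambda>i. a \<odot>\<^bsub>M\<^esub> f (n - i)"] a f by simp
  next
    case False
    then have "(\<Oplus>\<^bsub>M\<^esub>i\<in>{..n}. if i = k then a \<odot>\<^bsub>M\<^esub> f (n - i) else \<zero>\<^bsub>M\<^esub>) = \<zero>\<^bsub>M\<^esub>"
      by (intro M.add.finprod_one_eqI) auto
    then show ?thesis using False by simp
  qed
  finally show "(monom (UP R) a k \<odot>\<^bsub>rees_module R M I L\<^esub> f) n = (if k \<le> n then a \<odot>\<^bsub>M\<^esub> f (n - k) else \<zero>\<^bsub>M\<^esub>)" .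
qed

lemma monom_smult_closed:
  assumes L: "submodule L R M" and a: "a \<in> carrier R"
    and aL: "\<And>n x. x \<in> pow_smult R M I n L \<Longrightarrow> a \<odot>\<^bsub>M\<^esub> x \<in> pow_smult R M I (n + k) L"
    and f: "f \<in> carrier (rees_module R M I L)"
  shows "(\<lambda>n. if k \<le> n then a \<odot>\<^bsub>M\<^esub> f (n - k) else \<zero>\<^bsub>M\<^esub>) \<in> carrier (rees_module R M I L)" (is "?g \<in> _")
proof -
  have "?g n \<in> pow_smult R M I n L" for n
    using aL[OF rees_nth[OF f], of "n - k"] submodule_zero[OF pow_smult_submodule[OF Ii L]]
    by (cases "k \<le> n") simp_all
  moreover have "{n. ?g n \<noteq> \<zero>\<^bsub>M\<^esub>} \<subseteq> (\<lambda>n. n + k) ` {n. f n \<noteq> \<zero>\<^bsub>M\<^esub>}"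
  proof
    fix n assume "n \<in> {n. ?g n \<noteq> \<zero>\<^bsub>M\<^esub>}"
    then have "k \<le> n" "f (n - k) \<noteq> \<zero>\<^bsub>M\<^esub>" using a by (auto split: if_splits)
    then show "n \<in> (\<lambda>n. n + k) ` {n. f n \<noteq> \<zero>\<^bsub>M\<^esub>}" by (intro image_eqI[of _ _ "n - k"]) auto
  qed
  then have "finite {n. ?g n \<noteq> \<zero>\<^bsub>M\<^esub>}" by (rule finite_subset) (use f in \<open>simp add: rees_carrier\<close>)
  ultimately show ?thesis by (simp add: rees_carrier)
qed

lemma ypow_pow: "j \<in> {1..c} \<Longrightarrow> x \<in> carrier M \<Longrightarrow> y j [^] k \<odot>\<^bsub>M\<^esub> x = ypow j k x"
proof (induct k)
  case (Suc k)
  have yc: "y j \<in> carrier R" using y_closed Suc by blast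
  have "y j [^] Suc k \<odot>\<^bsub>M\<^esub> x = (y j \<otimes> y j [^] k) \<odot>\<^bsub>M\<^esub> x" using yc by (simp add: m_comm)
  also have "\<dots> = ypow j (Suc k) x" using yc Suc by (simp add: smult_assoc1)
  finally show ?case .
qed simp

text \<open>Powers of the monomial are the monomials with coefficient \<open>y j^k\<close> in degree
  \<open>k\<close>, and these act by a shift by \<open>k\<close>. Hence annihilation of G can be
  tested index by index; sequences concentrated at a single index yield the forward direction. The
  extra \<open>Suc\<close> comes from \<open>I^n (I N) = I^(n+1) N\<close>.\<close>

lemma monom_mem_radical_iff:
  assumes j: "j \<in> {1..c}"
  defines "T \<equiv> rees_algebra R (Idl (y ` {1..c}))"
    and "G \<equiv> rees_quotient R M I (carrier M) (ideal_smult R M I N)"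
  shows "monom (UP R) (y j) 1 \<in> ideal_radical T (annihilator T G (carrier G)) \<longleftrightarrow> nil j"
proof -
  let ?J = "Idl (y ` {1..c})" and ?IN = "ideal_smult R M I N"
  let ?L = "rees_module R M I (carrier M)" and ?K = "rees_module R M I ?IN"
  interpret U: UP_cring R "UP R" by (intro UP_cring.intro is_cring)
  have INs: "submodule ?IN R M" by (rule ideal_smult_submodule[OF Ii Ns])
  have INM: "?IN \<subseteq> carrier M" by (rule submoduleE(1)[OF INs])
  have PIN: "pow_smult R M I n ?IN = PN (Suc n)" for n unfolding PN_def by (rule pow_smult_Suc(1)[OF Ii Ns, symmetric])
  have yc: "y j \<in> carrier R" by (rule y_closed[OF j])
  have yJ: "y j \<in> ?J" using genideal_self[of "y ` {1..c}"] y_closed j by blast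
  have pJ: "y j [^] k \<in> ideal_power R ?J k" for k :: nat
  proof (induct k)
    case 0 then show ?case by (simp add: ideal_power_0)
  next
    case (Suc k) then show ?case using yJ by (simp add: ideal_power_Suc ideal_prod.prod)
  qed
  have monT: "monom (UP R) (y j [^] k) k \<in> carrier T" for k :: nat
  proof -
    have "monom (UP R) (y j [^] k) k \<in> up R" using U.monom_closed[of "y j [^] k" k] yc by (simp add: UP_def)
    moreover have "monom (UP R) (y j [^] k) k n \<in> ideal_power R ?J n" for n
      using pJ additive_subgroup.zero_closed[OF ideal.axioms(1)[OF ideal_power_ideal[OF J_ideal]]] yc
      by (simp add: monom_apply)
    ultimately show ?thesis by (simp add: T_def rees_algebra_def)
  qed
  have powT: "monom (UP R) (y j) 1 [^]\<^bsub>T\<^esub> k = monom (UP R) (y j [^] k) k" for k :: nat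
  proof -
    have "monom (UP R) (y j) 1 [^]\<^bsub>T\<^esub> k = monom (UP R) (y j) 1 [^]\<^bsub>UP R\<^esub> k"
      by (simp add: nat_pow_def T_def rees_algebra_def)
    then show ?thesis using U.monom_pow[OF yc, of 1 k] by simp
  qed
  have ann: "monom (UP R) (y j [^] k) k \<in> annihilator T G (carrier G) \<longleftrightarrow>
      (\<forall>n. \<forall>x\<in>PM n. ypow j k x \<in> PN (Suc (n + k)))" for k :: nat
  proof -
    let ?a = "y j [^] k" and ?p = "monom (UP R) (y j [^] k) k"
    have ac: "?a \<in> carrier R" using yc by simp
    have aL: "?a \<odot>\<^bsub>M\<^esub> x \<in> pow_smult R M I (n + k) (carrier M)" if "x \<in> pow_smult R M I n (carrier M)" for n x
      using ypow_PM[OF j, of x n k] ypow_pow[OF j submodule_carrier[OF PM_sub], of x n k] that by (simp add: PM_def)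
    have yPN: "ypow j k x \<in> PN (n + k)" if "x \<in> PN n" for n x
    proof (induct k)
      case (Suc k) then show ?case using I_PN[OF yI[OF j] Suc] by simp
    qed (use that in simp)
    have aK: "?a \<odot>\<^bsub>M\<^esub> x \<in> pow_smult R M I (n + k) ?IN" if "x \<in> pow_smult R M I n ?IN" for n x
      using yPN[of x "Suc n"] ypow_pow[OF j submodule_carrier[OF PN_sub], of x "Suc n" k] that by (simp add: PIN)
    have Lc: "f n \<in> carrier M" if "f \<in> carrier ?L" for f n
      by (rule rees_nth_carrier[OF Ms that])
    have KL: "carrier ?K \<subseteq> carrier ?L"
      by (rule additive_subgroup.a_subset[OF rees_subgroup[OF Ms INs INM]])
    have act: "?p \<odot>\<^bsub>?L\<^esub> f = (\<lambda>n. if k \<le> n then ?a \<odot>\<^bsub>M\<^esub> f (n - k) else \<zero>\<^bsub>M\<^esub>)" if "f \<in> carrier ?L" for f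
      by (rule monom_smult[OF ac Lc[OF that]])
    have iff: "smult G ?p (carrier ?K +>\<^bsub>?L\<^esub> f) = zero G \<longleftrightarrow> ?p \<odot>\<^bsub>?L\<^esub> f \<in> carrier ?K" if f: "f \<in> carrier ?L" for f
    proof -
      have pf: "?p \<odot>\<^bsub>?L\<^esub> f \<in> carrier ?L" unfolding act[OF f] by (rule monom_smult_closed[OF Ms ac aL f])
      have "smult G ?p (carrier ?K +>\<^bsub>?L\<^esub> f) = carrier ?K +>\<^bsub>?L\<^esub> (?p \<odot>\<^bsub>?L\<^esub> f)"
        unfolding G_def rees_quotient_def
      proof (rule smult_subquot[OF rees_group[OF Ms] rees_subgroup[OF Ms INs INM] f pf])
        fix h assume h: "h \<in> carrier ?K"
        then have hL: "h \<in> carrier ?L" using KL by blast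
        show "?p \<odot>\<^bsub>?L\<^esub> h \<in> carrier ?K" unfolding act[OF hL] by (rule monom_smult_closed[OF INs ac aK h])
        have add: "\<And>f g. f \<oplus>\<^bsub>?L\<^esub> g = (\<lambda>n. f n \<oplus>\<^bsub>M\<^esub> g n)" by (simp add: rees_module_def)
        have hf: "h \<oplus>\<^bsub>?L\<^esub> f \<in> carrier ?L" unfolding add by (rule rees_add_closed[OF Ms hL f])
        show "?p \<odot>\<^bsub>?L\<^esub> (h \<oplus>\<^bsub>?L\<^esub> f) = ?p \<odot>\<^bsub>?L\<^esub> h \<oplus>\<^bsub>?L\<^esub> ?p \<odot>\<^bsub>?L\<^esub> f"
          unfolding act[OF hf] act[OF hL] act[OF f] unfolding add
          using Lc[OF hL] Lc[OF f] ac by (auto simp: smult_r_distr)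
      qed
      moreover have "zero G = carrier ?K" by (simp add: G_def rees_quotient_def subquot_def)
      ultimately show ?thesis
        using abelian_group.coset_eq_iff[OF rees_group[OF Ms] rees_subgroup[OF Ms INs INM] pf] by simp
    qed
    have carG: "carrier G = (\<lambda>f. carrier ?K +>\<^bsub>?L\<^esub> f) ` carrier ?L" by (simp add: G_def rees_quotient_def subquot_def)
    have "?p \<in> annihilator T G (carrier G) \<longleftrightarrow> (\<forall>f\<in>carrier ?L. ?p \<odot>\<^bsub>?L\<^esub> f \<in> carrier ?K)"
      using monT iff unfolding annihilator_def carG by simp
    also have "\<dots> \<longleftrightarrow> (\<forall>n. \<forall>x\<in>PM n. ypow j k x \<in> PN (Suc (n + k)))"
    proof (intro iffI allI ballI)
      fix n x assume all: "\<forall>f\<in>carrier ?L. ?p \<odot>\<^bsub>?L\<^esub> f \<in> carrier ?K" and x: "x \<in> PM n"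
      define f where "f i = (if i = n then x else \<zero>\<^bsub>M\<^esub>)" for i
      have "{i. f i \<noteq> \<zero>\<^bsub>M\<^esub>} \<subseteq> {n}" by (auto simp: f_def)
      then have "finite {i. f i \<noteq> \<zero>\<^bsub>M\<^esub>}" by (rule finite_subset) simp
      then have f: "f \<in> carrier ?L"
        using x submodule_zero[OF pow_smult_submodule[OF Ii Ms]] by (simp add: rees_carrier f_def PM_def)
      then have "(?p \<odot>\<^bsub>?L\<^esub> f) (n + k) \<in> PN (Suc (n + k))" using all by (simp add: rees_carrier PIN)
      then show "ypow j k x \<in> PN (Suc (n + k))"
        unfolding act[OF f] using ypow_pow[OF j submodule_carrier[OF PM_sub x]] by (simp add: f_def)
    next
      fix f assume all: "\<forall>n. \<forall>x\<in>PM n. ypow j k x \<in> PN (Suc (n + k))" and f: "f \<in> carrier ?L"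
      have "(?p \<odot>\<^bsub>?L\<^esub> f) n \<in> PN (Suc n)" for n
      proof (cases "k \<le> n")
        case True
        have "f (n - k) \<in> PM (n - k)" using f by (simp add: rees_carrier PM_def)
        then have "ypow j k (f (n - k)) \<in> PN (Suc (n - k + k))" using all by blast
        then show ?thesis unfolding act[OF f] using True ypow_pow[OF j Lc[OF f]] by simp
      next
        case False
        then show ?thesis unfolding act[OF f] using submodule_zero[OF PN_sub] by simp
      qed
      moreover have "?p \<odot>\<^bsub>?L\<^esub> f \<in> carrier ?L" unfolding act[OF f] by (rule monom_smult_closed[OF Ms ac aL f])
      ultimately show "?p \<odot>\<^bsub>?L\<^esub> f \<in> carrier ?K" by (simp add: rees_carrier PIN)
    qed
    finally show ?thesis .
  qed
  have "monom (UP R) (y j) 1 \<in> carrier T" using monT[of 1] yc by simp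
  then show ?thesis unfolding ideal_radical_def nil_def mem_Collect_eq powT ann by simp
qed

end

section \<open>Assembly of the three claims\<close>

theorem theorem2p14:
  fixes R :: "('a, 'k) ring_scheme" and Rgr :: "nat \<Rightarrow> 'a set"
    and M :: "('a, 'b, 'l) module_scheme" and Mgr :: "int \<Rightarrow> 'b set"
    and x y :: "nat \<Rightarrow> 'a" and deg_x deg_y :: "nat \<Rightarrow> nat" and d c \<gamma> :: nat
    and I J :: "'a set" and N :: "'b set"
  assumes "noetherian_ring R"
    and "graded_ring R Rgr"
    and "\<forall>i\<in>{1..d}. x i \<in> Rgr (deg_x i) \<and> 1 \<le> deg_x i"
    and "generate_ring R (Rgr 0 \<union> x ` {1..d}) = carrier R"
    and "graded_module R Rgr M Mgr"
    and "fin_gen_module R M"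
    and "graded_submodule R M Mgr N"
    and "homogeneous_ideal R Rgr I"
    and "reduction_ideal R J I"
    and "\<forall>j\<in>{1..c}. y j \<in> Rgr (deg_y j)"
    and "mono_on {1..c} deg_y"
    and "J = Idl\<^bsub>R\<^esub> (y ` {1..c})"
    and "module_colon M I = {\<zero>\<^bsub>M\<^esub>}"
    and \<gamma>: "\<gamma> = Inf {j. 1 \<le> j \<and> j \<le> c \<and> monom (UP R) (y j) 1 \<notin>
          ideal_radical (rees_algebra R J)
            (annihilator (rees_algebra R J)
              (rees_quotient R M I (carrier M) (ideal_smult R M I N))
              (carrier (rees_quotient R M I (carrier M) (ideal_smult R M I N))))}"
  shows
    "(\<forall>p \<in> asymp_Ass_A R M N I. I \<subseteq> p \<longrightarrow>
        (\<exists>a \<in> deg_y ` {1..c}.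
          eventually_linear
            (\<lambda>n. v_number_at R (subquot M (carrier M) (pow_smult R M I n N))
                   (subquot_gr M Mgr (carrier M) (pow_smult R M I n N)) p) a) \<and>
        (asymp_Ass_B R M (ideal_smult R M I N) I = asymp_Ass_A R M N I \<longrightarrow>
          (\<forall>\<^sub>F n in sequentially.
            v_number_at R
              (subquot M (pow_smult R M I n (carrier M)) (pow_smult R M I (n + 1) N))
              (subquot_gr M Mgr (pow_smult R M I n (carrier M)) (pow_smult R M I (n + 1) N)) p =
            v_number_at R
              (subquot M (carrier M) (pow_smult R M I (n + 1) N))
              (subquot_gr M Mgr (carrier M) (pow_smult R M I (n + 1) N)) p)))
     \<and>
     (asymp_Ass_A R M N I \<noteq> {} \<and> (\<exists>n0. pow_smult R M I n0 (carrier M) \<subseteq> N) \<longrightarrow>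
        \<gamma> \<in> {1..c} \<and>
        eventually_linear
          (\<lambda>n. indeg
             (subquot M (pow_smult R M I n (carrier M)) (pow_smult R M I (n + 1) N))
             (subquot_gr M Mgr (pow_smult R M I n (carrier M)) (pow_smult R M I (n + 1) N)))
          (deg_y \<gamma>) \<and>
        eventually_linear
          (\<lambda>n. v_number R
             (subquot M (pow_smult R M I n (carrier M)) (pow_smult R M I (n + 1) N))
             (subquot_gr M Mgr (pow_smult R M I n (carrier M)) (pow_smult R M I (n + 1) N)))
          (deg_y \<gamma>) \<and>
        eventually_linear
          (\<lambda>n. v_number R
             (subquot M (carrier M) (pow_smult R M I (n + 1) N))
             (subquot_gr M Mgr (carrier M) (pow_smult R M I (n + 1) N)))
          (deg_y \<gamma>) \<and>
        (asymp_Ass_B R M (ideal_smult R M I N) I = asymp_Ass_A R M N I \<longrightarrow>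
          (\<forall>\<^sub>F n in sequentially.
            v_number R
              (subquot M (pow_smult R M I n (carrier M)) (pow_smult R M I (n + 1) N))
              (subquot_gr M Mgr (pow_smult R M I n (carrier M)) (pow_smult R M I (n + 1) N)) =
            v_number R
              (subquot M (carrier M) (pow_smult R M I (n + 1) N))
              (subquot_gr M Mgr (carrier M) (pow_smult R M I (n + 1) N)))))
     \<and>
     (asymp_Ass_A R M N I \<noteq> {} \<and> (\<exists>n0. pow_smult R M I n0 (carrier M) \<subseteq> N) \<and>
      module_colon M {y 1} = {\<zero>\<^bsub>M\<^esub>} \<and> 1 \<le> deg_y 1 \<longrightarrow>
        deg_y \<gamma> = deg_y 1)"
proof -
  obtain m where "asymptotic_v R Rgr M Mgr y c deg_y I N m"
  proof -
    interpret graded_module R Rgr M Mgr by fact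
    obtain m where red: "ideal_prod R J (ideal_power R I m) = ideal_power R I (Suc m)"
      using assms(9) by (auto simp: reduction_ideal_def)
    have yh: "y j \<in> Rgr (deg_y j)" and yR: "y j \<in> carrier R" if "j \<in> {1..c}" for j
      using assms(10) that Rg.C_carrier by blast+
    have "y ` {1..c} \<subseteq> J" unfolding assms(12) by (rule genideal_self) (use yR in blast)
    moreover have "J \<subseteq> I" using assms(9) by (simp add: reduction_ideal_def)
    ultimately have yI: "y j \<in> I" if "j \<in> {1..c}" for j using that by blast
    have nm: "noetherian_module R M"
      by (intro noetherian_module.intro noetherian_module_axioms.intro module_axioms assms(1,6))
    have ms: "module_seq R M y c"
      by (intro module_seq.intro module_seq_axioms.intro module_axioms yR)
    have gs: "graded_module_seq R Rgr M Mgr y c deg_y"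
      by (intro graded_module_seq.intro graded_module_seq_axioms.intro noeth_module_seq.intro
          graded_module_axioms nm ms yh assms(11))
    have "asymptotic_v R Rgr M Mgr y c deg_y I N m"
      by (intro asymptotic_v.intro asymptotic_v_axioms.intro gs yI graded_ideal_homogeneous
          gsub_graded_submodule assms(7,8,13) red[unfolded assms(12)])
    then show thesis by (rule that)
  qed
  then interpret V: asymptotic_v R Rgr M Mgr y c deg_y I N m .
  note fold = V.PM_def[symmetric] V.PN_def[symmetric] Suc_eq_plus1[symmetric]
  note v_at = V.v_number_at_subquot[OF V.PN_sub V.Ms] V.v_number_at_subquot[OF V.PN_sub V.PM_sub]
  note v_num = V.v_number_subquot[OF V.PN_sub V.Ms] V.v_number_subquot[OF V.PN_sub V.PM_sub]
  let ?A = "asymp_Ass_A R M N I"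
  obtain k S where S: "\<And>n. n \<ge> k \<Longrightarrow> V.ass (carrier M) (V.PN n) = S" using V.ass_M_stable by blast
  have "Ass R (subquot M (carrier M) (pow_smult R M I n N)) = S" if "n \<ge> k" for n
    unfolding fold using V.Ass_subquot[OF V.PN_sub V.Ms] S[OF that] by simp
  then have A: "?A = S"
    unfolding asymp_Ass_A_def by (intro eventual_value_eqI) (auto simp: eventually_sequentially)
  obtain n1 where *: "\<forall>n\<ge>n1. \<forall>p. I \<subseteq> p \<longrightarrow>
      V.vset (carrier M) (V.PN (Suc n)) p = V.vset (V.PN n) (V.PN (Suc n)) p \<and>
      V.vset (carrier M) (V.PN (Suc n)) p = V.vset (V.PM n) (V.PN (Suc n)) p"
    using V.vset_eventually_eq by (rule exE)
  have n1: "V.vset (carrier M) (V.PN (Suc n)) p = V.vset (V.PM n) (V.PN (Suc n)) p"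
    if "n \<ge> n1" "I \<subseteq> p" for n p using *[rule_format, OF that] by (rule conjunct2)
  have part1: "(\<exists>a \<in> deg_y ` {1..c}. eventually_linear
        (\<lambda>n. v_number_at R (subquot M (carrier M) (V.PN n)) (subquot_gr M Mgr (carrier M) (V.PN n)) p) a) \<and>
      (\<forall>\<^sub>F n in sequentially.
        v_number_at R (subquot M (V.PM n) (V.PN (Suc n))) (subquot_gr M Mgr (V.PM n) (V.PN (Suc n))) p =
        v_number_at R (subquot M (carrier M) (V.PN (Suc n))) (subquot_gr M Mgr (carrier M) (V.PN (Suc n))) p)"
    if p: "p \<in> ?A" and Ip: "I \<subseteq> p" for p
  proof
    have "\<forall>\<^sub>F n in sequentially. p \<in> V.ass (carrier M) (V.PN n)"
      unfolding eventually_sequentially using S p A by blast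
    from V.v_at_linear[OF this Ip] obtain a where a: "a \<in> deg_y ` {1..c}"
      "lin_min (\<lambda>n. V.vset (carrier M) (V.PN n) p) a" by blast
    show "\<exists>a \<in> deg_y ` {1..c}. eventually_linear
        (\<lambda>n. v_number_at R (subquot M (carrier M) (V.PN n)) (subquot_gr M Mgr (carrier M) (V.PN n)) p) a"
      unfolding v_at using a(1) lin_min_INF[OF a(2)] by blast
    show "\<forall>\<^sub>F n in sequentially.
        v_number_at R (subquot M (V.PM n) (V.PN (Suc n))) (subquot_gr M Mgr (V.PM n) (V.PN (Suc n))) p =
        v_number_at R (subquot M (carrier M) (V.PN (Suc n))) (subquot_gr M Mgr (carrier M) (V.PN (Suc n))) p"
      unfolding v_at eventually_sequentially using n1[OF _ Ip] by (intro exI[of _ n1]) simp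
  qed
  have nil_set: "\<gamma> = Inf {j. 1 \<le> j \<and> j \<le> c \<and> \<not> V.nil j}"
  proof -
    have "{j. 1 \<le> j \<and> j \<le> c \<and> \<not> V.nil j} = {j. 1 \<le> j \<and> j \<le> c \<and> monom (UP R) (y j) 1 \<notin>
          ideal_radical (rees_algebra R J)
            (annihilator (rees_algebra R J)
              (rees_quotient R M I (carrier M) (ideal_smult R M I N))
              (carrier (rees_quotient R M I (carrier M) (ideal_smult R M I N))))}"
      using V.monom_mem_radical_iff unfolding assms(12) by (intro Collect_cong) auto
    then show ?thesis using \<gamma> by simp
  qed
  have part2: "\<gamma> \<in> {1..c} \<and>
      eventually_linear (\<lambda>n. indeg (subquot M (V.PM n) (V.PN (Suc n))) (subquot_gr M Mgr (V.PM n) (V.PN (Suc n)))) (deg_y \<gamma>) \<and>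
      eventually_linear (\<lambda>n. v_number R (subquot M (V.PM n) (V.PN (Suc n))) (subquot_gr M Mgr (V.PM n) (V.PN (Suc n)))) (deg_y \<gamma>) \<and>
      eventually_linear (\<lambda>n. v_number R (subquot M (carrier M) (V.PN (Suc n))) (subquot_gr M Mgr (carrier M) (V.PN (Suc n)))) (deg_y \<gamma>) \<and>
      (\<forall>\<^sub>F n in sequentially.
        v_number R (subquot M (V.PM n) (V.PN (Suc n))) (subquot_gr M Mgr (V.PM n) (V.PN (Suc n))) =
        v_number R (subquot M (carrier M) (V.PN (Suc n))) (subquot_gr M Mgr (carrier M) (V.PN (Suc n))))"
    if ne: "?A \<noteq> {}" and n0: "V.PM n0 \<subseteq> N" for n0
  proof -
    note Isub = V.I_subset_ass[OF n0]
    obtain p where p: "p \<in> S" using ne A by blast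
    have pp: "primeideal p R" "I \<subseteq> p" using p S[OF le_refl] Isub by (auto simp: V.ass_def)
    \<comment> \<open>The prime \<open>p\<close> contains \<open>I\<close>, so by \<open>n1\<close>
      a homogeneous element with annihilator \<open>p\<close> can be found in
      \<open>I^(m+n) M\<close>. It lies outside \<open>B\<close> because \<open>p\<close> is
      proper.\<close>
    have "V.degs V.E V.B n \<noteq> {}" if n: "n \<ge> max n1 k" for n
    proof -
      have "p \<in> V.ass (carrier M) (V.B n)" using S[of "Suc (m + n)"] p n by simp
      then have "V.vset (carrier M) (V.B n) p \<noteq> {}" by (rule V.vset_nonempty(1)[OF V.PN_gsub _ V.gsub_carrier])
      then have "V.vset (V.E n) (V.B n) p \<noteq> {}" using n1[of "m + n" p] pp(2) n by simp
      then show ?thesis using V.vset_degs[OF pp(1), of n] by blast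
    qed
    then have ev: "\<forall>\<^sub>F n in sequentially. V.degs V.E V.B n \<noteq> {}" unfolding eventually_sequentially by blast
    note slope = V.indeg_slope[OF ev nil_set]
    have "lin_min (\<lambda>n. {u. \<not> V.PM (n + m) \<inter> Mgr u \<subseteq> V.PN (Suc (n + m))}) (deg_y \<gamma>)"
      using slope(3) by (simp add: V.degs_def[abs_def] add.commute)
    then have ind: "lin_min (\<lambda>n. {u. \<not> V.PM n \<inter> Mgr u \<subseteq> V.PN (Suc n)}) (deg_y \<gamma>)"
      by (rule lin_min_shift[of "\<lambda>n. {u. \<not> V.PM n \<inter> Mgr u \<subseteq> V.PN (Suc n)}" m])
    let ?U = "\<lambda>n. \<Union>p\<in>V.ass (V.PM n) (V.PN (Suc n)). V.vset (V.PM n) (V.PN (Suc n)) p"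
    let ?U' = "\<lambda>n. \<Union>p\<in>V.ass (carrier M) (V.PN (Suc n)). V.vset (carrier M) (V.PN (Suc n)) p"
    have "lin_min (\<lambda>n. ?U (n + m)) (deg_y \<gamma>)"
      using V.v_slope[OF slope] by (simp add: add.commute)
    then have v: "lin_min ?U (deg_y \<gamma>)" by (rule lin_min_shift[of ?U m])
    \<comment> \<open>Every associated prime of \<open>M/I^(n+1) N\<close> contains
      \<open>I\<close>, so the uniform bound \<open>n1\<close> applies to all of them at
      once.\<close>
    have UU: "?U n = ?U' n" if n: "n \<ge> n1" for n
    proof -
      have eq: "V.vset (carrier M) (V.PN (Suc n)) q = V.vset (V.PM n) (V.PN (Suc n)) q" if "q \<in> V.ass (carrier M) (V.PN (Suc n))" for q
        by (rule n1[OF n Isub[OF that]])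
      have sub: "V.ass (V.PM n) (V.PN (Suc n)) \<subseteq> V.ass (carrier M) (V.PN (Suc n))"
        using V.submodule_carrier[OF V.PM_sub] by (auto simp: V.ass_def)
      have "V.ass (carrier M) (V.PN (Suc n)) \<subseteq> V.ass (V.PM n) (V.PN (Suc n))"
      proof
        fix q assume q: "q \<in> V.ass (carrier M) (V.PN (Suc n))"
        have "V.vset (carrier M) (V.PN (Suc n)) q \<noteq> {}" by (rule V.vset_nonempty(1)[OF V.PN_gsub q V.gsub_carrier])
        moreover have "primeideal q R" using q by (simp add: V.ass_def)
        ultimately show "q \<in> V.ass (V.PM n) (V.PN (Suc n))" using V.ass_vset eq[OF q] by simp
      qed
      then have "V.ass (V.PM n) (V.PN (Suc n)) = V.ass (carrier M) (V.PN (Suc n))" using sub by blast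
      then show ?thesis using eq by auto
    qed
    then have evU: "\<forall>\<^sub>F n in sequentially. ?U n = ?U' n" unfolding eventually_sequentially by blast
    have v': "lin_min ?U' (deg_y \<gamma>)" by (rule lin_min_cong[OF v evU])
    have "\<forall>\<^sub>F n in sequentially.
        v_number R (subquot M (V.PM n) (V.PN (Suc n))) (subquot_gr M Mgr (V.PM n) (V.PN (Suc n))) =
        v_number R (subquot M (carrier M) (V.PN (Suc n))) (subquot_gr M Mgr (carrier M) (V.PN (Suc n)))"
      unfolding v_num using evU by eventually_elim simp
    then show ?thesis
      using slope(1) lin_min_INF[OF ind] lin_min_INF[OF v] lin_min_INF[OF v']
      unfolding V.indeg_subquot[OF V.PN_sub V.PM_sub] v_num by blast
  qed
  have part3: "deg_y \<gamma> = deg_y 1"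
    if ne: "?A \<noteq> {}" and n0: "V.PM n0 \<subseteq> N" and inj: "module_colon M {y 1} = {\<zero>\<^bsub>M\<^esub>}" and d1: "1 \<le> deg_y 1" for n0
  proof -
    have \<gamma>c: "\<gamma> \<in> {1..c}" using part2[OF ne n0] by blast
    \<comment> \<open>An associated prime exists, so \<open>M\<close> is not zero. This provides the
      element of lowest degree on which \<open>not_nil_1\<close> depends.\<close>
    have "carrier M \<noteq> {\<zero>\<^bsub>M\<^esub>}"
    proof
      assume M0: "carrier M = {\<zero>\<^bsub>M\<^esub>}"
      obtain p where "p \<in> S" using ne A by blast
      then have "p \<in> V.ass (carrier M) (V.PN k)" using S by simp
      moreover have "V.PN k = carrier M"
        using V.submodule_zero[OF V.PN_sub[of k]] V.submoduleE(1)[OF V.PN_sub[of k]] unfolding M0 by auto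
      ultimately show False using V.ass_self[OF V.Ms] by simp
    qed
    then have "\<not> V.nil 1" by (intro V.not_nil_1[OF _ inj d1]) (use \<gamma>c in simp)
    then have "1 \<in> {j. 1 \<le> j \<and> j \<le> c \<and> \<not> V.nil j}" using \<gamma>c by simp
    then have "\<gamma> \<le> 1" unfolding nil_set by (rule wellorder_Inf_le1)
    then show ?thesis using \<gamma>c by simp
  qed
  show ?thesis
    unfolding fold
    apply (intro conjI ballI impI)
    subgoal by (drule (1) part1) (rule conjunct1)
    subgoal by (drule (1) part1) (rule conjunct2)
    subgoal by (elim conjE exE) (drule (1) part2, elim conjE)
    subgoal by (elim conjE exE) (drule (1) part2, elim conjE)
    subgoal by (elim conjE exE) (drule (1) part2, elim conjE)
    subgoal by (elim conjE exE) (drule (1) part2, elim conjE)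
    subgoal by (elim conjE exE) (drule (1) part2, elim conjE)
    subgoal by (elim conjE exE) (rule part3)
    done
qed

end
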